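(* Let $k\ge 4$ and let $\Omega\subset\mathbb{R}^2$ be a simply connected bounded domain. Let $u=\nabla^\perp\psi$, $B=\nabla^\perp A$, with pressure $p$, together with $\Omega$, be a $C^k$ steady free boundary MHD solution with trivial external field and current, i.e. $$u\cdot\nabla u-B\cdot\nabla B=-\nabla p,\qquad u\cdot\nabla B-B\cdot\nabla u=0,\qquad \nabla\cdot B=\nabla\cdot u=0\qquad\text{in }\Omega,$$ $$p=0,\qquad B\cdot\hat n=0,\qquad u\cdot\hat n=0\qquad\text{on }\partial\Omega .$$ Suppose that $B$ is non-vanishing except at a single point $x_*\in\Omega$, and that the travel time $\mu$ of $A$ is $k$-times differentiable. Suppose additionally that $|B|\neq|u|$ away from the null point $x_*$ and that $\lim_{x\to x_*}|u(x)|/|B(x)|\neq 1$. Then, up to a translation, $\Omega=B_R(0)$ with $R$ such that $\mathrm{vol}(B_R(0))=\mathrm{vol}(\Omega)$, and the velocity and magnetic field are circular, i.e. $A=A(r)$ and $\psi=\psi(r)$ are functions of the distance $r$ to the center only.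
   Context: $\nabla^\perp=(-\partial_2,\partial_1)$ and $\hat n$ is the unit outward normal to $\partial\Omega$. The scalar functions $\psi$ (streamfunction) and $A$ (magnetic potential) are constant on $\partial\Omega$ because $u$ and $B$ are tangent to it; $A$ is normalized so that $A=0$ on $\partial\Omega$. A $C^k$ solution means $u,B$ are of class $C^k$. The travel time of $A$ is $$\mu(a)=\oint_{\{A=a\}}\frac{\mathrm{d}\ell}{|\nabla A|}$$ for $a$ in the range of $A$ (at the value of $A$ at the null point it is understood by extension); the differentiability assumption is on the whole range of $A$. $B_R(0)$ is the disk of radius $R$ centered at $0$. *)

theory Defs
  imports "HOL-Analysis.Analysis"
begin

section \<open>Regularity classes\<close>

text \<open>On the closure \<open>S\<close> of a \<open>C\<^sup>1\<close> domain, derivatives within \<open>S\<close> are unique also at boundary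
  points, and this is the usual class \<open>C\<^sup>k(S)\<close> of functions all of whose partial derivatives
  up to order \<open>k\<close> extend continuously to \<open>S\<close>; \<open>g i\<close> is the partial derivative in direction \<open>i\<close>.\<close>

primrec Ck_on :: "nat \<Rightarrow> 'a::euclidean_space set \<Rightarrow> ('a \<Rightarrow> 'b::real_normed_vector) \<Rightarrow> bool" where
  "Ck_on 0 S f \<longleftrightarrow> continuous_on S f"
| "Ck_on (Suc k) S f \<longleftrightarrow>
     (\<exists>g. (\<forall>x\<in>S. (f has_derivative (\<lambda>h. \<Sum>i\<in>Basis. (h \<bullet> i) *\<^sub>R g i x)) (at x within S)) \<and>
          (\<forall>i\<in>Basis. Ck_on k S (g i)))"

primrec times_differentiable_on :: "nat \<Rightarrow> real set \<Rightarrow> (real \<Rightarrow> real) \<Rightarrow> bool" where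
  "times_differentiable_on 0 S f \<longleftrightarrow> True"
| "times_differentiable_on (Suc k) S f \<longleftrightarrow>
     (\<exists>f'. (\<forall>x\<in>S. (f has_real_derivative f' x) (at x within S)) \<and>
           times_differentiable_on k S f')"


section \<open>Vector calculus in the plane\<close>

text \<open>The filter argument is \<open>at x\<close> or \<open>at x within S\<close>, as for \<open>frechet_derivative\<close>.\<close>

definition grad :: "(real^2 \<Rightarrow> real) \<Rightarrow> (real^2) filter \<Rightarrow> real^2" where
  "grad f F = (\<chi> i. frechet_derivative f F (axis i 1))"

definition perp :: "real^2 \<Rightarrow> real^2" where
  "perp v = vector [- (v $ 2), v $ 1]"

definition divergence :: "(real^2 \<Rightarrow> real^2) \<Rightarrow> real^2 \<Rightarrow> real" where
  "divergence v x = (\<Sum>i\<in>UNIV. frechet_derivative v (at x) (axis i 1) $ i)"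

text \<open>\<open>(v \<cdot> \<nabla>) w\<close> at \<open>x\<close>\<close>

definition advect :: "(real^2 \<Rightarrow> real^2) \<Rightarrow> (real^2 \<Rightarrow> real^2) \<Rightarrow> real^2 \<Rightarrow> real^2" where
  "advect v w x = frechet_derivative w (at x) (v x)"

text \<open>\<open>f\<close> is a potential of \<open>v\<close>, up to the boundary: \<open>v = \<nabla>\<^sup>\<bottom> f\<close> on \<open>S\<close>.\<close>

definition is_stream_function :: "(real^2) set \<Rightarrow> (real^2 \<Rightarrow> real) \<Rightarrow> (real^2 \<Rightarrow> real^2) \<Rightarrow> bool" where
  "is_stream_function S f v \<longleftrightarrow>
     (\<forall>x\<in>S. f differentiable (at x within S) \<and> v x = perp (grad f (at x within S)))"


section \<open>Domains with \<open>C\<^sup>1\<close> boundary and their outward normal\<close>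

text \<open>\<open>\<phi>\<close> is a \<open>C\<^sup>1\<close> function without critical points on the ball of radius \<open>r\<close> around \<open>x\<close>,
  with gradient \<open>g\<close>, and \<open>\<Omega>\<close> is \<open>{\<phi> < 0}\<close> there. If \<open>x\<close> is a boundary point, then
  \<open>\<phi> x = 0\<close> and \<open>g x\<close> points out of \<open>\<Omega>\<close>.\<close>

definition local_defining_function ::
  "(real^2) set \<Rightarrow> real^2 \<Rightarrow> real \<Rightarrow> (real^2 \<Rightarrow> real) \<Rightarrow> (real^2 \<Rightarrow> real^2) \<Rightarrow> bool" where
  "local_defining_function \<Omega> x r \<phi> g \<longleftrightarrow>
     r > 0 \<and>
     (\<forall>y\<in>ball x r. (\<phi> has_derivative (\<lambda>h. g y \<bullet> h)) (at y) \<and> g y \<noteq> 0) \<and>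
     continuous_on (ball x r) g \<and>
     \<Omega> \<inter> ball x r = {y \<in> ball x r. \<phi> y < 0}"

definition C1_boundary :: "(real^2) set \<Rightarrow> bool" where
  "C1_boundary \<Omega> \<longleftrightarrow> (\<forall>x\<in>frontier \<Omega>. \<exists>r \<phi> g. local_defining_function \<Omega> x r \<phi> g)"

definition outward_normal :: "(real^2) set \<Rightarrow> real^2 \<Rightarrow> real^2" where
  "outward_normal \<Omega> x =
     (THE n. \<exists>r \<phi> g. local_defining_function \<Omega> x r \<phi> g \<and> n = g x /\<^sub>R norm (g x))"


section \<open>Steady free boundary MHD\<close>

text \<open>External field and current are trivial, so the pressure balance on the boundary is \<open>p = 0\<close>.\<close>

definition steady_free_boundary_MHD ::
  "nat \<Rightarrow> (real^2) set \<Rightarrow> (real^2 \<Rightarrow> real^2) \<Rightarrow> (real^2 \<Rightarrow> real^2) \<Rightarrow> (real^2 \<Rightarrow> real) \<Rightarrow> bool" where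
  "steady_free_boundary_MHD k \<Omega> u B p \<longleftrightarrow>
     Ck_on k (closure \<Omega>) u \<and> Ck_on k (closure \<Omega>) B \<and>
     continuous_on (closure \<Omega>) p \<and>
     (\<forall>x\<in>\<Omega>. p differentiable (at x) \<and>
        advect u u x - advect B B x = - grad p (at x) \<and>
        advect u B x - advect B u x = 0 \<and>
        divergence B x = 0 \<and> divergence u x = 0) \<and>
     (\<forall>x\<in>frontier \<Omega>. p x = 0 \<and>
        B x \<bullet> outward_normal \<Omega> x = 0 \<and> u x \<bullet> outward_normal \<Omega> x = 0)"


section \<open>Travel time\<close>

definition regular_simple_closed_curve :: "(real \<Rightarrow> real^2) \<Rightarrow> bool" where
  "regular_simple_closed_curve \<gamma> \<longleftrightarrow>
     simple_path \<gamma> \<and> pathfinish \<gamma> = pathstart \<gamma> \<and> \<gamma> C1_differentiable_on {0..1} \<and>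
     (\<forall>t\<in>{0..1}. vector_derivative \<gamma> (at t) \<noteq> 0)"

text \<open>Integral with respect to arclength over a closed curve given as a set \<open>C\<close>; the value does
  not depend on the regular parametrization.\<close>

definition arclength_integral :: "(real^2) set \<Rightarrow> (real^2 \<Rightarrow> real) \<Rightarrow> real" where
  "arclength_integral C f =
     (THE I. \<exists>\<gamma>. regular_simple_closed_curve \<gamma> \<and> path_image \<gamma> = C \<and>
        ((\<lambda>t. f (\<gamma> t) * norm (vector_derivative \<gamma> (at t))) has_integral I) {0..1})"

definition travel_time :: "(real^2) set \<Rightarrow> (real^2 \<Rightarrow> real) \<Rightarrow> real \<Rightarrow> real" where
  "travel_time \<Omega> A a =
     arclength_integral {x \<in> closure \<Omega>. A x = a}
       (\<lambda>x. 1 / norm (grad A (at x within closure \<Omega>)))"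

end

theory Submission
  imports Defs "HOL-Complex_Analysis.Riemann_Mapping"
begin

text \<open>By the induction equation \<open>u \<times> B\<close> has zero gradient, and it vanishes at the null point, so
  \<open>u = \<lambda>B\<close> with \<open>\<lambda>\<close> constant along field lines. Then \<open>v = \<surd>\<bar>1 - \<lambda>\<^sup>2\<bar> B\<close> is, up to the sign of the
  pressure, a steady Euler flow; its stream function \<open>\<phi>\<close> is a function of \<open>A\<close>, has \<open>x\<^sub>*\<close> as its only
  critical point and vanishes on the boundary, where \<open>|\<nabla>\<phi>|\<close> is constant by Bernoulli's law and
  \<open>p = 0\<close>. The level sets of \<open>A\<close> are connected, because a superlevel set and its complement have
  only one component each: another one would contain a second critical point. Hence \<open>\<Delta>\<phi>\<close> is a
  function of \<open>\<phi>\<close>, locally Lipschitz below the maximum, and Serrin's moving plane method applies. The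
  planes cannot stop before they reach \<open>x\<^sub>*\<close>, since the reflection of \<open>x\<^sub>*\<close> would be critical as well;
  so \<open>\<phi>\<close> is symmetric with respect to every line through \<open>x\<^sub>*\<close>.\<close>

text \<open>The obstacle is low regularity at two places. At \<open>xs\<close> the factor \<lambda>
  has only a limit, so \<phi> is used there merely as a continuous function; differential statements
  live on the closure of \<Omega> without \<open>xs\<close>. This does no harm, since \<phi> has a
  strict maximum at \<open>xs\<close>: near a zero of the difference between \<phi> and its
  reflection both values stay below the maximum, so the mirror point avoids \<open>xs\<close>. At
  the boundary only \<open>C1_boundary\<close> is given, while Serrin's argument wants second order
  information. It comes from \<phi> itself: differentiability of its gradient at a boundary point
  yields interior tangent balls, and constancy of the length of the gradient kills the mixed second
  derivative where plane and boundary are orthogonal. Nothing is extended smoothly across the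
  boundary: \<phi> is extended by zero, and boundary behaviour is read off along rays entering
  \<Omega>. Connectedness of level sets matters because a gradient parallel to that of A makes a
  function only locally constant on the levels of A.\<close>

no_notation fps_nth (infixl \<open>$\<close> 75)

section \<open>Maximum principles\<close>

text \<open>The trace of the derivative of a gradient field. The gradient has to exist near
  \<open>x\<close> but to be differentiable at \<open>x\<close> only, so no continuity of second
  derivatives is involved.\<close>

definition has_laplacian :: "('a::euclidean_space \<Rightarrow> real) \<Rightarrow> real \<Rightarrow> 'a \<Rightarrow> bool" where
  "has_laplacian f L x \<longleftrightarrow>
     (\<exists>G K. (\<forall>\<^sub>F y in nhds x. (f has_derivative (\<lambda>h. G y \<bullet> h)) (at y)) \<and>
            (G has_derivative K) (at x) \<and> L = (\<Sum>i\<in>Basis. K i \<bullet> i))"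

lemma has_laplacianI_eventually:
  assumes "\<forall>\<^sub>F y in nhds x. (f has_derivative (\<lambda>h. G y \<bullet> h)) (at y)"
    and "(G has_derivative K) (at x)" "L = (\<Sum>i\<in>Basis. K i \<bullet> i)"
  shows "has_laplacian f L x"
  unfolding has_laplacian_def
  by (rule exI[of _ G], rule exI[of _ K]) (use assms in auto)

lemma has_laplacianI:
  assumes "open S" "x \<in> S" "\<And>y. y \<in> S \<Longrightarrow> (f has_derivative (\<lambda>h. G y \<bullet> h)) (at y)"
    and "(G has_derivative K) (at x)" "L = (\<Sum>i\<in>Basis. K i \<bullet> i)"
  shows "has_laplacian f L x"
  unfolding has_laplacian_def
  by (rule exI[of _ G], rule exI[of _ K]) (use assms in \<open>auto simp: eventually_nhds\<close>)

text \<open>One shape serves both the difference of a function and its mirror image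
  (\<open>a = -1\<close>) and a function minus a multiple of a barrier.\<close>

lemma has_laplacian_lincomb:
  assumes "has_laplacian f L x" "has_laplacian g M x"
  shows "has_laplacian (\<lambda>y. f y + a * g y) (L + a * M) x"
proof -
  obtain G K where 1: "\<forall>\<^sub>F y in nhds x. (f has_derivative (\<lambda>h. G y \<bullet> h)) (at y)"
      "(G has_derivative K) (at x)" "L = (\<Sum>i\<in>Basis. K i \<bullet> i)"
    using assms(1) unfolding has_laplacian_def by blast
  obtain G' K' where 2: "\<forall>\<^sub>F y in nhds x. (g has_derivative (\<lambda>h. G' y \<bullet> h)) (at y)"
      "(G' has_derivative K') (at x)" "M = (\<Sum>i\<in>Basis. K' i \<bullet> i)"
    using assms(2) unfolding has_laplacian_def by blast
  have "\<forall>\<^sub>F y in nhds x. ((\<lambda>y. f y + a * g y) has_derivative (\<lambda>h. (G y + a *\<^sub>R G' y) \<bullet> h)) (at y)"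
    using 1(1) 2(1)
    by eventually_elim (auto intro!: derivative_eq_intros simp: algebra_simps)
  moreover have "((\<lambda>y. G y + a *\<^sub>R G' y) has_derivative (\<lambda>h. K h + a *\<^sub>R K' h)) (at x)"
    by (intro derivative_intros 1 2)
  moreover have "L + a * M = (\<Sum>i\<in>Basis. (K i + a *\<^sub>R K' i) \<bullet> i)"
    by (simp add: 1(3) 2(3) inner_add_left sum.distrib sum_distrib_left)
  ultimately show ?thesis
    by (rule has_laplacianI_eventually)
qed

lemma has_laplacian_const: "has_laplacian (\<lambda>_. c) 0 x"
  by (rule has_laplacianI[of UNIV _ _ "\<lambda>_. 0" "\<lambda>_. 0"]) auto

text \<open>As \<open>g' 0 = 0\<close>, a negative \<open>k\<close> would make \<open>g'\<close>
  negative just to the right of 0, and the mean value theorem would give a value below the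
  minimum.\<close>

lemma second_derivative_nonneg_at_min:
  fixes g :: "real \<Rightarrow> real"
  assumes d: "\<forall>\<^sub>F t in nhds 0. (g has_real_derivative g' t) (at t)"
    and d2: "(g' has_real_derivative k) (at 0)"
    and min: "\<forall>\<^sub>F t in nhds 0. g t \<ge> g 0"
  shows "k \<ge> 0"
proof (rule ccontr)
  assume "\<not> k \<ge> 0"
  obtain r where r: "r > 0" "\<And>t. \<bar>t\<bar> < r \<Longrightarrow> (g has_real_derivative g' t) (at t)"
      "\<And>t. \<bar>t\<bar> < r \<Longrightarrow> g t \<ge> g 0"
    using eventually_conj[OF d min] unfolding eventually_nhds_metric by (auto simp: dist_real_def)
  have "g' 0 = 0"
    by (rule DERIV_local_min[OF r(2) r(1)]) (use r in auto)
  obtain s where s: "s > 0" "\<And>h. 0 < h \<Longrightarrow> h < s \<Longrightarrow> g' h < g' 0"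
    using DERIV_neg_dec_right[OF d2] \<open>\<not> k \<ge> 0\<close> by force
  define t where "t = min r s / 2"
  have t: "0 < t" "t < r" "t < s" using r s by (auto simp: t_def)
  obtain z where z: "0 < z" "z < t" "g t - g 0 = (t - 0) * g' z"
    using MVT2[of 0 t g g'] t r(2) by force
  have "g' z < 0" using s(2)[of z] z t \<open>g' 0 = 0\<close> by auto
  then have "g t < g 0" using z t by (smt (verit) mult_pos_neg)
  then show False using r(3)[of t] t by auto
qed

lemma has_laplacian_nonneg_at_min:
  assumes "has_laplacian f L x" "\<forall>\<^sub>F y in nhds x. f y \<ge> f x"
  shows "L \<ge> 0"
proof -
  obtain G K where 1: "\<forall>\<^sub>F y in nhds x. (f has_derivative (\<lambda>h. G y \<bullet> h)) (at y)"
      "(G has_derivative K) (at x)" "L = (\<Sum>i\<in>Basis. K i \<bullet> i)"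
    using assms(1) unfolding has_laplacian_def by blast
  have "K i \<bullet> i \<ge> 0" for i
  proof (rule second_derivative_nonneg_at_min)
    have lim: "filterlim (\<lambda>t. x + t *\<^sub>R i) (nhds x) (nhds (0::real))"
      by (auto intro!: tendsto_eq_intros filterlim_ident)
    show "\<forall>\<^sub>F t in nhds 0. ((\<lambda>t. f (x + t *\<^sub>R i)) has_real_derivative G (x + t *\<^sub>R i) \<bullet> i) (at t)"
      using eventually_compose_filterlim[OF 1(1) lim]
    proof eventually_elim
      case (elim t)
      have "((\<lambda>t. f (x + t *\<^sub>R i)) has_derivative (\<lambda>h. G (x + t *\<^sub>R i) \<bullet> (h *\<^sub>R i))) (at t)"
        by (rule has_derivative_compose[of "\<lambda>t. x + t *\<^sub>R i", OF _ elim]) (auto intro!: derivative_eq_intros)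
      then show ?case by (simp add: has_field_derivative_def mult_commute_abs)
    qed
    have "((\<lambda>t. G (x + t *\<^sub>R i)) has_derivative (\<lambda>h. K (h *\<^sub>R i))) (at 0)"
      by (rule has_derivative_compose[of "\<lambda>t. x + t *\<^sub>R i"]) (auto intro!: derivative_eq_intros 1)
    then have "((\<lambda>t. G (x + t *\<^sub>R i) \<bullet> i) has_derivative (\<lambda>h. K (h *\<^sub>R i) \<bullet> i)) (at 0)"
      by (auto intro!: derivative_eq_intros)
    then show "((\<lambda>t. G (x + t *\<^sub>R i) \<bullet> i) has_real_derivative K i \<bullet> i) (at 0)"
      using has_derivative_bounded_linear[OF 1(2)]
      by (simp add: has_field_derivative_def mult_commute_abs linear_simps)
    show "\<forall>\<^sub>F t in nhds 0. f (x + t *\<^sub>R i) \<ge> f (x + 0 *\<^sub>R i)"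
      using eventually_compose_filterlim[OF assms(2) lim] by simp
  qed
  then show ?thesis unfolding 1(3) by (intro sum_nonneg) auto
qed

text \<open>A negative minimum lies in \<open>U\<close>, where a negative Laplacian contradicts
  \<open>has_laplacian_nonneg_at_min\<close>. The Laplacian has to be negative only where
  \<open>g\<close> is; this lets later comparisons absorb a term \<open>C * w\<close> of either
  sign.\<close>

lemma minimum_principle:
  assumes "compact S" "continuous_on S g" "open U" "U \<subseteq> S"
    and "\<And>x. x \<in> S - U \<Longrightarrow> g x \<ge> 0"
    and "\<And>x. x \<in> U \<Longrightarrow> g x < 0 \<Longrightarrow> \<exists>L<0. has_laplacian g L x"
    and "x \<in> S"
  shows "g x \<ge> 0"
proof (rule ccontr)
  assume neg: "\<not> g x \<ge> 0"
  obtain m where m: "m \<in> S" "\<And>y. y \<in> S \<Longrightarrow> g m \<le> g y"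
    using continuous_attains_inf[OF assms(1) _ assms(2)] assms(7) by blast
  then have "g m < 0" using neg assms(7) by force
  then have "m \<in> U" using m assms(5)[of m] by force
  then obtain L where "L < 0" "has_laplacian g L m" using assms(6) \<open>g m < 0\<close> by blast
  moreover have "\<forall>\<^sub>F y in nhds m. g m \<le> g y"
    unfolding eventually_nhds using \<open>m \<in> U\<close> assms(3,4) m(2) by blast
  ultimately show False using has_laplacian_nonneg_at_min by force
qed

section \<open>Reflections in hyperplanes and the Laplacian\<close>

text \<open>For a unit vector \<open>e\<close>, the reflection in the hyperplane
  \<open>x \<bullet> e = a\<close>; \<open>reflect e 0\<close> is its linear part.\<close>

definition reflect :: "'a::real_inner \<Rightarrow> real \<Rightarrow> 'a \<Rightarrow> 'a" where
  "reflect e a x = x - (2 * (x \<bullet> e - a)) *\<^sub>R e"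

text \<open>The linear part \<open>R\<close> of the reflection is symmetric, so the new gradient is
  \<open>R\<close> applied to the reflected one and the new Hessian is \<open>R K R\<close>; since
  \<open>R\<close> is an involution, the trace is unchanged.\<close>

lemma has_laplacian_reflect:
  fixes e :: "'a::euclidean_space"
  assumes e: "norm e = 1" and f: "has_laplacian f L (reflect e a x)"
  shows "has_laplacian (\<lambda>y. f (reflect e a y)) L x"
proof -
  have ee: "e \<bullet> e = 1" using e by (simp add: dot_square_norm)
  define R where "R h = h - (2 * (h \<bullet> e)) *\<^sub>R e" for h
  have R: "bounded_linear R" unfolding R_def by (intro bounded_linear_intros)
  have sym: "R u \<bullet> v = u \<bullet> R v" for u v by (simp add: R_def algebra_simps inner_commute)
  have dR: "(reflect e a has_derivative R) (at y)" for y
    unfolding reflect_def R_def by (auto intro!: derivative_eq_intros)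
  obtain G K where 1: "\<forall>\<^sub>F y in nhds (reflect e a x). (f has_derivative (\<lambda>h. G y \<bullet> h)) (at y)"
      "(G has_derivative K) (at (reflect e a x))" "L = (\<Sum>i\<in>Basis. K i \<bullet> i)"
    using f unfolding has_laplacian_def by blast
  have "isCont (reflect e a) x" using dR has_derivative_continuous by blast
  then have lim: "filterlim (reflect e a) (nhds (reflect e a x)) (nhds x)"
    by (simp add: isCont_def tendsto_at_iff_tendsto_nhds)
  have A: "\<forall>\<^sub>F y in nhds x. ((\<lambda>y. f (reflect e a y)) has_derivative (\<lambda>h. R (G (reflect e a y)) \<bullet> h)) (at y)"
    using eventually_compose_filterlim[OF 1(1) lim]
  proof eventually_elim
    case (elim y)
    show ?case using has_derivative_compose[OF dR elim] by (simp add: sym)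
  qed
  have "((\<lambda>y. G (reflect e a y)) has_derivative (\<lambda>h. K (R h))) (at x)"
    by (rule has_derivative_compose[OF dR 1(2)])
  then have B: "((\<lambda>y. R (G (reflect e a y))) has_derivative (\<lambda>h. R (K (R h)))) (at x)"
    by (rule bounded_linear.has_derivative[OF R])
  have lK: "linear K" using 1(2) has_derivative_linear by blast
  \<comment> \<open>As \<open>R\<close> is the identity minus twice the projection on
    \<open>e\<close>, the corrections to the trace sum to -2, -2 and +4 times
    \<open>K e \<bullet> e\<close>.\<close>
  have KR: "K (R i) \<bullet> R i = K i \<bullet> i - 2 * ((e \<bullet> i) * (K e \<bullet> i)) - 2 * (K ((e \<bullet> i) *\<^sub>R i) \<bullet> e)
        + 4 * ((e \<bullet> i) * (e \<bullet> i)) * (K e \<bullet> e)" for i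
    by (simp add: R_def linear_diff[OF lK] linear_cmul[OF lK] inner_diff_left inner_diff_right
        inner_commute algebra_simps)
  have s1: "(\<Sum>i\<in>Basis. (e \<bullet> i) * (K e \<bullet> i)) = K e \<bullet> e"
    by (subst euclidean_inner[of "K e" e]) (simp add: mult.commute)
  have s2: "(\<Sum>i\<in>Basis. K ((e \<bullet> i) *\<^sub>R i) \<bullet> e) = K e \<bullet> e"
    unfolding inner_sum_left[symmetric] linear_sum[OF lK, symmetric] euclidean_representation ..
  have s3: "(\<Sum>i\<in>Basis. (e \<bullet> i) * (e \<bullet> i)) = 1"
    using ee by (simp flip: euclidean_inner)
  have "(\<Sum>i\<in>Basis. R (K (R i)) \<bullet> i) = L"
    unfolding sym KR sum.distrib sum_subtractf
    unfolding sum_distrib_left[symmetric] sum_distrib_right[symmetric] s1 s2 s3 1(3) by simp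
  then show ?thesis using has_laplacianI_eventually[OF A B] by simp
qed

section \<open>Gaussian barriers\<close>

lemma gaussian_gradient:
  fixes c :: "'a::euclidean_space"
  shows "((\<lambda>y. exp (- \<alpha> * ((y - c) \<bullet> (y - c)))) has_derivative
     (\<lambda>h. (- (2 * \<alpha> * exp (- \<alpha> * ((x - c) \<bullet> (x - c)))) *\<^sub>R (x - c)) \<bullet> h)) (at x)"
  by (auto intro!: derivative_eq_intros simp: algebra_simps inner_commute)

lemma has_laplacian_gaussian:
  fixes c :: "'a::euclidean_space"
  shows "has_laplacian (\<lambda>y. exp (- \<alpha> * ((y - c) \<bullet> (y - c))))
     (exp (- \<alpha> * ((x - c) \<bullet> (x - c))) * (4 * \<alpha>\<^sup>2 * ((x - c) \<bullet> (x - c)) - 2 * \<alpha> * DIM('a))) x"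
proof (rule has_laplacianI[OF open_UNIV UNIV_I gaussian_gradient])
  let ?E = "exp (- \<alpha> * ((x - c) \<bullet> (x - c)))"
  show "((\<lambda>x. - (2 * \<alpha> * exp (- \<alpha> * ((x - c) \<bullet> (x - c)))) *\<^sub>R (x - c)) has_derivative
      (\<lambda>h. (4 * \<alpha>\<^sup>2 * ?E * ((x - c) \<bullet> h)) *\<^sub>R (x - c) - (2 * \<alpha> * ?E) *\<^sub>R h)) (at x)"
    by (auto intro!: derivative_eq_intros simp: algebra_simps inner_commute power2_eq_square)
  have "(\<Sum>i\<in>Basis. ((x - c) \<bullet> i) * ((x - c) \<bullet> i)) = (x - c) \<bullet> (x - c)"
    by (simp flip: euclidean_inner)
  then show "?E * (4 * \<alpha>\<^sup>2 * ((x - c) \<bullet> (x - c)) - 2 * \<alpha> * DIM('a)) =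
    (\<Sum>i\<in>Basis. ((4 * \<alpha>\<^sup>2 * ?E * ((x - c) \<bullet> i)) *\<^sub>R (x - c) - (2 * \<alpha> * ?E) *\<^sub>R i) \<bullet> i)"
    by (simp add: inner_diff_left[of "_ *\<^sub>R _" "_ *\<^sub>R _"] sum_subtractf mult.assoc
        sum_distrib_left[symmetric] right_diff_distrib)
qed

text \<open>The bracket differs from that of the pure Gaussian by \<open>- 4 * \<alpha>\<close>, the
  cross term of the two gradients; \<open>b\<close> multiplies a linear function and contributes
  nothing to the Laplacian.\<close>

lemma has_laplacian_linear_gaussian:
  fixes c e :: "'a::euclidean_space"
  shows "has_laplacian (\<lambda>y. ((y - c) \<bullet> e) * (exp (- \<alpha> * ((y - c) \<bullet> (y - c))) - b))
     (((x - c) \<bullet> e) * exp (- \<alpha> * ((x - c) \<bullet> (x - c))) *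
       (4 * \<alpha>\<^sup>2 * ((x - c) \<bullet> (x - c)) - 2 * \<alpha> * DIM('a) - 4 * \<alpha>)) x"
proof (rule has_laplacianI[OF open_UNIV UNIV_I])
  let ?E = "\<lambda>x. exp (- \<alpha> * ((x - c) \<bullet> (x - c)))"
  show "((\<lambda>y. ((y - c) \<bullet> e) * (?E y - b)) has_derivative
       (\<lambda>h. ((?E y - b) *\<^sub>R e - (2 * \<alpha> * ((y - c) \<bullet> e) * ?E y) *\<^sub>R (y - c)) \<bullet> h)) (at y)" for y
    by (auto intro!: derivative_eq_intros simp: algebra_simps inner_commute)
  show "((\<lambda>y. (?E y - b) *\<^sub>R e - (2 * \<alpha> * ((y - c) \<bullet> e) * ?E y) *\<^sub>R (y - c)) has_derivative
      (\<lambda>h. - (2 * \<alpha> * ?E x * ((x - c) \<bullet> h)) *\<^sub>R e - (2 * \<alpha> * (h \<bullet> e) * ?E x) *\<^sub>R (x - c)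
        + (4 * \<alpha>\<^sup>2 * ((x - c) \<bullet> e) * ?E x * ((x - c) \<bullet> h)) *\<^sub>R (x - c) - (2 * \<alpha> * ((x - c) \<bullet> e) * ?E x) *\<^sub>R h)) (at x)"
    by (auto intro!: derivative_eq_intros simp: algebra_simps inner_commute power2_eq_square)
  have s: "(\<Sum>i\<in>Basis. (u \<bullet> i) * (v \<bullet> i)) = u \<bullet> v" for u v :: 'a
    by (simp flip: euclidean_inner)
  have s': "(\<Sum>i\<in>Basis. (i \<bullet> u) * (v \<bullet> i)) = u \<bullet> v" for u v :: 'a
    using s[of u v] by (simp add: inner_commute)
  have *: "(- (2 * \<alpha> * ?E x * ((x - c) \<bullet> i)) *\<^sub>R e - (2 * \<alpha> * (i \<bullet> e) * ?E x) *\<^sub>R (x - c)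
        + (4 * \<alpha>\<^sup>2 * ((x - c) \<bullet> e) * ?E x * ((x - c) \<bullet> i)) *\<^sub>R (x - c) - (2 * \<alpha> * ((x - c) \<bullet> e) * ?E x) *\<^sub>R i) \<bullet> i
     = - (2 * \<alpha> * ?E x) * (((x - c) \<bullet> i) * (e \<bullet> i)) - (2 * \<alpha> * ?E x) * ((i \<bullet> e) * ((x - c) \<bullet> i))
       + (4 * \<alpha>\<^sup>2 * ((x - c) \<bullet> e) * ?E x) * (((x - c) \<bullet> i) * ((x - c) \<bullet> i)) - (2 * \<alpha> * ((x - c) \<bullet> e) * ?E x)"
    if "i \<in> Basis" for i
  proof -
    have **: "(- p *\<^sub>R e - q *\<^sub>R y + r *\<^sub>R y - t *\<^sub>R i) \<bullet> i = - p * (e \<bullet> i) - q * (y \<bullet> i) + r * (y \<bullet> i) - t"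
      for p q r t :: real and y
      using that by (simp add: algebra_simps)
    show ?thesis unfolding ** by (simp add: algebra_simps)
  qed
  show "((x - c) \<bullet> e) * ?E x * (4 * \<alpha>\<^sup>2 * ((x - c) \<bullet> (x - c)) - 2 * \<alpha> * DIM('a) - 4 * \<alpha>) =
    (\<Sum>i\<in>Basis. (- (2 * \<alpha> * ?E x * ((x - c) \<bullet> i)) *\<^sub>R e - (2 * \<alpha> * (i \<bullet> e) * ?E x) *\<^sub>R (x - c)
        + (4 * \<alpha>\<^sup>2 * ((x - c) \<bullet> e) * ?E x * ((x - c) \<bullet> i)) *\<^sub>R (x - c) - (2 * \<alpha> * ((x - c) \<bullet> e) * ?E x) *\<^sub>R i) \<bullet> i)"
    by (rule trans[OF _ sum.cong[OF refl *[symmetric]]])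
       (simp_all only: sum.distrib sum_subtractf s s' sum_distrib_left[symmetric] sum_constant,
        simp add: algebra_simps inner_commute)
qed

text \<open>One exponent for both barriers: at distance at least \<rho>/2 from the centre the term
  quadratic in \<alpha> wins. The bracket is that of \<open>has_laplacian_linear_gaussian\<close>,
  the smaller of the two.\<close>

lemma barrier_exponent:
  fixes \<rho> C N :: real
  assumes "\<rho> > 0" "C \<ge> 0" "N \<ge> 0"
  obtains \<alpha> where "\<alpha> > 0" "\<And>q. q \<ge> \<rho>\<^sup>2 / 4 \<Longrightarrow> 4 * \<alpha>\<^sup>2 * q - 2 * \<alpha> * N - 4 * \<alpha> > C"
proof
  \<comment> \<open>For \<open>q \<ge> \<rho>\<^sup>2 / 4\<close> the leading term is at least
    \<open>\<alpha> * (2 * N + 4) + \<alpha> * (1 + C)\<close>, and \<alpha> \<ge> 1 makes the last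
    summand exceed \<open>C\<close>.\<close>
  define \<alpha> where "\<alpha> = max 1 ((2 * N + 5 + C) / \<rho>\<^sup>2)"
  have a: "\<alpha> \<ge> 1" "\<alpha> * \<rho>\<^sup>2 \<ge> 2 * N + 5 + C"
  proof -
    have "\<alpha> * \<rho>\<^sup>2 \<ge> (2 * N + 5 + C) / \<rho>\<^sup>2 * \<rho>\<^sup>2"
      unfolding \<alpha>_def using assms by (intro mult_right_mono) auto
    then show "\<alpha> * \<rho>\<^sup>2 \<ge> 2 * N + 5 + C" using assms by simp
  qed (simp add: \<alpha>_def)
  then show "\<alpha> > 0" by simp
  fix q assume "q \<ge> \<rho>\<^sup>2 / 4"
  then have "4 * \<alpha>\<^sup>2 * (\<rho>\<^sup>2 / 4) \<le> 4 * \<alpha>\<^sup>2 * q" by (intro mult_left_mono) auto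
  moreover have "\<alpha> * (2 * N + 5 + C) \<le> \<alpha> * (\<alpha> * \<rho>\<^sup>2)" using a by (intro mult_left_mono) auto
  moreover have "1 * (1 + C) \<le> \<alpha> * (1 + C)" using a assms by (intro mult_right_mono) auto
  ultimately show "4 * \<alpha>\<^sup>2 * q - 2 * \<alpha> * N - 4 * \<alpha> > C"
    by (simp add: algebra_simps power2_eq_square)
qed

text \<open>The inequality \<open>exp t \<ge> 1 + t\<close> converts a gain \<open>s\<close> in
  squared radius into linear growth of the barrier, normalized to vanish on the sphere of radius
  \<rho>.\<close>

lemma gaussian_increment:
  fixes \<alpha> \<rho> q s :: real
  assumes "\<alpha> > 0" "q \<le> \<rho>\<^sup>2 - s"
  shows "exp (- \<alpha> * q) - exp (- \<alpha> * \<rho>\<^sup>2) \<ge> exp (- \<alpha> * \<rho>\<^sup>2) * \<alpha> * s"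
proof -
  have "\<alpha> * q \<le> \<alpha> * (\<rho>\<^sup>2 - s)" using assms by (intro mult_left_mono) auto
  then have "exp (- \<alpha> * q) \<ge> exp (- \<alpha> * \<rho>\<^sup>2) * exp (\<alpha> * s)"
    unfolding exp_add[symmetric] by (simp add: algebra_simps)
  moreover have "exp (\<alpha> * s) \<ge> 1 + \<alpha> * s" by (rule exp_ge_add_one_self)
  then have "exp (- \<alpha> * \<rho>\<^sup>2) * exp (\<alpha> * s) \<ge> exp (- \<alpha> * \<rho>\<^sup>2) * (1 + \<alpha> * s)"
    by (intro mult_left_mono) auto
  ultimately show ?thesis by (simp add: algebra_simps)
qed

section \<open>Hopf's boundary point lemma and its corner version\<close>

text \<open>In the shell between the radii \<rho>/2 and \<rho>, \<open>w\<close> is compared with a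
  multiple of a Gaussian that vanishes on the outer sphere. The conclusion is linear growth along
  the inner normal rather than a sign of a derivative, because \<open>w\<close> need not be
  differentiable at \<open>z\<close>.\<close>

lemma hopf_ball:
  fixes c z :: "'a::euclidean_space"
  assumes \<rho>: "\<rho> > 0" "dist c z = \<rho>"
    and cont: "continuous_on (cball c \<rho>) w"
    and nonneg: "\<And>x. x \<in> cball c \<rho> \<Longrightarrow> w x \<ge> 0"
    and pos: "\<And>x. x \<in> ball c \<rho> \<Longrightarrow> w x > 0"
    and lap: "\<And>x. x \<in> ball c \<rho> \<Longrightarrow> \<exists>L. has_laplacian w L x \<and> L \<le> C * w x"
  shows "\<exists>\<kappa>>0. \<forall>t\<in>{0..\<rho>/2}. w (z + t *\<^sub>R ((c - z) /\<^sub>R \<rho>)) \<ge> \<kappa> * t"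
proof -
  let ?C = "\<bar>C\<bar>"
  obtain \<alpha> where \<alpha>: "\<alpha> > 0"
    "\<And>q. q \<ge> \<rho>\<^sup>2 / 4 \<Longrightarrow> 4 * \<alpha>\<^sup>2 * q - 2 * \<alpha> * DIM('a) - 4 * \<alpha> > ?C"
    using barrier_exponent[OF \<rho>(1), of ?C "DIM('a)"] by auto
  define E where "E x = exp (- \<alpha> * ((x - c) \<bullet> (x - c)))" for x
  define b where "b = exp (- \<alpha> * \<rho>\<^sup>2)"
  have E1: "E x \<le> 1" "E x > 0" for x unfolding E_def using \<alpha> by auto
  have b: "b > 0" unfolding b_def by simp
  obtain y where y: "y \<in> cball c (\<rho>/2)" "\<And>x. x \<in> cball c (\<rho>/2) \<Longrightarrow> w y \<le> w x"
    using continuous_attains_inf[of "cball c (\<rho>/2)" w] continuous_on_subset[OF cont subset_cball, of "\<rho>/2"] \<rho>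
    by fastforce
  define m where "m = w y"
  have m: "m > 0" "\<And>x. x \<in> cball c (\<rho>/2) \<Longrightarrow> m \<le> w x"
    using pos[of y] y \<rho> unfolding m_def by auto
  define S where "S = cball c \<rho> - ball c (\<rho>/2)"
  define U where "U = ball c \<rho> - cball c (\<rho>/2)"
  \<comment> \<open>The difference \<open>w - m (E - b)\<close>, in the form produced by
    \<open>has_laplacian_lincomb\<close>.\<close>
  have main: "w x + (- m) * (E x + (- b) * 1) \<ge> 0" if "x \<in> S" for x
  proof (rule minimum_principle[of S _ U, OF _ _ _ _ _ _ that])
    show "compact S" unfolding S_def by (intro compact_diff) auto
    show "continuous_on S (\<lambda>x. w x + (- m) * (E x + (- b) * 1))"
      unfolding E_def by (intro continuous_intros continuous_on_subset[OF cont]) (auto simp: S_def)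
    show "open U" "U \<subseteq> S" unfolding U_def S_def by (auto intro!: open_Diff)
    fix x
    assume "x \<in> S - U"
    then have "x \<in> cball c \<rho>" "dist c x = \<rho> \<or> x \<in> cball c (\<rho>/2)" unfolding S_def U_def by auto
    then show "w x + (- m) * (E x + (- b) * 1) \<ge> 0"
    proof (elim disjE)
      assume "x \<in> cball c \<rho>" "dist c x = \<rho>"
      moreover then have "E x = b" unfolding E_def b_def
        by (simp add: dot_square_norm dist_norm norm_minus_commute)
      ultimately show ?thesis using nonneg by simp
    next
      assume "x \<in> cball c (\<rho>/2)"
      moreover have "m * (E x - b) \<le> m * 1" using E1(1)[of x] m(1) b by (intro mult_left_mono) auto
      ultimately show ?thesis using m(2)[of x] by simp
    qed
  next
    fix x assume x: "x \<in> U" and neg: "w x + (- m) * (E x + (- b) * 1) < 0"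
    let ?q = "(x - c) \<bullet> (x - c)"
    let ?K = "4 * \<alpha>\<^sup>2 * ?q - 2 * \<alpha> * DIM('a)"
    have xb: "x \<in> ball c \<rho>" using x by (simp add: U_def)
    then obtain L where L: "has_laplacian w L x" "L \<le> C * w x" using lap by blast
    have lp: "has_laplacian (\<lambda>x. w x + (- m) * (E x + (- b) * 1)) (L + (- m) * (E x * ?K + (- b) * 0)) x"
      by (intro has_laplacian_lincomb L has_laplacian_const, unfold E_def, rule has_laplacian_gaussian)
    have "?q \<ge> \<rho>\<^sup>2 / 4"
    proof -
      have "norm (x - c) \<ge> \<rho> / 2" using x by (auto simp: U_def dist_norm norm_minus_commute)
      then have "(norm (x - c))\<^sup>2 \<ge> (\<rho>/2)\<^sup>2" using \<rho> by (intro power_mono) auto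
      then show ?thesis by (simp add: dot_square_norm power_divide)
    qed
    then have K: "?K > ?C" using \<alpha> by force
    \<comment> \<open>Where the difference is negative, \<open>w\<close> is below
      \<open>m * E\<close>, so its Laplacian is at most \<open>?C * (m * E)\<close>, which is less
      than \<open>m\<close> times the Laplacian of \<open>E\<close>.\<close>
    have "L \<le> ?C * w x" using L(2) pos[OF xb]
      by (smt (verit, best) mult_right_mono)
    also have "\<dots> \<le> ?C * (m * E x)"
    proof (intro mult_left_mono)
      have "w x < m * E x - m * b" using neg by (simp add: algebra_simps)
      then show "w x \<le> m * E x" using mult_pos_pos[OF m(1) b] by linarith
    qed simp
    also have "\<dots> < ?K * (m * E x)" using K m E1 by (intro mult_strict_right_mono) auto
    finally have "L + (- m) * (E x * ?K + (- b) * 0) < 0" by (simp add: algebra_simps)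
    then show "\<exists>L<0. has_laplacian (\<lambda>x. w x + (- m) * (E x + (- b) * 1)) L x" using lp by blast
  qed
  show ?thesis
  proof (intro exI conjI ballI)
    show "m * (b * \<alpha> * \<rho>) > 0" using m b \<alpha> \<rho> by simp
    fix t assume t: "t \<in> {0..\<rho>/2}"
    let ?x = "z + t *\<^sub>R ((c - z) /\<^sub>R \<rho>)"
    have eq: "?x - c = (1 - t / \<rho>) *\<^sub>R (z - c)"
      by (simp add: algebra_simps divide_inverse)
    have nrm: "norm (?x - c) = \<rho> - t"
    proof -
      have "norm (z - c) = \<rho>" using \<rho> by (simp add: dist_norm norm_minus_commute)
      then have "norm (?x - c) = \<bar>1 - t / \<rho>\<bar> * \<rho>" unfolding eq by simp
      also have "\<dots> = (1 - t / \<rho>) * \<rho>" using t \<rho> by simp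
      also have "\<dots> = \<rho> - t" using \<rho> by (simp add: field_simps)
      finally show ?thesis .
    qed
    have "?x \<in> S" using nrm t by (auto simp: S_def dist_norm norm_minus_commute)
    then have "w ?x \<ge> m * (E ?x - b)" using main[of ?x] by (simp add: algebra_simps)
    moreover have "E ?x - b \<ge> b * \<alpha> * (\<rho> * t)"
      unfolding E_def b_def
    proof (rule gaussian_increment[OF \<alpha>(1)])
      have "(?x - c) \<bullet> (?x - c) = (\<rho> - t)\<^sup>2" by (simp only: dot_square_norm nrm)
      moreover have "t * t \<le> t * \<rho>" using t by (intro mult_left_mono) auto
      ultimately show "(?x - c) \<bullet> (?x - c) \<le> \<rho>\<^sup>2 - \<rho> * t"
        by (simp add: power2_eq_square algebra_simps)
    qed
    then have "m * (E ?x - b) \<ge> m * (b * \<alpha> * (\<rho> * t))" using m by (intro mult_left_mono) auto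
    ultimately show "w ?x \<ge> m * (b * \<alpha> * \<rho>) * t" by (simp add: algebra_simps)
  qed
qed

text \<open>If no constant worked, points violating the bound with constants 1/(n+1) would
  accumulate at a point of the compact set, against the local bound there. The punctured filter in
  \<open>loc\<close> says nothing at \<open>x\<close> itself, hence \<open>loc'\<close>.\<close>

lemma compact_local_lower_bound:
  fixes w s :: "'a::metric_space \<Rightarrow> real"
  assumes "compact S" "\<And>x. x \<in> S \<Longrightarrow> s x \<ge> 0"
    and loc: "\<And>x. x \<in> S \<Longrightarrow> \<exists>\<epsilon>>0. \<forall>\<^sub>F y in at x within S. w y \<ge> \<epsilon> * s y"
    and loc': "\<And>x. x \<in> S \<Longrightarrow> \<exists>\<epsilon>>0. w x \<ge> \<epsilon> * s x"
  shows "\<exists>\<epsilon>>0. \<forall>x\<in>S. w x \<ge> \<epsilon> * s x"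
proof (rule ccontr)
  assume "\<not> ?thesis"
  then have "\<exists>x\<in>S. w x < inverse (real (Suc n)) * s x" for n
    by (metis not_le inverse_positive_iff_positive of_nat_0_less_iff zero_less_Suc)
  then obtain X where X: "\<And>n. X n \<in> S" "\<And>n. w (X n) < inverse (real (Suc n)) * s (X n)" by metis
  obtain l r where l: "l \<in> S" "strict_mono r" "(X \<circ> r) \<longlonglongrightarrow> l"
    using assms(1) X(1) unfolding compact_def by blast
  obtain \<epsilon>1 where e1: "\<epsilon>1 > 0" "\<forall>\<^sub>F y in at l within S. w y \<ge> \<epsilon>1 * s y" using loc l by blast
  obtain \<epsilon>2 where e2: "\<epsilon>2 > 0" "w l \<ge> \<epsilon>2 * s l" using loc' l by blast
  define \<epsilon> where "\<epsilon> = min \<epsilon>1 \<epsilon>2"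
  have e: "\<epsilon> > 0" using e1 e2 by (simp add: \<epsilon>_def)
  have "\<forall>\<^sub>F y in nhds l. y \<in> S \<longrightarrow> w y \<ge> \<epsilon> * s y"
    using e1(2) unfolding eventually_at_filter
  proof eventually_elim
    case (elim y)
    show ?case
    proof
      assume "y \<in> S"
      then have "w y \<ge> \<epsilon>1 * s y \<or> w y \<ge> \<epsilon>2 * s y" using elim e2 by (cases "y = l") auto
      moreover have "\<epsilon> * s y \<le> \<epsilon>1 * s y" "\<epsilon> * s y \<le> \<epsilon>2 * s y"
        using assms(2)[OF \<open>y \<in> S\<close>] by (auto simp: \<epsilon>_def intro!: mult_right_mono)
      ultimately show "w y \<ge> \<epsilon> * s y" by linarith
    qed
  qed
  then have "\<forall>\<^sub>F n in sequentially. w (X (r n)) \<ge> \<epsilon> * s (X (r n))"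
    using l(3) X(1) by (auto simp: filterlim_iff o_def)
  moreover have "(\<lambda>n. inverse (real (Suc (r n)))) \<longlonglongrightarrow> 0"
    using LIMSEQ_subseq_LIMSEQ[OF LIMSEQ_inverse_real_of_nat l(2)] by (simp add: o_def)
  then have "\<forall>\<^sub>F n in sequentially. inverse (real (Suc (r n))) < \<epsilon>"
    using e by (rule order_tendstoD)
  ultimately have "\<forall>\<^sub>F n in sequentially. False"
  proof eventually_elim
    case (elim n)
    have "inverse (real (Suc (r n))) * s (X (r n)) \<le> \<epsilon> * s (X (r n))"
      using elim(2) assms(2)[OF X(1)] by (intro mult_right_mono) auto
    then show False using elim(1) X(2)[of "r n"] by linarith
  qed
  then show False by simp
qed

text \<open>The barrier is that of Hopf's lemma multiplied by the distance to the plane \<open>(x - z) \<bullet> e = 0\<close>.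
  Assumption \<open>flat\<close> is needed to compare it with \<open>w\<close> where both vanish.\<close>

lemma serrin_corner:
  fixes z e \<nu> :: "'a::euclidean_space"
  assumes \<rho>: "\<rho> > 0" and e: "norm e = 1" "norm \<nu> = 1" "e \<bullet> \<nu> = 0"
    and c: "c = z + \<rho> *\<^sub>R \<nu>"
    and cont: "continuous_on (cball c \<rho>) w"
    and nonneg: "\<And>x. x \<in> cball c \<rho> \<Longrightarrow> (x - z) \<bullet> e \<ge> 0 \<Longrightarrow> w x \<ge> 0"
    and lap: "\<And>x. x \<in> ball c \<rho> \<Longrightarrow> (x - z) \<bullet> e > 0 \<Longrightarrow> \<exists>L. has_laplacian w L x \<and> L \<le> C * w x"
    and pos: "\<And>x. x \<in> cball c \<rho> - {z} \<Longrightarrow> (x - z) \<bullet> e > 0 \<Longrightarrow> w x > 0"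
    and flat: "\<And>x. x \<in> cball c \<rho> - {z} \<Longrightarrow> dist z x \<le> \<rho>/2 \<Longrightarrow> (x - z) \<bullet> e = 0 \<Longrightarrow>
       \<exists>\<epsilon>>0. \<forall>\<^sub>F y in at x. y \<in> cball c \<rho> \<longrightarrow> (y - z) \<bullet> e > 0 \<longrightarrow> w y \<ge> \<epsilon> * ((y - z) \<bullet> e)"
  shows "\<exists>\<kappa>>0. \<forall>t\<in>{0..\<rho>/4}. w (z + t *\<^sub>R (e + \<nu>)) \<ge> \<kappa> * t\<^sup>2"
proof -
  let ?C = "\<bar>C\<bar>"
  obtain \<alpha> where \<alpha>: "\<alpha> > 0"
    "\<And>q. q \<ge> \<rho>\<^sup>2 / 4 \<Longrightarrow> 4 * \<alpha>\<^sup>2 * q - 2 * \<alpha> * DIM('a) - 4 * \<alpha> > ?C"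
    using barrier_exponent[OF \<rho>, of ?C "DIM('a)"] by auto
  define E where "E x = exp (- \<alpha> * ((x - c) \<bullet> (x - c)))" for x
  define b where "b = exp (- \<alpha> * \<rho>\<^sup>2)"
  have E1: "E x \<le> 1" "E x > 0" for x unfolding E_def using \<alpha> by auto
  have b: "b > 0" unfolding b_def by simp
  have ce: "(x - c) \<bullet> e = (x - z) \<bullet> e" for x
    using e(3) by (simp add: c algebra_simps inner_commute)
  define s where "s x = (x - z) \<bullet> e" for x
  \<comment> \<open>Of the pieces bounding the comparison region this is the one where the barrier
    need not vanish. At its rim on the plane both \<open>w\<close> and the distance \<open>s\<close>
    may vanish, so the bound of \<open>w\<close> by a multiple of \<open>s\<close> rests on
    \<open>flat\<close> there.\<close>
  define A where "A = cball c \<rho> \<inter> sphere z (\<rho>/2) \<inter> {x. s x \<ge> 0}"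
  have scont: "continuous_on T s" for T unfolding s_def by (intro continuous_intros)
  have cl: "closed {x. s x \<ge> 0}"
    using closed_Collect_le[OF continuous_on_const scont, of 0] by simp
  have sle: "s x \<le> 1 * norm (x - z)" for x
    using Cauchy_Schwarz_ineq2[of "x - z" e] e by (simp add: s_def)
  have znc: "z \<notin> A" using \<rho> by (auto simp: A_def)
  have "\<exists>\<epsilon>>0. \<forall>x\<in>A. w x \<ge> \<epsilon> * s x"
  proof (rule compact_local_lower_bound)
    show "compact A" unfolding A_def using cl by (intro compact_Int_closed) auto
    show "s x \<ge> 0" if "x \<in> A" for x using that by (simp add: A_def)
    fix x assume x: "x \<in> A"
    then have xc: "x \<in> cball c \<rho> - {z}" using znc by (auto simp: A_def)
    show "\<exists>\<epsilon>>0. w x \<ge> \<epsilon> * s x"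
    proof (cases "s x > 0")
      case True
      then have "w x > 0" using pos[OF xc] by (simp add: s_def)
      then show ?thesis using True by (intro exI[of _ "w x / s x"]) auto
    next
      case False
      then show ?thesis using x xc nonneg[of x] by (intro exI[of _ 1]) (auto simp: A_def s_def)
    qed
    show "\<exists>\<epsilon>>0. \<forall>\<^sub>F y in at x within A. w y \<ge> \<epsilon> * s y"
    proof (cases "s x > 0")
      case True
      then have wx: "w x > 0" using pos[OF xc] by (simp add: s_def)
      have "(w \<longlongrightarrow> w x) (at x within A)"
        using continuous_on_subset[OF cont, of A] x by (simp add: A_def continuous_on_def Int_assoc)
      then have 1: "\<forall>\<^sub>F y in at x within A. w y > w x / 2"
        by (rule order_tendstoD) (use wx in auto)
      have 2: "\<forall>\<^sub>F y in at x within A. y \<in> A" by (simp add: eventually_at_filter)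
      show ?thesis
      proof (intro exI conjI)
        \<comment> \<open>On \<open>A\<close> the distance \<open>s\<close> is at most \<rho>/2, so
          this constant times \<open>s y\<close> is at most \<open>w x / 2\<close>, which is below
          \<open>w y\<close> near \<open>x\<close>.\<close>
        show "w x / \<rho> > 0" using wx \<rho> by simp
        show "\<forall>\<^sub>F y in at x within A. w y \<ge> w x / \<rho> * s y"
          using 1 2
        proof eventually_elim
          case (elim y)
          then have "s y \<le> \<rho> / 2" using sle[of y] by (auto simp: A_def dist_norm norm_minus_commute)
          then have "w x / \<rho> * s y \<le> w x / \<rho> * (\<rho> / 2)" using wx \<rho> by (intro mult_left_mono) auto
          moreover have "w x / \<rho> * (\<rho> / 2) = w x / 2" using \<rho> by simp
          ultimately show ?case using elim by linarith
        qed
      qed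
    next
      case False
      then have "(x - z) \<bullet> e = 0" "dist z x \<le> \<rho>/2" using x by (auto simp: A_def s_def)
      then obtain \<epsilon> where \<epsilon>: "\<epsilon> > 0"
        "\<forall>\<^sub>F y in at x. y \<in> cball c \<rho> \<longrightarrow> (y - z) \<bullet> e > 0 \<longrightarrow> w y \<ge> \<epsilon> * ((y - z) \<bullet> e)"
        using flat[OF xc] by blast
      have "\<forall>\<^sub>F y in at x within A. y \<in> cball c \<rho> \<longrightarrow> (y - z) \<bullet> e > 0 \<longrightarrow> w y \<ge> \<epsilon> * ((y - z) \<bullet> e)"
        by (rule filter_leD[OF at_le[of A UNIV x] \<epsilon>(2)]) simp
      moreover have "\<forall>\<^sub>F y in at x within A. y \<in> A" by (simp add: eventually_at_filter)
      ultimately have "\<forall>\<^sub>F y in at x within A. w y \<ge> \<epsilon> * s y"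
      proof eventually_elim
        case (elim y)
        then have "y \<in> cball c \<rho>" "s y \<ge> 0" by (auto simp: A_def)
        then show ?case using elim nonneg[of y] by (cases "s y = 0") (auto simp: s_def)
      qed
      then show ?thesis using \<epsilon> by blast
    qed
  qed
  then obtain m where m: "m > 0" "\<And>x. x \<in> A \<Longrightarrow> w x \<ge> m * s x" by blast
  define S where "S = cball c \<rho> \<inter> cball z (\<rho>/2) \<inter> {x. s x \<ge> 0}"
  define U where "U = ball c \<rho> \<inter> ball z (\<rho>/2) \<inter> {x. s x > 0}"
  have main: "w x + (- m) * (((x - c) \<bullet> e) * (E x - b)) \<ge> 0" if "x \<in> S" for x
  proof (rule minimum_principle[of S _ U, OF _ _ _ _ _ _ that])
    show "compact S" unfolding S_def using cl by (intro compact_Int_closed) auto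
    show "continuous_on S (\<lambda>x. w x + (- m) * (((x - c) \<bullet> e) * (E x - b)))"
      unfolding E_def by (intro continuous_intros continuous_on_subset[OF cont]) (auto simp: S_def)
    have "open {x. s x > 0}" using open_Collect_less[OF continuous_on_const scont, of 0] by simp
    then show "open U" "U \<subseteq> S" unfolding U_def S_def by auto
    fix x
    assume "x \<in> S - U"
    then have x: "x \<in> cball c \<rho>" "s x \<ge> 0" "dist z x \<le> \<rho>/2"
      and "dist c x = \<rho> \<or> s x = 0 \<or> dist z x = \<rho>/2" unfolding S_def U_def by auto
    from this(4) show "w x + (- m) * (((x - c) \<bullet> e) * (E x - b)) \<ge> 0"
    proof (elim disjE)
      assume "dist c x = \<rho>"
      moreover then have "E x = b" unfolding E_def b_def
        by (simp add: dot_square_norm dist_norm norm_minus_commute)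
      ultimately show ?thesis using x nonneg by (simp add: s_def)
    next
      assume "s x = 0"
      then show ?thesis using x nonneg by (simp add: s_def ce)
    next
      assume "dist z x = \<rho>/2"
      then have "x \<in> A" using x by (simp add: A_def)
      then have "w x \<ge> m * s x" by (rule m)
      moreover have "m * s x * (E x - b) \<le> m * s x * 1" using E1(1)[of x] m(1) b x
        by (intro mult_left_mono) auto
      ultimately show ?thesis by (simp add: ce mult.assoc flip: s_def)
    qed
  next
    fix x assume x: "x \<in> U" and neg: "w x + (- m) * (((x - c) \<bullet> e) * (E x - b)) < 0"
    let ?q = "(x - c) \<bullet> (x - c)"
    let ?K = "4 * \<alpha>\<^sup>2 * ?q - 2 * \<alpha> * DIM('a) - 4 * \<alpha>"
    have xb: "x \<in> ball c \<rho>" and sx: "s x > 0" and xz: "dist z x < \<rho>/2" using x by (auto simp: U_def)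
    then obtain L where L: "has_laplacian w L x" "L \<le> C * w x" using lap by (auto simp: s_def)
    have lp: "has_laplacian (\<lambda>x. w x + (- m) * (((x - c) \<bullet> e) * (E x - b)))
        (L + (- m) * (((x - c) \<bullet> e) * E x * ?K)) x"
      unfolding E_def by (intro has_laplacian_lincomb L has_laplacian_linear_gaussian)
    \<comment> \<open>The centre is at distance \<rho> from \<open>z\<close> and the region stays
      within \<rho>/2 of \<open>z\<close>, which keeps it \<rho>/2 away from the centre.\<close>
    have "?q \<ge> \<rho>\<^sup>2 / 4"
    proof -
      have "dist c z = \<rho>" using e \<rho> by (simp add: c dist_norm)
      then have "dist c x \<ge> \<rho>/2" using xz dist_triangle[of c z x] by (simp add: dist_commute)
      then have "norm (x - c) \<ge> \<rho> / 2" by (auto simp: dist_norm norm_minus_commute)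
      then have "(norm (x - c))\<^sup>2 \<ge> (\<rho>/2)\<^sup>2" using \<rho> by (intro power_mono) auto
      then show ?thesis by (simp add: dot_square_norm power_divide)
    qed
    then have K: "?K > ?C" using \<alpha> by force
    have wx: "w x \<ge> 0" using nonneg[of x] xb sx by (simp add: s_def)
    have "L \<le> ?C * w x" using L(2) wx
      by (smt (verit, best) mult_right_mono)
    also have "\<dots> \<le> ?C * (m * s x * E x)"
    proof (intro mult_left_mono)
      have "w x < m * s x * E x - m * s x * b" using neg unfolding ce s_def[symmetric] by (simp add: algebra_simps)
      then show "w x \<le> m * s x * E x" using mult_pos_pos[OF mult_pos_pos[OF m(1) sx] b] by linarith
    qed simp
    also have "\<dots> < ?K * (m * s x * E x)" using K m E1 sx by (intro mult_strict_right_mono) auto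
    finally have "L + (- m) * (((x - c) \<bullet> e) * E x * ?K) < 0"
      unfolding ce s_def[symmetric] by (simp add: algebra_simps)
    then show "\<exists>L<0. has_laplacian (\<lambda>x. w x + (- m) * (((x - c) \<bullet> e) * (E x - b))) L x" using lp by blast
  qed
  show ?thesis
  proof (intro exI conjI ballI)
    show "m * (b * \<alpha> * \<rho>) > 0" using m b \<alpha> \<rho> by simp
    fix t assume t: "t \<in> {0..\<rho>/4}"
    \<comment> \<open>Along \<open>e + \<nu>\<close> the first factor of the barrier equals
      \<open>t\<close> and the second is at least a multiple of \<open>t\<close>, hence the square.
      The bound t \<le> \<rho>/4 keeps the point in the comparison region.\<close>
    let ?x = "z + t *\<^sub>R (e + \<nu>)"
    have eq: "?x - c = t *\<^sub>R e + (t - \<rho>) *\<^sub>R \<nu>"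
      by (simp add: algebra_simps c)
    have ee: "e \<bullet> e = 1" "\<nu> \<bullet> \<nu> = 1" using e by (auto simp: dot_square_norm)
    have q: "(?x - c) \<bullet> (?x - c) = t\<^sup>2 + (t - \<rho>)\<^sup>2" 
      unfolding eq using e(3) ee by (simp add: algebra_simps inner_commute power2_eq_square)
    have tt: "t * t \<le> t * (\<rho> / 2)" using t \<rho> by (intro mult_left_mono) auto
    have q': "(?x - c) \<bullet> (?x - c) \<le> \<rho>\<^sup>2 - \<rho> * t"
      unfolding q using tt t \<rho> by (simp add: power2_eq_square algebra_simps)
    have sx: "s ?x = t" using e(3) ee by (simp add: s_def algebra_simps inner_commute)
    have "?x \<in> cball c \<rho>"
    proof -
      have "(norm (?x - c))\<^sup>2 \<le> \<rho>\<^sup>2" using q' t \<rho> 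
        by (smt (verit) atLeastAtMost_iff dot_square_norm mult_nonneg_nonneg)
      then show ?thesis using \<rho> by (auto simp: dist_norm norm_minus_commute dest: power2_le_imp_le)
    qed
    moreover have "norm (t *\<^sub>R (e + \<nu>)) \<le> t * 2"
      using t norm_triangle_ineq[of e \<nu>] e by (auto intro!: mult_left_mono)
    then have "?x \<in> cball z (\<rho>/2)" using t by (simp add: dist_norm)
    ultimately have "?x \<in> S" using sx t by (auto simp: S_def)
    then have "w ?x \<ge> m * (s ?x * (E ?x - b))" using main[of ?x] unfolding ce s_def[symmetric] by linarith
    moreover have "E ?x - b \<ge> b * \<alpha> * (\<rho> * t)"
      unfolding E_def b_def by (rule gaussian_increment[OF \<alpha>(1) q'])
    then have "m * (s ?x * (E ?x - b)) \<ge> m * (s ?x * (b * \<alpha> * (\<rho> * t)))"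
      using m t sx by (intro mult_left_mono) auto
    ultimately show "w ?x \<ge> m * (b * \<alpha> * \<rho>) * t\<^sup>2" unfolding sx by (simp add: algebra_simps power2_eq_square)
  qed
qed

section \<open>Derivatives along rays and lines\<close>

lemma at_within_greaterThanLessThan:
  fixes a b :: real
  assumes "a < b"
  shows "at a within {a<..<b} = at_right a"
  by (rule at_within_nhd[of a "{..<b}"]) (use assms in auto)

lemma eventually_ray_in_open:
  fixes z v :: "'a::real_normed_vector"
  assumes "open U" "z \<in> U"
  shows "\<forall>\<^sub>F t in at_right (0::real). z + t *\<^sub>R v \<in> U"
proof (rule topological_tendstoD[OF _ assms(1)])
  show "((\<lambda>t. z + t *\<^sub>R v) \<longlongrightarrow> z + 0 *\<^sub>R v) (at_right 0)" by (intro tendsto_intros)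
qed (use assms in simp)

lemma eventually_ray_inward:
  fixes z d :: "'a::real_normed_vector"
  assumes "\<exists>\<delta>>0. \<forall>x\<in>S \<inter> ball z \<delta>. \<forall>t>0. x + t *\<^sub>R d \<in> ball z \<delta> \<longrightarrow> x + t *\<^sub>R d \<in> U"
    and "z \<in> S"
  shows "\<forall>\<^sub>F t in at_right 0. z + t *\<^sub>R d \<in> U"
proof -
  obtain \<delta> where \<delta>: "\<delta> > 0" "\<And>t. t > 0 \<Longrightarrow> z + t *\<^sub>R d \<in> ball z \<delta> \<Longrightarrow> z + t *\<^sub>R d \<in> U"
    using assms by fastforce
  have "\<forall>\<^sub>F t in at_right 0. z + t *\<^sub>R d \<in> ball z \<delta>"
    by (rule eventually_ray_in_open) (use \<delta> in auto)
  then show ?thesis using eventually_at_right_less[of 0]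
    by eventually_elim (use \<delta> in auto)
qed

lemma ball_segment:
  fixes y d :: "'a::real_normed_vector"
  assumes "y \<in> ball z r" "y + t *\<^sub>R d \<in> ball z r" "0 \<le> s" "s \<le> t"
  shows "y + s *\<^sub>R d \<in> ball z r"
proof (cases "t = 0")
  case False
  have "(1 - s/t) *\<^sub>R y + (s/t) *\<^sub>R (y + t *\<^sub>R d) \<in> ball z r"
    by (rule convexD_alt[OF convex_ball]) (use assms False in auto)
  moreover have "(1 - s/t) *\<^sub>R y + (s/t) *\<^sub>R (y + t *\<^sub>R d) = y + s *\<^sub>R d"
    using False by (simp add: algebra_simps)
  ultimately show ?thesis by simp
qed (use assms in auto)

text \<open>The sets \<open>T\<close> of parameters and \<open>S\<close> of points are independent,
  so one statement covers two-sided derivatives inside a domain and one-sided ones at its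
  boundary.\<close>

lemma line_derivative:
  fixes f :: "'a::real_normed_vector \<Rightarrow> real"
  assumes f: "(f has_derivative D) (at (z + s *\<^sub>R v) within S)"
    and S: "\<And>t. t \<in> T \<Longrightarrow> z + t *\<^sub>R v \<in> S"
  shows "((\<lambda>t. f (z + t *\<^sub>R v)) has_real_derivative D v) (at s within T)"
proof -
  have "((\<lambda>t. z + t *\<^sub>R v) has_derivative (\<lambda>t. t *\<^sub>R v)) (at s within T)"
    by (auto intro!: derivative_eq_intros)
  moreover have "(f has_derivative D) (at (z + s *\<^sub>R v) within (\<lambda>t. z + t *\<^sub>R v) ` T)"
    by (rule has_derivative_subset[OF f]) (use S in auto)
  ultimately have "((\<lambda>t. f (z + t *\<^sub>R v)) has_derivative (\<lambda>t. D (t *\<^sub>R v))) (at s within T)"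
    by (rule diff_chain_within[unfolded o_def])
  then show ?thesis
    using has_derivative_linear[OF f] by (simp add: has_field_derivative_def linear_cmul mult_commute_abs)
qed

lemma directional_derivative_tendsto:
  fixes f :: "'a::real_normed_vector \<Rightarrow> real"
  assumes f: "(f has_derivative D) (at z within S)"
    and S: "\<forall>\<^sub>F t in at_right (0::real). z + t *\<^sub>R v \<in> S"
  shows "((\<lambda>t. (f (z + t *\<^sub>R v) - f z) / t) \<longlongrightarrow> D v) (at_right 0)"
proof -
  obtain b where b: "b > 0" "\<And>t. 0 < t \<Longrightarrow> t < b \<Longrightarrow> z + t *\<^sub>R v \<in> S"
    using S unfolding eventually_at_right_field by blast
  have "((\<lambda>t. f (z + t *\<^sub>R v)) has_real_derivative D v) (at 0 within {0<..<b})"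
    by (rule line_derivative[where S = S]) (use f b in auto)
  then show ?thesis
    unfolding has_field_derivative_iff using b(1) at_within_greaterThanLessThan[of 0 b] by simp
qed

lemma directional_derivative_ge:
  fixes f :: "'a::real_normed_vector \<Rightarrow> real"
  assumes "(f has_derivative D) (at z within S)"
    and "\<forall>\<^sub>F t in at_right (0::real). z + t *\<^sub>R v \<in> S \<and> f (z + t *\<^sub>R v) - f z \<ge> \<kappa> * t"
  shows "D v \<ge> \<kappa>"
proof -
  have S: "\<forall>\<^sub>F t in at_right (0::real). z + t *\<^sub>R v \<in> S"
    using assms(2) by eventually_elim auto
  show ?thesis
  proof (rule tendsto_lowerbound[OF directional_derivative_tendsto[OF assms(1) S]])
    show "\<forall>\<^sub>F t in at_right 0. \<kappa> \<le> (f (z + t *\<^sub>R v) - f z) / t"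
      using assms(2) eventually_at_right_less[of 0]
      by eventually_elim (simp add: pos_le_divide_eq)
  qed simp
qed

lemma growth_along_line:
  fixes f :: "'a::real_inner \<Rightarrow> real"
  assumes t: "t \<ge> 0"
    and der: "\<And>s. 0 \<le> s \<Longrightarrow> s \<le> t \<Longrightarrow> (f has_derivative (\<lambda>h. g (x + s *\<^sub>R d) \<bullet> h)) (at (x + s *\<^sub>R d))"
    and ge: "\<And>s. 0 \<le> s \<Longrightarrow> s \<le> t \<Longrightarrow> g (x + s *\<^sub>R d) \<bullet> d \<ge> m"
  shows "f (x + t *\<^sub>R d) \<ge> f x + m * t"
proof (cases "t = 0")
  case False
  then have "t > 0" using t by simp
  have line: "((\<lambda>t. f (x + t *\<^sub>R d)) has_real_derivative g (x + s *\<^sub>R d) \<bullet> d) (at s)"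
    if "0 \<le> s" "s \<le> t" for s
    by (rule line_derivative[where S = UNIV and D = "\<lambda>h. g (x + s *\<^sub>R d) \<bullet> h"]) (use der[OF that] in auto)
  obtain s where s: "0 < s" "s < t" "f (x + t *\<^sub>R d) - f (x + 0 *\<^sub>R d) = (t - 0) * (g (x + s *\<^sub>R d) \<bullet> d)"
    using MVT2[OF \<open>t > 0\<close> line] by blast
  have "t * (g (x + s *\<^sub>R d) \<bullet> d) \<ge> t * m" using ge[of s] s t by (intro mult_left_mono) auto
  then show ?thesis using s(3) by (simp add: mult.commute)
qed simp

text \<open>Second order Taylor expansion along a ray with Peano remainder: one application of
  l'Hopital's rule reduces it to the difference quotient of the gradient at \<open>z\<close>, which
  may be a boundary point.\<close>

lemma second_order_tendsto:
  fixes f :: "'a::euclidean_space \<Rightarrow> real"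
  assumes f: "\<And>y. y \<in> S \<Longrightarrow> (f has_derivative (\<lambda>h. G y \<bullet> h)) (at y within S)"
    and G: "(G has_derivative K) (at z within S)"
    and z: "z \<in> S"
    and S: "\<forall>\<^sub>F t in at_right (0::real). z + t *\<^sub>R v \<in> S"
  shows "((\<lambda>t. (f (z + t *\<^sub>R v) - f z - t * (G z \<bullet> v)) / t\<^sup>2) \<longlongrightarrow> (K v \<bullet> v) / 2) (at_right 0)"
proof -
  obtain b where b: "b > 0" "\<And>t. 0 < t \<Longrightarrow> t < b \<Longrightarrow> z + t *\<^sub>R v \<in> S"
    using S unfolding eventually_at_right_field by blast
  show ?thesis
  proof (rule lhopital_right_0)
    have "((\<lambda>t. f (z + t *\<^sub>R v)) has_real_derivative G z \<bullet> v) (at 0 within {0<..<b})"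
      by (rule line_derivative[where S = S and D = "\<lambda>h. G z \<bullet> h"]) (use f[OF z] b in auto)
    then have "continuous (at 0 within {0<..<b}) (\<lambda>t. f (z + t *\<^sub>R v))"
      by (rule DERIV_continuous)
    then have "((\<lambda>t. f (z + t *\<^sub>R v)) \<longlongrightarrow> f z) (at_right 0)"
      unfolding continuous_within using b(1) at_within_greaterThanLessThan[of 0 b] by simp
    then show "((\<lambda>t. f (z + t *\<^sub>R v) - f z - t * (G z \<bullet> v)) \<longlongrightarrow> 0) (at_right 0)"
      by (auto intro!: tendsto_eq_intros)
    show "((\<lambda>t::real. t\<^sup>2) \<longlongrightarrow> 0) (at_right 0)"
      by (auto intro!: tendsto_eq_intros)
    show "\<forall>\<^sub>F t in at_right (0::real). t\<^sup>2 \<noteq> 0"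
      using eventually_at_right_less[of 0] by eventually_elim simp
    show "\<forall>\<^sub>F t in at_right (0::real). 2 * t \<noteq> 0"
      using eventually_at_right_less[of 0] by eventually_elim simp
    show "\<forall>\<^sub>F t in at_right (0::real). ((\<lambda>t::real. t\<^sup>2) has_real_derivative 2 * t) (at t)"
      by (intro always_eventually allI) (auto intro!: derivative_eq_intros)
    have "\<forall>\<^sub>F t in at_right 0. 0 < t \<and> t < b"
      unfolding eventually_at_right_field using b(1) by blast
    then show "\<forall>\<^sub>F t in at_right 0. ((\<lambda>t. f (z + t *\<^sub>R v) - f z - t * (G z \<bullet> v)) has_real_derivative
        G (z + t *\<^sub>R v) \<bullet> v - G z \<bullet> v) (at t)"
    proof eventually_elim
      case (elim t)
      have "((\<lambda>t. f (z + t *\<^sub>R v)) has_real_derivative G (z + t *\<^sub>R v) \<bullet> v) (at t within {0<..<b})"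
      proof (rule line_derivative[where S = S and D = "\<lambda>h. G (z + t *\<^sub>R v) \<bullet> h"])
        show "(f has_derivative (\<lambda>h. G (z + t *\<^sub>R v) \<bullet> h)) (at (z + t *\<^sub>R v) within S)"
          using f b(2) elim by blast
        show "z + s *\<^sub>R v \<in> S" if "s \<in> {0<..<b}" for s
          using b(2)[of s] that by simp
      qed
      then have "((\<lambda>t. f (z + t *\<^sub>R v)) has_real_derivative G (z + t *\<^sub>R v) \<bullet> v) (at t)"
        using elim at_within_open[of t "{0<..<b}"] by simp
      then show ?case by (auto intro!: derivative_eq_intros)
    qed
    have "((\<lambda>y. G y \<bullet> v) has_derivative (\<lambda>h. K h \<bullet> v)) (at z within S)"
      by (auto intro!: derivative_eq_intros G)
    from tendsto_divide[OF directional_derivative_tendsto[OF this S] tendsto_const[of 2]]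
    show "((\<lambda>t. (G (z + t *\<^sub>R v) \<bullet> v - G z \<bullet> v) / (2 * t)) \<longlongrightarrow> (K v \<bullet> v) / 2) (at_right 0)"
      by (simp add: field_simps)
  qed
qed

lemma has_laplacian_imp_has_derivative:
  assumes "has_laplacian f L x"
  obtains D where "(f has_derivative D) (at x)"
  using assms eventually_nhds_x_imp_x unfolding has_laplacian_def by blast

text \<open>If \<open>w y\<close> is positive, the zero \<open>q\<close> nearest to \<open>y\<close>
  lies on the boundary of a ball about \<open>y\<close> where \<open>w\<close> is positive. Hopf's
  lemma gives a positive derivative at \<open>q\<close> towards \<open>y\<close>, while
  \<open>q\<close> is an interior minimum. Halving the radius keeps that ball inside
  \<open>ball z r\<close>.\<close>

lemma strong_minimum_principle:
  fixes w :: "'a::euclidean_space \<Rightarrow> real"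
  assumes cont: "continuous_on (ball z r) w"
    and nonneg: "\<And>x. x \<in> ball z r \<Longrightarrow> w x \<ge> 0"
    and lap: "\<And>x. x \<in> ball z r \<Longrightarrow> \<exists>L. has_laplacian w L x \<and> L \<le> C * w x"
    and z: "w z = 0" and y: "y \<in> ball z (r/2)"
  shows "w y = 0"
proof (rule ccontr)
  assume "w y \<noteq> 0"
  define T where "T = {x \<in> cball y (dist y z). w x = 0}"
  have d: "dist y z < r / 2" using y by (simp add: dist_commute)
  have sub: "cball y (dist y z) \<subseteq> ball z r"
  proof
    fix x assume "x \<in> cball y (dist y z)"
    then show "x \<in> ball z r"
      using dist_triangle[of z x y] d by (auto simp: dist_commute)
  qed
  have "closed T" unfolding T_def
    using continuous_closed_preimage[OF continuous_on_subset[OF cont sub] closed_cball, of "{0}"]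
    by (simp add: vimage_def Int_def)
  moreover have "T \<noteq> {}" using z unfolding T_def by (auto simp: dist_commute)
  ultimately obtain q where q: "q \<in> T" "\<And>x. x \<in> T \<Longrightarrow> dist y q \<le> dist y x"
    using distance_attains_inf[of T y] by blast
  define \<rho> where "\<rho> = dist y q"
  have \<rho>: "\<rho> > 0" "\<rho> \<le> dist y z"
    using \<open>w y \<noteq> 0\<close> q by (auto simp: \<rho>_def T_def)
  have sub2: "cball y \<rho> \<subseteq> ball z r" using subset_trans[OF subset_cball[OF \<rho>(2)] sub] .
  have "\<exists>\<kappa>>0. \<forall>t\<in>{0..\<rho>/2}. w (q + t *\<^sub>R ((y - q) /\<^sub>R \<rho>)) \<ge> \<kappa> * t"
  proof (rule hopf_ball)
    show "continuous_on (cball y \<rho>) w" using cont sub2 continuous_on_subset by blast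
    show "w x \<ge> 0" if "x \<in> cball y \<rho>" for x using nonneg sub2 that by blast
    show "\<exists>L. has_laplacian w L x \<and> L \<le> C * w x" if "x \<in> ball y \<rho>" for x
      using lap sub2 that ball_subset_cball by blast
    show "w x > 0" if "x \<in> ball y \<rho>" for x
    proof -
      have "w x \<ge> 0" using nonneg sub2 that ball_subset_cball by blast
      moreover have "w x \<noteq> 0" using q(2)[of x] that \<rho> by (auto simp: T_def \<rho>_def)
      ultimately show ?thesis by simp
    qed
  qed (use \<rho> in \<open>auto simp: \<rho>_def\<close>)
  then obtain \<kappa> where \<kappa>: "\<kappa> > 0" "\<And>t. t \<in> {0..\<rho>/2} \<Longrightarrow> w (q + t *\<^sub>R ((y - q) /\<^sub>R \<rho>)) \<ge> \<kappa> * t" by blast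
  have qb: "q \<in> ball z r" using q(1) sub by (auto simp: T_def)
  then obtain D where D: "(w has_derivative D) (at q)"
    using lap has_laplacian_imp_has_derivative by blast
  have wq: "w q = 0" using q by (simp add: T_def)
  have "D = (\<lambda>h. 0)"
    by (rule differential_zero_maxmin[OF qb open_ball D]) (use nonneg wq in auto)
  moreover have "D ((y - q) /\<^sub>R \<rho>) \<ge> \<kappa>"
  proof (rule directional_derivative_ge[OF D])
    show "\<forall>\<^sub>F t in at_right 0. q + t *\<^sub>R ((y - q) /\<^sub>R \<rho>) \<in> UNIV \<and>
        \<kappa> * t \<le> w (q + t *\<^sub>R ((y - q) /\<^sub>R \<rho>)) - w q"
      unfolding eventually_at_right_field using \<kappa>(2) wq \<rho>
      by (auto intro!: exI[of _ "\<rho>/2"])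
  qed
  ultimately show False using \<kappa> by simp
qed

section \<open>Moving planes\<close>

text \<open>The assumption \<open>lipschitz\<close> on \<open>\<omega> = \<Delta>\<phi>\<close> stands for \<open>\<Delta>\<phi> = f(\<phi>)\<close> with \<open>f\<close> locally Lipschitz below the
  maximum of \<open>\<phi>\<close>. Outside \<open>\<Omega>\<close>, \<open>\<phi>\<close> is zero, so that \<open>\<phi> x \<le> \<phi> x'\<close> with \<open>x \<in> \<Omega>\<close> entails \<open>x' \<in> \<Omega>\<close>.\<close>

locale overdetermined =
  fixes \<Omega> :: "'a::euclidean_space set" and \<phi> \<omega> :: "'a \<Rightarrow> real" and G :: "'a \<Rightarrow> 'a"
    and K :: "'a \<Rightarrow> 'a \<Rightarrow> 'a" and xs :: 'a and c0 :: real
  assumes open_\<Omega>: "open \<Omega>" and bounded_\<Omega>: "bounded \<Omega>" and xs: "xs \<in> \<Omega>"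
    and zero: "\<And>x. x \<notin> \<Omega> \<Longrightarrow> \<phi> x = 0" and pos: "\<And>x. x \<in> \<Omega> \<Longrightarrow> \<phi> x > 0"
    and cont: "continuous_on UNIV \<phi>"
    and grad: "\<And>x. x \<in> closure \<Omega> - {xs} \<Longrightarrow> (\<phi> has_derivative (\<lambda>h. G x \<bullet> h)) (at x within closure \<Omega>)"
    and hess: "\<And>x. x \<in> closure \<Omega> - {xs} \<Longrightarrow> (G has_derivative K x) (at x within closure \<Omega>)"
    and hess_symmetric: "\<And>x h k. x \<in> frontier \<Omega> \<Longrightarrow> K x h \<bullet> k = h \<bullet> K x k"
    and grad_nz: "\<And>x. x \<in> closure \<Omega> - {xs} \<Longrightarrow> G x \<noteq> 0"
    and grad_frontier: "\<And>x. x \<in> frontier \<Omega> \<Longrightarrow> norm (G x) = c0"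
    and trace: "\<And>x. x \<in> \<Omega> - {xs} \<Longrightarrow> \<omega> x = (\<Sum>i\<in>Basis. K x i \<bullet> i)"
    and lipschitz: "\<And>z. z \<in> closure \<Omega> - {xs} \<Longrightarrow> \<exists>\<delta>>0. \<exists>C. \<forall>x\<in>\<Omega> - {xs}. \<forall>y\<in>\<Omega> - {xs}.
       \<bar>\<phi> x - \<phi> z\<bar> < \<delta> \<longrightarrow> \<bar>\<phi> y - \<phi> z\<bar> < \<delta> \<longrightarrow> \<bar>\<omega> x - \<omega> y\<bar> \<le> C * \<bar>\<phi> x - \<phi> y\<bar>"
    and inward: "\<And>z d. z \<in> frontier \<Omega> \<Longrightarrow> G z \<bullet> d > 0 \<Longrightarrow>
       \<exists>\<delta>>0. \<forall>x\<in>closure \<Omega> \<inter> ball z \<delta>. \<forall>t>0. x + t *\<^sub>R d \<in> ball z \<delta> \<longrightarrow> x + t *\<^sub>R d \<in> \<Omega>"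
begin

section \<open>Geometry of \<Omega> and monotonicity of \<phi> near a boundary point\<close>

lemma frontier_eq: "frontier \<Omega> = closure \<Omega> - \<Omega>"
  by (simp add: frontier_def interior_open open_\<Omega>)

lemma frontierD: "z \<in> frontier \<Omega> \<Longrightarrow> z \<in> closure \<Omega> - {xs}" "z \<in> frontier \<Omega> \<Longrightarrow> z \<notin> \<Omega>"
  using xs by (auto simp: frontier_eq)

lemma at_\<Omega>: "x \<in> \<Omega> \<Longrightarrow> at x within closure \<Omega> = at x"
  using open_\<Omega> closure_subset by (meson at_within_interior in_mono interior_maximal)

lemma \<Omega>_closure: "x \<in> \<Omega> \<Longrightarrow> x \<in> closure \<Omega>"
  using closure_subset by blast

lemma grad_at: "x \<in> \<Omega> \<Longrightarrow> x \<noteq> xs \<Longrightarrow> (\<phi> has_derivative (\<lambda>h. G x \<bullet> h)) (at x)"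
  using grad[of x] at_\<Omega>[of x] \<Omega>_closure by simp

lemma hess_at: "x \<in> \<Omega> \<Longrightarrow> x \<noteq> xs \<Longrightarrow> (G has_derivative K x) (at x)"
  using hess[of x] at_\<Omega>[of x] \<Omega>_closure by simp

lemma nonneg: "\<phi> x \<ge> 0"
  using zero pos by (metis less_eq_real_def order_refl)

lemma laplacian: "x \<in> \<Omega> \<Longrightarrow> x \<noteq> xs \<Longrightarrow> has_laplacian \<phi> (\<omega> x) x"
  by (rule has_laplacianI[of "\<Omega> - {xs}" _ _ G "K x"])
     (use open_\<Omega> grad_at hess_at trace in auto)

text \<open>The maximum over the compact closure is positive and hence attained inside \<Omega>,
  where a maximum away from \<open>xs\<close> would be a zero of \<open>G\<close>.\<close>

lemma less_max: assumes "x \<noteq> xs" shows "\<phi> x < \<phi> xs"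
proof -
  obtain m where m: "m \<in> closure \<Omega>" "\<And>y. y \<in> closure \<Omega> \<Longrightarrow> \<phi> y \<le> \<phi> m"
    using continuous_attains_sup[of "closure \<Omega>" \<phi>] continuous_on_subset[OF cont]
      bounded_\<Omega> xs \<Omega>_closure by (metis compact_closure empty_iff top_greatest)
  have "\<phi> m > 0" using m(2)[of xs] pos[OF xs] \<Omega>_closure[OF xs] by linarith
  have *: "y = xs" if "y \<in> \<Omega>" "\<phi> y = \<phi> m" for y
  proof (rule ccontr)
    assume "y \<noteq> xs"
    then have "(\<lambda>h. G y \<bullet> h) = (\<lambda>h. 0)"
      using m(2) \<Omega>_closure that by (intro differential_zero_maxmin[OF that(1) open_\<Omega> grad_at]) auto
    then have "G y \<bullet> G y = 0" by meson
    then show False using grad_nz[of y] \<open>y \<noteq> xs\<close> that \<Omega>_closure by simp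
  qed
  have "m \<in> \<Omega>" using zero \<open>\<phi> m > 0\<close> by force
  then have "m = xs" using * by blast
  show ?thesis
  proof (cases "x \<in> \<Omega>")
    case True
    then show ?thesis using *[of x] m(2)[of x] assms \<Omega>_closure[of x] \<open>m = xs\<close> by force
  qed (use zero pos xs in auto)
qed

lemma cont_at: "isCont \<phi> x"
  using cont continuous_on_eq_continuous_at by blast

lemma grad_cont: "z \<in> closure \<Omega> - {xs} \<Longrightarrow> (G \<longlongrightarrow> G z) (at z within closure \<Omega>)"
  using hess has_derivative_continuous continuous_within by blast

lemma c0_pos: "z \<in> frontier \<Omega> \<Longrightarrow> c0 > 0"
  using grad_nz[of z] grad_frontier[of z] frontierD[of z] by auto

lemma inward_ray:
  assumes "z \<in> frontier \<Omega>" "G z \<bullet> d > 0"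
  shows "\<forall>\<^sub>F t in at_right 0. z + t *\<^sub>R d \<in> \<Omega>"
  using eventually_ray_inward[OF inward[OF assms]] frontierD(1)[OF assms(1)] by blast

text \<open>Along a direction in which \<open>\<phi>\<close> increases, the segment cannot leave \<open>\<Omega>\<close>: by Rolle's theorem
  \<open>\<phi>\<close> would have a critical point of the restriction before the first exit.\<close>

lemma interior_ball:
  assumes q: "q \<in> frontier \<Omega>"
  shows "\<exists>\<rho>0>0. \<forall>\<rho>. 0 < \<rho> \<longrightarrow> \<rho> \<le> \<rho>0 \<longrightarrow> cball (q + \<rho> *\<^sub>R (G q /\<^sub>R c0)) \<rho> - {q} \<subseteq> \<Omega>"
proof -
  note q' = frontierD[OF q]
  have c0: "c0 > 0" using c0_pos[OF q] .
  obtain B where B: "\<And>h. norm (K q h) \<le> norm h * B"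
    using bounded_linear.bounded[OF has_derivative_bounded_linear[OF hess[OF q'(1)]]] by blast
  obtain \<delta>1 where \<delta>1: "\<delta>1 > 0" "\<And>y. y \<in> closure \<Omega> \<Longrightarrow> norm (y - q) < \<delta>1 \<Longrightarrow>
      norm (G y - G q - K q (y - q)) \<le> 1 * norm (y - q)"
    using hess[OF q'(1)] zero_less_one unfolding has_derivative_within_alt by blast
  define C where "C = \<bar>B\<bar> + 1"
  have C: "C > 0" by (simp add: C_def)
  \<comment> \<open>Differentiability of \<open>G\<close> at the single point \<open>q\<close>
    bounds its deviation from \<open>G q\<close> linearly: the second order information that a
    tangent ball requires and that a boundary of class C1 alone does not carry.\<close>
  have GC: "norm (G y - G q) \<le> C * norm (y - q)" if "y \<in> closure \<Omega>" "norm (y - q) < \<delta>1" for y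
  proof -
    have "norm (G y - G q) \<le> norm (G y - G q - K q (y - q)) + norm (K q (y - q))"
      using norm_triangle_ineq[of "G y - G q - K q (y - q)" "K q (y - q)"] by simp
    also have "\<dots> \<le> 1 * norm (y - q) + norm (y - q) * \<bar>B\<bar>"
      using \<delta>1(2)[OF that] B[of "y - q"] mult_left_mono[OF abs_ge_self[of B] norm_ge_zero[of "y - q"]] by linarith
    finally show ?thesis by (simp add: C_def algebra_simps)
  qed
  define \<delta> where "\<delta> = min \<delta>1 (dist q xs)"
  have \<delta>: "\<delta> > 0" using \<delta>1 q' by (auto simp: \<delta>_def)
  \<comment> \<open>The second condition on \<open>v\<close> describes an open ball tangent to the
    boundary at \<open>q\<close>, of radius \<open>c0 / (2 * C)\<close>.\<close>
  have inside: "q + v \<in> \<Omega>" if v: "norm v < \<delta>" "G q \<bullet> v > C * (norm v)\<^sup>2" for v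
  proof (rule ccontr)
    assume out: "q + v \<notin> \<Omega>"
    have Gv: "G q \<bullet> v > 0" proof -
      have "C * (norm v)\<^sup>2 \<ge> 0" using C by simp
      then show ?thesis using v by linarith
    qed
    obtain \<tau> where \<tau>: "\<tau> > 0" "\<And>t. 0 < t \<Longrightarrow> t < \<tau> \<Longrightarrow> q + t *\<^sub>R v \<in> \<Omega>"
      using inward_ray[OF q Gv] unfolding eventually_at_right_field by blast
    have \<tau>1: "\<tau> \<le> 1" using \<tau>(2)[of 1] out by force
    \<comment> \<open>The search starts at \<tau>/2 because \<open>q\<close> itself, at parameter 0,
      is outside \<Omega>; \<open>Inf T\<close> is then the first exit.\<close>
    define T where "T = {t \<in> {\<tau>/2..1}. q + t *\<^sub>R v \<notin> \<Omega>}"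
    have "closed T"
    proof -
      have "T = {\<tau>/2..1} \<inter> (\<lambda>t. q + t *\<^sub>R v) -` (- \<Omega>)" by (auto simp: T_def)
      moreover have "closed \<dots>" using open_\<Omega>
        by (intro continuous_closed_preimage) (auto intro!: continuous_intros)
      ultimately show ?thesis by simp
    qed
    moreover have "1 \<in> T" using out \<tau>1 by (simp add: T_def)
    moreover have bdd: "bdd_below T" by (rule bdd_belowI[of _ "\<tau>/2"]) (auto simp: T_def)
    ultimately have I: "Inf T \<in> T" by (metis closed_contains_Inf empty_iff)
    define s where "s = Inf T"
    have s: "s \<ge> \<tau>/2" "s \<le> 1" "q + s *\<^sub>R v \<notin> \<Omega>" using I by (auto simp: T_def s_def)
    have before: "q + t *\<^sub>R v \<in> \<Omega>" if "0 < t" "t < s" for t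
    proof (rule ccontr)
      assume "q + t *\<^sub>R v \<notin> \<Omega>"
      then have "t \<ge> \<tau>" using \<tau>(2)[of t] that by force
      then have "t \<in> T" using \<open>q + t *\<^sub>R v \<notin> \<Omega>\<close> that s \<tau> by (auto simp: T_def)
      then show False using cInf_lower[OF _ bdd] that by (force simp: s_def)
    qed
    have nx: "q + t *\<^sub>R v \<noteq> xs" and small: "norm (t *\<^sub>R v) < \<delta>1" if "0 < t" "t < s" for t
    proof -
      have "t * norm v \<le> 1 * norm v" using that s by (intro mult_right_mono) auto
      then have "norm (t *\<^sub>R v) \<le> norm v" using that by simp
      then have n: "norm (t *\<^sub>R v) < \<delta>" using v by linarith
      then show "norm (t *\<^sub>R v) < \<delta>1" by (simp add: \<delta>_def)
      show "q + t *\<^sub>R v \<noteq> xs"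
      proof
        assume "q + t *\<^sub>R v = xs"
        then have "dist q xs = norm (t *\<^sub>R v)" by (auto simp: dist_norm)
        then show False using n by (simp add: \<delta>_def)
      qed
    qed
    have "\<exists>t. 0 < t \<and> t < s \<and> \<phi> (q + s *\<^sub>R v) - \<phi> (q + 0 *\<^sub>R v) = (s - 0) * (G (q + t *\<^sub>R v) \<bullet> v)"
    proof -
      have der: "((\<lambda>t. \<phi> (q + t *\<^sub>R v)) has_real_derivative G (q + t *\<^sub>R v) \<bullet> v) (at t)"
        if "0 < t" "t < s" for t
        by (rule line_derivative[where S = UNIV and D = "\<lambda>h. G (q + t *\<^sub>R v) \<bullet> h"])
             (use grad_at[OF before nx] that in auto)
      have "continuous_on {0..s} (\<lambda>t. \<phi> (q + t *\<^sub>R v))"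
        by (intro continuous_on_compose2[OF cont] continuous_intros) auto
      moreover have "0 < s" using s \<tau> by simp
      ultimately obtain l t where "0 < t" "t < s" and l: "DERIV (\<lambda>t. \<phi> (q + t *\<^sub>R v)) t :> l"
        "\<phi> (q + s *\<^sub>R v) - \<phi> (q + 0 *\<^sub>R v) = (s - 0) * l"
        using MVT[of 0 s "\<lambda>t. \<phi> (q + t *\<^sub>R v)"] der real_differentiable_def by blast
      then show ?thesis using DERIV_unique[OF l(1) der] by blast
    qed
    then obtain t where t: "0 < t" "t < s" and eq: "\<phi> (q + s *\<^sub>R v) - \<phi> q = s * (G (q + t *\<^sub>R v) \<bullet> v)" by auto
    have "G (q + t *\<^sub>R v) \<bullet> v = 0" using eq zero s q'(2) \<tau> by simp
    moreover have "\<bar>(G (q + t *\<^sub>R v) - G q) \<bullet> v\<bar> \<le> C * (norm v)\<^sup>2"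
    proof -
      have "\<bar>(G (q + t *\<^sub>R v) - G q) \<bullet> v\<bar> \<le> norm (G (q + t *\<^sub>R v) - G q) * norm v"
        by (rule Cauchy_Schwarz_ineq2)
      also have "\<dots> \<le> (C * norm (t *\<^sub>R v)) * norm v"
        using GC[of "q + t *\<^sub>R v"] before[OF t] small[OF t] \<Omega>_closure by (intro mult_right_mono) auto
      also have "\<dots> = (C * (t * norm v)) * norm v" using t by simp
      also have "\<dots> \<le> (C * (1 * norm v)) * norm v"
        using t s C by (intro mult_right_mono mult_left_mono) auto
      finally show ?thesis by (simp add: power2_eq_square algebra_simps)
    qed
    ultimately show False using v(2) by (simp add: inner_diff_left)
  qed
  \<comment> \<open>The bound \<delta>/3 keeps the ball within \<delta> of \<open>q\<close>; the
    bound \<open>c0 / (3 * C)\<close> makes it smaller than the tangent ball of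
    \<open>inside\<close>, so that the two spheres meet in \<open>q\<close> only.\<close>
  define \<rho>0 where "\<rho>0 = min (\<delta> / 3) (c0 / (3 * C))"
  show ?thesis
  proof (intro exI conjI allI impI subsetI)
    show "\<rho>0 > 0" using \<delta> c0 C by (simp add: \<rho>0_def)
    fix \<rho> y assume \<rho>: "0 < \<rho>" "\<rho> \<le> \<rho>0" and y: "y \<in> cball (q + \<rho> *\<^sub>R (G q /\<^sub>R c0)) \<rho> - {q}"
    define v where "v = y - q"
    define \<nu> where "\<nu> = G q /\<^sub>R c0"
    have \<nu>: "norm \<nu> = 1" using grad_frontier[OF q] c0 by (simp add: \<nu>_def)
    have v0: "norm v > 0" using y by (simp add: v_def)
    have nv: "norm (v - \<rho> *\<^sub>R \<nu>) \<le> \<rho>"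
      using y by (simp add: v_def \<nu>_def dist_norm norm_minus_commute algebra_simps)
    then have "norm v \<le> 2 * \<rho>"
      using norm_triangle_ineq[of "v - \<rho> *\<^sub>R \<nu>" "\<rho> *\<^sub>R \<nu>"] \<nu> \<rho> by simp
    then have vd: "norm v < \<delta>" using \<rho> \<delta> by (simp add: \<rho>0_def)
    have "(norm (v - \<rho> *\<^sub>R \<nu>))\<^sup>2 \<le> \<rho>\<^sup>2" using nv by (intro power_mono) auto
    moreover have "(norm (v - \<rho> *\<^sub>R \<nu>))\<^sup>2 = (norm v)\<^sup>2 - 2 * \<rho> * (\<nu> \<bullet> v) + \<rho>\<^sup>2 * (norm \<nu>)\<^sup>2"
      unfolding power2_norm_eq_inner by (simp add: algebra_simps inner_commute power2_eq_square)
    then have "(norm (v - \<rho> *\<^sub>R \<nu>))\<^sup>2 = (norm v)\<^sup>2 - 2 * \<rho> * (\<nu> \<bullet> v) + \<rho>\<^sup>2" using \<nu> by simp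
    ultimately have a: "(norm v)\<^sup>2 \<le> 2 * \<rho> * (\<nu> \<bullet> v)" by simp
    have "\<rho> * (3 * C) \<le> c0" using \<rho> C by (simp add: \<rho>0_def pos_le_divide_eq)
    moreover have "\<rho> * C > 0" using \<rho> C by simp
    ultimately have "2 * \<rho> * C < c0" by (simp add: algebra_simps)
    then have "2 * \<rho> * C * (norm v)\<^sup>2 < c0 * (norm v)\<^sup>2" using v0 by (intro mult_strict_right_mono) auto
    also have "\<dots> \<le> c0 * (2 * \<rho> * (\<nu> \<bullet> v))" using a c0 by (intro mult_left_mono) auto
    also have "\<dots> = 2 * \<rho> * (G q \<bullet> v)" using c0 by (simp add: \<nu>_def)
    finally have "2 * \<rho> * (C * (norm v)\<^sup>2) < 2 * \<rho> * (G q \<bullet> v)" by simp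
    then have "C * (norm v)\<^sup>2 < G q \<bullet> v" using \<rho> by simp
    from inside[OF vd this] show "y \<in> \<Omega>" by (simp add: v_def)
  qed
qed

text \<open>The rate \<kappa> is uniform over starting points near \<open>z\<close>, including those
  arbitrarily close to the boundary: \<open>inward\<close> keeps the segment in \<Omega>, and the
  gradient is continuous up to the boundary. This handles pairs of mirror points that collapse to
  one point of the plane.\<close>

lemma increasing_along:
  assumes z: "z \<in> closure \<Omega> - {xs}" and d: "G z \<bullet> d > 0"
  shows "\<exists>\<kappa>>0. \<exists>r>0. \<forall>y\<in>\<Omega> \<inter> ball z r. \<forall>t\<ge>0. y + t *\<^sub>R d \<in> ball z r \<longrightarrow>
     \<phi> (y + t *\<^sub>R d) \<ge> \<phi> y + \<kappa> * t"
proof -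
  have "\<exists>r>0. \<forall>y\<in>\<Omega> \<inter> ball z r. \<forall>t>0. y + t *\<^sub>R d \<in> ball z r \<longrightarrow> y + t *\<^sub>R d \<in> \<Omega>"
  proof (cases "z \<in> \<Omega>")
    case True
    then show ?thesis using open_\<Omega> by (metis Int_iff inf.absorb_iff1 open_contains_ball)
  next
    case False
    then have "z \<in> frontier \<Omega>" using z by (simp add: frontier_eq)
    from inward[OF this d] show ?thesis using \<Omega>_closure by blast
  qed
  then obtain r1 where r1: "r1 > 0" "\<And>y t. y \<in> \<Omega> \<inter> ball z r1 \<Longrightarrow> t > 0 \<Longrightarrow>
     y + t *\<^sub>R d \<in> ball z r1 \<Longrightarrow> y + t *\<^sub>R d \<in> \<Omega>" by blast
  have "((\<lambda>x. G x \<bullet> d) \<longlongrightarrow> G z \<bullet> d) (at z within closure \<Omega>)"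
    by (intro tendsto_intros grad_cont z)
  then have "\<forall>\<^sub>F x in at z within closure \<Omega>. G x \<bullet> d > G z \<bullet> d / 2"
    by (rule order_tendstoD) (use d in auto)
  then obtain r2 where r2: "r2 > 0" "\<And>x. x \<in> closure \<Omega> \<Longrightarrow> x \<noteq> z \<Longrightarrow> dist x z < r2 \<Longrightarrow> G x \<bullet> d > G z \<bullet> d / 2"
    unfolding eventually_at by blast
  define r where "r = min (min r1 r2) (dist z xs)"
  have r: "r > 0" using r1 r2 z by (auto simp: r_def)
  have Gd: "G x \<bullet> d \<ge> G z \<bullet> d / 2" if "x \<in> closure \<Omega>" "x \<in> ball z r" for x
    using r2(2)[of x] that d by (cases "x = z") (auto simp: r_def dist_commute)
  show ?thesis
  proof (intro exI conjI ballI allI impI)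
    show "G z \<bullet> d / 2 > 0" "r > 0" using d r by auto
    fix y t assume y: "y \<in> \<Omega> \<inter> ball z r" and t: "t \<ge> (0::real)" "y + t *\<^sub>R d \<in> ball z r"
    have seg': "y + s *\<^sub>R d \<in> \<Omega>" "y + s *\<^sub>R d \<noteq> xs" if "0 \<le> s" "s \<le> t" for s
    proof -
      have b: "y + s *\<^sub>R d \<in> ball z r" using ball_segment[OF _ t(2) that] y by blast
      then show "y + s *\<^sub>R d \<noteq> xs" by (auto simp: r_def)
      show "y + s *\<^sub>R d \<in> \<Omega>"
      proof (cases "s = 0")
        case False
        then show ?thesis using r1(2)[of y s] b y that by (simp add: r_def)
      qed (use y in auto)
    qed
    show "\<phi> (y + t *\<^sub>R d) \<ge> \<phi> y + G z \<bullet> d / 2 * t"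
    proof (rule growth_along_line[OF t(1)])
      fix s assume s: "0 \<le> s" "s \<le> t"
      show "(\<phi> has_derivative (\<lambda>h. G (y + s *\<^sub>R d) \<bullet> h)) (at (y + s *\<^sub>R d))"
        by (rule grad_at[OF seg'[OF s]])
      show "G (y + s *\<^sub>R d) \<bullet> d \<ge> G z \<bullet> d / 2"
        using Gd ball_segment[OF _ t(2) s] seg'(1)[OF s] \<Omega>_closure y by blast
    qed
  qed
qed

end

section \<open>Algebra of reflections\<close>

lemma reflect_add_scaleR: "reflect e a (x + t *\<^sub>R v) = reflect e a x + t *\<^sub>R reflect e 0 v"
  by (simp add: reflect_def algebra_simps)

lemma reflect_inner:
  assumes "norm e = 1" shows "reflect e a x \<bullet> e = 2 * a - x \<bullet> e"
  using assms by (simp add: reflect_def algebra_simps dot_square_norm)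

lemma reflect_reflect:
  assumes "norm e = 1" shows "reflect e a (reflect e a x) = x"
  unfolding reflect_def[of e a "reflect e a x"] reflect_inner[OF assms]
  by (simp add: reflect_def algebra_simps)

lemma reflect_fixed: "x \<bullet> e = a \<Longrightarrow> reflect e a x = x"
  by (simp add: reflect_def)

lemma inner_reflect_0: "u \<bullet> reflect e 0 v = reflect e 0 u \<bullet> v"
  by (simp add: reflect_def algebra_simps inner_commute)

lemma reflect_0_isometry:
  assumes "norm e = 1" shows "reflect e 0 u \<bullet> reflect e 0 v = u \<bullet> v"
  by (simp add: inner_reflect_0 reflect_reflect[OF assms])

lemma continuous_reflect: "isCont (reflect e a) x"
  unfolding reflect_def by (intro continuous_intros)

lemma reflect_has_derivative: "(reflect e a has_derivative reflect e 0) (at x)"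
  unfolding reflect_def by (auto intro!: derivative_eq_intros)

lemma reflect_minus: "reflect (- e) (- a) x = reflect e a x"
  by (simp add: reflect_def algebra_simps)

section \<open>A fixed position of the plane\<close>

text \<open>As \<phi> is positive exactly on \<Omega>, \<open>reflect_le\<close> also contains the
  geometric fact that the part of \<Omega> beyond the plane is reflected into \<Omega>.\<close>

locale moving_plane = overdetermined \<Omega> \<phi> \<omega> G K xs c0
  for \<Omega> :: "'a::euclidean_space set" and \<phi> \<omega> G K xs c0 +
  fixes e :: 'a and a :: real
  assumes e: "norm e = 1"
    and a: "a > xs \<bullet> e"
    and reflect_le: "\<And>x. x \<bullet> e > a \<Longrightarrow> \<phi> x \<le> \<phi> (reflect e a x)"
begin

definition excess :: "'a \<Rightarrow> real" where "excess x = \<phi> (reflect e a x) - \<phi> x"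

lemma ee: "e \<bullet> e = 1"
  using e by (simp add: dot_square_norm)

lemma excess_cont: "continuous_on S excess"
proof -
  have "continuous_on UNIV (reflect e a)" using continuous_reflect continuous_at_imp_continuous_on by blast
  then have "continuous_on UNIV excess" unfolding excess_def
    by (intro continuous_intros continuous_on_compose2[OF cont]) (auto intro: cont)
  then show ?thesis by (rule continuous_on_subset) auto
qed

lemma excess_fixed: "x \<bullet> e = a \<Longrightarrow> excess x = 0"
  by (simp add: excess_def reflect_fixed)

lemma excess_nonneg: "x \<bullet> e \<ge> a \<Longrightarrow> excess x \<ge> 0"
  using reflect_le[of x] excess_fixed[of x] by (cases "x \<bullet> e = a") (auto simp: excess_def)

lemma right_ne: "x \<bullet> e \<ge> a \<Longrightarrow> x \<noteq> xs"
  using a by auto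

lemma reflect_mem: "x \<in> \<Omega> \<Longrightarrow> x \<bullet> e \<ge> a \<Longrightarrow> reflect e a x \<in> \<Omega>"
  using excess_nonneg[of x] pos[of x] zero[of "reflect e a x"] by (force simp: excess_def)

lemma open_right: "open {x. x \<bullet> e > a}"
  using open_halfspace_gt[of a e] by (simp add: inner_commute)

text \<open>The Laplacian of the excess is a difference of two values of \<omega>. Near a zero of
  the excess both values of \<phi> are close to \<open>\<phi> z\<close>, so \<open>lipschitz\<close>
  applies with one constant.\<close>

lemma excess_laplacian:
  assumes z: "z \<in> closure \<Omega>" "z \<bullet> e \<ge> a" "excess z = 0"
  shows "\<exists>r>0. \<exists>C. \<forall>x\<in>ball z r. x \<in> \<Omega> \<longrightarrow> x \<bullet> e > a \<longrightarrow>
     (\<exists>L. has_laplacian excess L x \<and> L \<le> C * excess x)"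
proof -
  have zx: "z \<noteq> xs" using right_ne[OF z(2)] .
  obtain \<delta> C where \<delta>: "\<delta> > 0" and C: "\<And>x y. x \<in> \<Omega> - {xs} \<Longrightarrow> y \<in> \<Omega> - {xs} \<Longrightarrow>
       \<bar>\<phi> x - \<phi> z\<bar> < \<delta> \<Longrightarrow> \<bar>\<phi> y - \<phi> z\<bar> < \<delta> \<Longrightarrow> \<bar>\<omega> x - \<omega> y\<bar> \<le> C * \<bar>\<phi> x - \<phi> y\<bar>"
    using lipschitz[of z] z zx by blast
  \<comment> \<open>The second bound keeps \<phi> at the mirror point below its maximum, so that
    this point is not \<open>xs\<close>, where no Laplacian is available.\<close>
  define d where "d = min \<delta> (\<phi> xs - \<phi> z)"
  have d: "d > 0" using \<delta> less_max[OF zx] by (simp add: d_def)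
  have "((\<lambda>x. \<phi> (reflect e a x)) \<longlongrightarrow> \<phi> (reflect e a z)) (nhds z)"
    using isCont_o2[OF continuous_reflect cont_at, of z] tendsto_at_iff_tendsto_nhds[of "\<lambda>x. \<phi> (reflect e a x)" z]
    by (simp add: isCont_def)
  from tendstoD[OF this d] have 1: "\<forall>\<^sub>F x in nhds z. \<bar>\<phi> (reflect e a x) - \<phi> z\<bar> < d"
    using z(3) by (simp add: dist_real_def excess_def)
  have "(\<phi> \<longlongrightarrow> \<phi> z) (nhds z)"
    using cont_at[of z] by (simp add: isCont_def tendsto_at_iff_tendsto_nhds)
  from tendstoD[OF this d] have "\<forall>\<^sub>F x in nhds z. \<bar>\<phi> x - \<phi> z\<bar> < d"
    by (simp add: dist_real_def)
  with 1 have "\<forall>\<^sub>F x in nhds z. \<bar>\<phi> (reflect e a x) - \<phi> z\<bar> < d \<and> \<bar>\<phi> x - \<phi> z\<bar> < d"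
    by (rule eventually_conj)
  then obtain r where r: "r > 0" "\<And>x. dist x z < r \<Longrightarrow> \<bar>\<phi> (reflect e a x) - \<phi> z\<bar> < d"
     "\<And>x. dist x z < r \<Longrightarrow> \<bar>\<phi> x - \<phi> z\<bar> < d"
    unfolding eventually_nhds_metric by blast
  show ?thesis
  proof (intro exI conjI ballI impI)
    show "r > 0" by fact
    fix x assume x: "x \<in> ball z r" "x \<in> \<Omega>" "x \<bullet> e > a"
    let ?y = "reflect e a x"
    have xz: "dist x z < r" using x by (simp add: dist_commute)
    have x': "x \<in> \<Omega> - {xs}" using x right_ne[of x] by auto
    have y': "?y \<in> \<Omega> - {xs}"
      using reflect_mem[of x] x r(2)[OF xz] by (auto simp: d_def)
    show "has_laplacian excess (\<omega> ?y - \<omega> x) x"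
    proof -
      have "has_laplacian (\<lambda>x. \<phi> (reflect e a x) + (-1) * \<phi> x) (\<omega> ?y + (-1) * \<omega> x) x"
        using x' y' by (intro has_laplacian_lincomb has_laplacian_reflect e laplacian) auto
      then show ?thesis by (simp add: excess_def[abs_def])
    qed
    have "\<bar>\<omega> ?y - \<omega> x\<bar> \<le> C * \<bar>\<phi> ?y - \<phi> x\<bar>"
      using C[OF y' x'] r(2,3)[OF xz] by (simp add: d_def)
    moreover have "\<bar>\<phi> ?y - \<phi> x\<bar> = excess x" using excess_nonneg[of x] x by (simp add: excess_def)
    ultimately show "\<omega> ?y - \<omega> x \<le> C * excess x" by simp
  qed
qed

lemma excess_zero_open:
  assumes "x \<in> \<Omega>" "x \<bullet> e > a" "excess x = 0"
  shows "\<exists>r>0. ball x r \<subseteq> {y \<in> \<Omega>. y \<bullet> e > a \<and> excess y = 0}"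
proof -
  obtain r1 C where r1: "r1 > 0" "\<And>y. y \<in> ball x r1 \<Longrightarrow> y \<in> \<Omega> \<Longrightarrow> y \<bullet> e > a \<Longrightarrow>
     \<exists>L. has_laplacian excess L y \<and> L \<le> C * excess y"
    using excess_laplacian[OF \<Omega>_closure[OF assms(1)] less_imp_le[OF assms(2)] assms(3)] by blast
  have "open (\<Omega> \<inter> {y. y \<bullet> e > a})" using open_\<Omega> open_right by blast
  then obtain r2 where r2: "r2 > 0" "ball x r2 \<subseteq> \<Omega> \<inter> {y. y \<bullet> e > a}"
    using assms openE by blast
  define r where "r = min r1 r2"
  have r: "ball x r \<subseteq> ball x r1" "ball x r \<subseteq> \<Omega> \<inter> {y. y \<bullet> e > a}" "r > 0"
    using r1 r2 by (auto simp: r_def)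
  have "excess y = 0" if "y \<in> ball x (r/2)" for y
  proof (rule strong_minimum_principle[OF _ _ _ _ that])
    show "continuous_on (ball x r) excess" by (rule excess_cont)
    show "excess y \<ge> 0" if "y \<in> ball x r" for y
      using excess_nonneg[of y] r(2) that by force
    show "\<exists>L. has_laplacian excess L y \<and> L \<le> C * excess y" if "y \<in> ball x r" for y
      using r1(2)[of y] r(1,2) that by blast
  qed fact
  moreover have "ball x (r/2) \<subseteq> ball x r" using r by auto
  ultimately show ?thesis using r by (intro exI[of _ "r/2"]) auto
qed

text \<open>Where the excess vanishes it vanishes on a whole component of the right part of \<open>\<Omega>\<close>. There \<open>\<phi>\<close>
  is symmetric in the plane, so its maximum over the closure is a critical point other than \<open>xs\<close>.\<close>

lemma excess_pos:
  assumes x: "x \<in> \<Omega>" "x \<bullet> e > a"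
  shows "excess x > 0"
proof (rule ccontr)
  assume "\<not> excess x > 0"
  then have x0: "excess x = 0" using excess_nonneg[of x] x by simp
  define \<Sigma> where "\<Sigma> = \<Omega> \<inter> {y. y \<bullet> e > a}"
  have op: "open \<Sigma>" unfolding \<Sigma>_def using open_\<Omega> open_right by blast
  define V where "V = connected_component_set \<Sigma> x"
  have V: "open V" "connected V" "x \<in> V" "V \<subseteq> \<Sigma>"
    using x op connected_component_refl_eq[of \<Sigma> x] connected_component_subset[of \<Sigma> x]
    by (auto simp: V_def open_connected_component \<Sigma>_def)
  have zero_V: "excess y = 0" if "y \<in> V" for y
  proof (rule ccontr)
    assume "excess y \<noteq> 0"
    define P where "P = {y \<in> \<Sigma>. excess y = 0}"
    define Q where "Q = {y \<in> \<Sigma>. excess y \<noteq> 0}"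
    have "open P" unfolding open_contains_ball P_def \<Sigma>_def
      using excess_zero_open by fastforce
    moreover have "open Q"
    proof -
      have "Q = \<Sigma> \<inter> excess -` (- {0})" by (auto simp: Q_def)
      then show ?thesis
        using continuous_open_preimage[OF excess_cont op, of "- {0}"] by (simp add: open_Compl)
    qed
    ultimately show False
      using connectedD[OF V(2), of P Q] V x0 \<open>excess y \<noteq> 0\<close> that by (auto simp: P_def Q_def)
  qed
  obtain q where q: "q \<in> closure V" "\<And>y. y \<in> closure V \<Longrightarrow> \<phi> y \<le> \<phi> q"
  proof -
    have "bounded V" using bounded_\<Omega> V(4) by (auto simp: \<Sigma>_def intro: bounded_subset)
    then show thesis
      using continuous_attains_sup[of "closure V" \<phi>] continuous_on_subset[OF cont] V(3) that
        closure_subset[of V] compact_closure[of V] by (metis empty_iff subsetD top_greatest)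
  qed
  have Vc: "V \<subseteq> closure V" by (rule closure_subset)
  have "\<phi> q \<ge> \<phi> x" using q V Vc by blast
  then have q\<Omega>: "q \<in> \<Omega>" using pos[OF x(1)] zero[of q] by force
  have qe: "q \<bullet> e \<ge> a"
  proof -
    have "closed {y. y \<bullet> e \<ge> a}" using closed_halfspace_ge[of a e] by (simp add: inner_commute)
    then have "closure V \<subseteq> {y. y \<bullet> e \<ge> a}"
      using V(4) by (intro closure_minimal) (auto simp: \<Sigma>_def)
    then show ?thesis using q by blast
  qed
  have qx: "q \<noteq> xs" using right_ne[OF qe] .
  have dq: "(\<phi> has_derivative (\<lambda>h. G q \<bullet> h)) (at q)" using grad_at q\<Omega> qx by blast
  obtain r where r: "r > 0" "ball q r \<subseteq> \<Omega>" using q\<Omega> open_\<Omega> openE by blast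
  \<comment> \<open>A half ball is convex and lies in a single component; so even if
    \<open>q\<close> is on the plane, every direction into the right half space leads into
    \<open>V\<close>.\<close>
  have HV: "ball q r \<inter> {y. y \<bullet> e > a} \<subseteq> V"
  proof -
    let ?H = "ball q r \<inter> {y. y \<bullet> e > a}"
    have "convex ?H" using convex_halfspace_gt[of a e] by (intro convex_Int) (auto simp: inner_commute)
    then have "connected ?H" by (rule convex_connected)
    moreover obtain y where y: "y \<in> V" "y \<in> ball q r"
      using q(1) r(1) closure_approachable by (metis dist_commute mem_ball)
    moreover have "y \<in> ?H" using y V by (auto simp: \<Sigma>_def)
    moreover have "?H \<subseteq> \<Sigma>" using r by (auto simp: \<Sigma>_def)
    ultimately have "?H \<subseteq> connected_component_set \<Sigma> y"
      using connected_component_maximal by metis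
    moreover have "connected_component_set \<Sigma> y = V"
      unfolding V_def using y connected_component_eq unfolding V_def by metis
    ultimately show ?thesis by simp
  qed
  have near: "\<forall>\<^sub>F t in at_right 0. q + t *\<^sub>R h \<in> ball q r" for h
    by (rule eventually_ray_in_open) (use r in auto)
  have down: "G q \<bullet> h \<le> 0" if h: "h \<bullet> e > 0" for h
  proof -
    have "((\<lambda>x. - \<phi> x) has_derivative (\<lambda>h. - (G q \<bullet> h))) (at q)"
      by (intro derivative_intros dq)
    moreover have "\<forall>\<^sub>F t in at_right 0. q + t *\<^sub>R h \<in> UNIV \<and> - \<phi> (q + t *\<^sub>R h) - - \<phi> q \<ge> 0 * t"
      using near[of h] eventually_at_right_less[of 0]
    proof eventually_elim
      case (elim t)
      then have "(q + t *\<^sub>R h) \<bullet> e > a" using qe mult_pos_pos[OF elim(2) h] by (simp add: inner_add_left)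
      then have "q + t *\<^sub>R h \<in> V" using HV elim by blast
      then show ?case using q(2) Vc by auto
    qed
    ultimately have "- (G q \<bullet> h) \<ge> 0" by (rule directional_derivative_ge)
    then show ?thesis by simp
  qed
  have "G q = 0"
  proof (cases "q \<bullet> e > a")
    case True
    then have "q \<in> V" using HV r q\<Omega> by auto
    then have "(\<lambda>h. G q \<bullet> h) = (\<lambda>h. 0)"
      using differential_zero_maxmin[OF _ V(1) dq] q(2) Vc by blast
    then have "G q \<bullet> G q = 0" by meson
    then show ?thesis by simp
  next
    case False
    then have fix_q: "q \<bullet> e = a" using qe by simp
    \<comment> \<open>Along \<open>e\<close> the excess has derivative
      \<open>- 2 * (G q \<bullet> e)\<close> at a point of the plane. Since the excess vanishes on
      \<open>V\<close>, this derivative is zero.\<close>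
    have dex: "(excess has_derivative (\<lambda>h. G q \<bullet> reflect e 0 h - G q \<bullet> h)) (at q)"
      unfolding excess_def
      by (intro derivative_intros has_derivative_compose[OF reflect_has_derivative])
         (simp_all add: dq reflect_fixed[OF fix_q])
    have "G q \<bullet> reflect e 0 e - G q \<bullet> e \<ge> 0"
    proof (rule directional_derivative_ge[OF dex])
      show "\<forall>\<^sub>F t in at_right 0. q + t *\<^sub>R e \<in> UNIV \<and> excess (q + t *\<^sub>R e) - excess q \<ge> 0 * t"
        using eventually_at_right_less[of 0]
        by eventually_elim (use fix_q ee excess_nonneg in \<open>simp add: excess_fixed inner_add_left\<close>)
    qed
    moreover have "((\<lambda>x. - excess x) has_derivative (\<lambda>h. - (G q \<bullet> reflect e 0 h - G q \<bullet> h))) (at q)"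
      by (intro derivative_intros dex)
    then have "- (G q \<bullet> reflect e 0 e - G q \<bullet> e) \<ge> 0"
    proof (rule directional_derivative_ge)
      show "\<forall>\<^sub>F t in at_right 0. q + t *\<^sub>R e \<in> UNIV \<and> - excess (q + t *\<^sub>R e) - - excess q \<ge> 0 * t"
        using near[of e] eventually_at_right_less[of 0]
      proof eventually_elim
        case (elim t)
        then have "(q + t *\<^sub>R e) \<bullet> e > a" using fix_q ee by (simp add: inner_add_left)
        then have "q + t *\<^sub>R e \<in> V" using HV elim by blast
        then show ?case using zero_V excess_fixed[OF fix_q] by simp
      qed
    qed
    moreover have "reflect e 0 e = - e" using ee by (simp add: reflect_def scaleR_2)
    ultimately have Ge: "G q \<bullet> e = 0" by simp
    \<comment> \<open>Adding \<open>e\<close> makes the test direction \<open>G q\<close> point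
      strictly to the right without changing its product with \<open>G q\<close>.\<close>
    have "G q \<bullet> (G q + e) \<le> 0" using down[of "G q + e"] Ge ee by (simp add: inner_add_left)
    then have "G q \<bullet> G q \<le> 0" using Ge by (simp add: inner_add_right)
    then show ?thesis using inner_ge_zero[of "G q"] inner_eq_zero_iff[of "G q"] by linarith
  qed
  then show False using grad_nz[of q] q\<Omega> qx \<Omega>_closure by auto
qed

text \<open>Hopf's lemma for the excess, with a ball touching the plane from the right; along
  \<open>e\<close> the derivative of the excess is \<open>- 2 * (G x \<bullet> e)\<close>.\<close>

lemma grad_flat_neg:
  assumes x: "x \<in> \<Omega>" "x \<bullet> e = a"
  shows "G x \<bullet> e < 0"
proof -
  have xx: "x \<noteq> xs" using right_ne[of x] x by simp
  have x0: "excess x = 0" using excess_fixed x by simp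
  obtain r1 C where r1: "r1 > 0" "\<And>y. y \<in> ball x r1 \<Longrightarrow> y \<in> \<Omega> \<Longrightarrow> y \<bullet> e > a \<Longrightarrow>
     \<exists>L. has_laplacian excess L y \<and> L \<le> C * excess y"
    using excess_laplacian[OF \<Omega>_closure[OF x(1)] eq_refl[OF x(2)[symmetric]] x0] by blast
  obtain r2 where r2: "r2 > 0" "ball x r2 \<subseteq> \<Omega>" using x open_\<Omega> openE by blast
  \<comment> \<open>Points of the closed ball below are within \<open>2 * \<rho>\<close> of
    \<open>x\<close>, so a third of the radii suffices.\<close>
  define \<rho> where "\<rho> = min r1 r2 / 3"
  have \<rho>: "\<rho> > 0" using r1 r2 by (simp add: \<rho>_def)
  define c where "c = x + \<rho> *\<^sub>R e"
  have cx: "dist c x = \<rho>" using e \<rho> by (simp add: c_def dist_norm)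
  have sub: "cball c \<rho> \<subseteq> ball x r1 \<inter> ball x r2"
  proof
    fix y assume "y \<in> cball c \<rho>"
    then have "dist x y \<le> \<rho> + \<rho>" using dist_triangle[of x y c] cx by (simp add: dist_commute)
    moreover have "3 * \<rho> \<le> r1" "3 * \<rho> \<le> r2" by (auto simp: \<rho>_def)
    ultimately show "y \<in> ball x r1 \<inter> ball x r2" using \<rho> by simp
  qed
  have side: "\<bar>(y - c) \<bullet> e\<bar> \<le> dist c y" "y \<bullet> e = a + \<rho> + (y - c) \<bullet> e" for y
    using Cauchy_Schwarz_ineq2[of "y - c" e] e ee x
    by (auto simp: dist_norm norm_minus_commute c_def algebra_simps)
  have "\<exists>\<kappa>>0. \<forall>t\<in>{0..\<rho>/2}. excess (x + t *\<^sub>R ((c - x) /\<^sub>R \<rho>)) \<ge> \<kappa> * t"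
  proof (rule hopf_ball[OF \<rho> cx excess_cont])
    show "excess y \<ge> 0" if "y \<in> cball c \<rho>" for y
      using side[of y] that by (intro excess_nonneg) auto
    have *: "y \<in> \<Omega> \<and> y \<bullet> e > a" if "y \<in> ball c \<rho>" for y
      using side[of y] that sub r2 by (auto dest!: subsetD)
    show "excess y > 0" if "y \<in> ball c \<rho>" for y
      using *[OF that] excess_pos by blast
    show "\<exists>L. has_laplacian excess L y \<and> L \<le> C * excess y" if "y \<in> ball c \<rho>" for y
    proof -
      have "y \<in> cball c \<rho>" using that by auto
      then have "y \<in> ball x r1" using sub by blast
      then show ?thesis using *[OF that] r1(2) by blast
    qed
  qed
  then obtain \<kappa> where \<kappa>: "\<kappa> > 0" "\<And>t. t \<in> {0..\<rho>/2} \<Longrightarrow> excess (x + t *\<^sub>R e) \<ge> \<kappa> * t"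
    using \<rho> by (auto simp: c_def)
  have "(excess has_derivative (\<lambda>h. G x \<bullet> reflect e 0 h - G x \<bullet> h)) (at x)"
    unfolding excess_def
    by (intro derivative_intros has_derivative_compose[OF reflect_has_derivative])
       (simp_all add: grad_at x xx reflect_fixed)
  then have "G x \<bullet> reflect e 0 e - G x \<bullet> e \<ge> \<kappa>"
  proof (rule directional_derivative_ge)
    show "\<forall>\<^sub>F t in at_right 0. x + t *\<^sub>R e \<in> UNIV \<and> excess (x + t *\<^sub>R e) - excess x \<ge> \<kappa> * t"
      unfolding eventually_at_right_field using \<kappa>(2) x0 \<rho>
      by (auto intro!: exI[of _ "\<rho>/2"])
  qed
  moreover have "reflect e 0 e = - e" using ee by (simp add: reflect_def scaleR_2)
  ultimately show ?thesis using \<kappa> by simp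
qed

end

context overdetermined
begin

lemma small_interior_ball:
  assumes "q \<in> frontier \<Omega>" "r > 0"
  obtains \<rho> where "\<rho> > 0" "cball (q + \<rho> *\<^sub>R (G q /\<^sub>R c0)) \<rho> - {q} \<subseteq> \<Omega>"
    "cball (q + \<rho> *\<^sub>R (G q /\<^sub>R c0)) \<rho> \<subseteq> ball q r"
    "dist (q + \<rho> *\<^sub>R (G q /\<^sub>R c0)) q = \<rho>"
proof -
  obtain \<rho>0 where \<rho>0: "\<rho>0 > 0" "\<And>\<rho>. 0 < \<rho> \<Longrightarrow> \<rho> \<le> \<rho>0 \<Longrightarrow> cball (q + \<rho> *\<^sub>R (G q /\<^sub>R c0)) \<rho> - {q} \<subseteq> \<Omega>"
    using interior_ball[OF assms(1)] by blast
  define \<rho> where "\<rho> = min \<rho>0 (r/3)"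
  have \<rho>: "\<rho> > 0" "\<rho> \<le> \<rho>0" "3 * \<rho> \<le> r" using \<rho>0 assms by (auto simp: \<rho>_def)
  let ?c = "q + \<rho> *\<^sub>R (G q /\<^sub>R c0)"
  have d: "dist ?c q = \<rho>"
    using grad_frontier[OF assms(1)] c0_pos[OF assms(1)] \<rho> by (simp add: dist_norm)
  show thesis
  proof
    show "cball ?c \<rho> \<subseteq> ball q r"
    proof
      fix y assume "y \<in> cball ?c \<rho>"
      then have "dist q y \<le> \<rho> + \<rho>" using dist_triangle[of q y ?c] d by (simp add: dist_commute)
      then show "y \<in> ball q r" using \<rho> by simp
    qed
  qed (use \<rho>0 \<rho> d in auto)
qed

end

context moving_plane
begin

lemma reflect_closure_mem:
  assumes "q \<in> closure \<Omega>" "q \<bullet> e > a"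
  shows "reflect e a q \<in> closure \<Omega>"
proof -
  obtain X where X: "\<And>n. X n \<in> \<Omega>" "X \<longlonglongrightarrow> q"
    using assms(1) closure_sequential by blast
  have "\<forall>\<^sub>F n in sequentially. X n \<in> {x. x \<bullet> e > a}"
    by (rule topological_tendstoD[OF X(2) open_right]) (use assms in simp)
  then have "\<forall>\<^sub>F n in sequentially. reflect e a (X n) \<in> closure \<Omega>"
    by eventually_elim (use reflect_mem[OF X(1)] \<Omega>_closure in auto)
  moreover have "(\<lambda>n. reflect e a (X n)) \<longlonglongrightarrow> reflect e a q"
    using isCont_tendsto_compose[OF continuous_reflect X(2)] .
  ultimately show ?thesis
    by (rule Lim_in_closed_set[OF closed_closure _ sequentially_bot])
qed

text \<open>The case of internal tangency. If \<phi> vanished at the mirror image, both points would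
  be on the frontier, where gradients have the same length; since the excess is nonnegative, the
  reflected gradient would coincide with \<open>G q\<close>. Then the excess has zero derivative
  along the inner normal, against Hopf's lemma.\<close>

lemma reflect_frontier_pos:
  assumes q: "q \<in> frontier \<Omega>" "q \<bullet> e > a"
  shows "\<phi> (reflect e a q) > 0"
proof (rule ccontr)
  let ?R = "reflect e a" and ?L = "reflect e 0"
  assume "\<not> \<phi> (?R q) > 0"
  then have Rq0: "\<phi> (?R q) = 0" by (intro antisym nonneg) (simp add: not_less)
  note qD = frontierD[OF q(1)]
  have q0: "\<phi> q = 0" using zero qD by blast
  have exq: "excess q = 0" unfolding excess_def using Rq0 q0 by simp
  have Rq: "?R q \<in> frontier \<Omega>"
    using reflect_closure_mem[of q] q qD Rq0 pos[of "?R q"] by (auto simp: frontier_eq)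
  note RqD = frontierD[OF Rq]
  have c0: "c0 > 0" using c0_pos[OF q(1)] .
  have tright: "\<forall>\<^sub>F t in at_right 0. (q + t *\<^sub>R d) \<bullet> e > a" for d
    using eventually_ray_in_open[OF open_right] q(2) by simp
  have RqR: "?R (q + t *\<^sub>R d) = ?R q + t *\<^sub>R ?L d" for t d by (rule reflect_add_scaleR)
  \<comment> \<open>The derivative of the excess along an inward direction, as a difference of two
    one-sided limits: at frontier points \<phi> is differentiable only from within the
    closure.\<close>
  have dir: "G (?R q) \<bullet> ?L d - G q \<bullet> d \<ge> \<kappa>"
    if d: "G q \<bullet> d > 0" and k: "\<forall>\<^sub>F t in at_right 0. excess (q + t *\<^sub>R d) \<ge> \<kappa> * t" for d \<kappa>
  proof -
    have in1: "\<forall>\<^sub>F t in at_right 0. q + t *\<^sub>R d \<in> \<Omega>" by (rule inward_ray[OF q(1) d])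
    then have in1': "\<forall>\<^sub>F t in at_right 0. q + t *\<^sub>R d \<in> closure \<Omega>"
      by eventually_elim (rule \<Omega>_closure)
    have in2: "\<forall>\<^sub>F t in at_right 0. ?R q + t *\<^sub>R ?L d \<in> closure \<Omega>"
      using in1 tright[of d]
      by eventually_elim (use reflect_mem RqR \<Omega>_closure in \<open>metis less_eq_real_def\<close>)
    have l1: "((\<lambda>t. (\<phi> (q + t *\<^sub>R d) - \<phi> q) / t) \<longlongrightarrow> G q \<bullet> d) (at_right 0)"
      by (rule directional_derivative_tendsto[OF grad[OF qD(1)] in1'])
    have l2: "((\<lambda>t. (\<phi> (?R q + t *\<^sub>R ?L d) - \<phi> (?R q)) / t) \<longlongrightarrow> G (?R q) \<bullet> ?L d) (at_right 0)"
      by (rule directional_derivative_tendsto[OF grad[OF RqD(1)] in2])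
    show ?thesis
    proof (rule tendsto_lowerbound[OF tendsto_diff[OF l2 l1]])
      show "\<forall>\<^sub>F t in at_right 0. \<kappa> \<le> (\<phi> (?R q + t *\<^sub>R ?L d) - \<phi> (?R q)) / t - (\<phi> (q + t *\<^sub>R d) - \<phi> q) / t"
        using k eventually_at_right_less[of 0]
        by eventually_elim (simp add: q0 Rq0 excess_def RqR pos_le_divide_eq flip: diff_divide_distrib)
    qed simp
  qed
  define g where "g = ?L (G (?R q))"
  have ng: "g \<bullet> g = c0\<^sup>2" "G q \<bullet> G q = c0\<^sup>2"
    using grad_frontier[OF Rq] grad_frontier[OF q(1)]
    unfolding g_def reflect_0_isometry[OF e] by (simp_all flip: power2_norm_eq_inner)
  have "G (?R q) \<bullet> ?L (G q) - G q \<bullet> G q \<ge> 0"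
  proof (rule dir)
    show "G q \<bullet> G q > 0" using ng c0 by simp
    show "\<forall>\<^sub>F t in at_right 0. 0 * t \<le> excess (q + t *\<^sub>R G q)"
      using tright[of "G q"] by eventually_elim (use excess_nonneg in force)
  qed
  then have "g \<bullet> G q \<ge> c0\<^sup>2" using ng by (simp add: g_def inner_reflect_0)
  \<comment> \<open>The reflected gradient and \<open>G q\<close> have length \<open>c0\<close> and
    inner product at least its square, the equality case of Cauchy-Schwarz.\<close>
  then have "(g - G q) \<bullet> (g - G q) \<le> 0" using ng by (simp add: inner_diff_left inner_diff_right inner_commute)
  then have "g - G q = 0" using inner_ge_zero[of "g - G q"] inner_eq_zero_iff[of "g - G q"] by linarith
  then have gq: "g = G q" by simp
  obtain r1 C where r1: "r1 > 0" "\<And>y. y \<in> ball q r1 \<Longrightarrow> y \<in> \<Omega> \<Longrightarrow> y \<bullet> e > a \<Longrightarrow>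
     \<exists>L. has_laplacian excess L y \<and> L \<le> C * excess y"
    using excess_laplacian[of q] q qD exq by force
  obtain r2 where r2: "r2 > 0" "ball q r2 \<subseteq> {x. x \<bullet> e > a}"
    using open_right q openE by blast
  define \<nu> where "\<nu> = G q /\<^sub>R c0"
  obtain \<rho> where \<rho>: "\<rho> > 0" "cball (q + \<rho> *\<^sub>R \<nu>) \<rho> - {q} \<subseteq> \<Omega>"
    "cball (q + \<rho> *\<^sub>R \<nu>) \<rho> \<subseteq> ball q (min r1 r2)" "dist (q + \<rho> *\<^sub>R \<nu>) q = \<rho>"
    unfolding \<nu>_def by (rule small_interior_ball[OF q(1), of "min r1 r2"]) (use r1 r2 in auto)
  let ?c = "q + \<rho> *\<^sub>R \<nu>"
  have b: "y \<in> \<Omega>" "y \<bullet> e > a" "y \<in> ball q r1" if "y \<in> ball ?c \<rho>" for y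
  proof -
    have "y \<noteq> q" using that \<rho>(4) by auto
    then show "y \<in> \<Omega>" using that \<rho>(2) by auto
    have "y \<in> cball ?c \<rho>" using that by auto
    then have "y \<in> ball q (min r1 r2)" using \<rho>(3) by blast
    then show "y \<bullet> e > a" "y \<in> ball q r1" using r2(2) by auto
  qed
  have "\<exists>\<kappa>>0. \<forall>t\<in>{0..\<rho>/2}. excess (q + t *\<^sub>R ((?c - q) /\<^sub>R \<rho>)) \<ge> \<kappa> * t"
  proof (rule hopf_ball[OF \<rho>(1,4) excess_cont])
    show "excess y \<ge> 0" if "y \<in> cball ?c \<rho>" for y
    proof -
      have "y \<in> ball q (min r1 r2)" using that \<rho>(3) by blast
      then have "y \<bullet> e > a" using r2(2) by auto
      then show ?thesis by (intro excess_nonneg) simp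
    qed
  qed (use b excess_pos r1(2) in blast)+
  then obtain \<kappa> where \<kappa>: "\<kappa> > 0" "\<And>t. t \<in> {0..\<rho>/2} \<Longrightarrow> excess (q + t *\<^sub>R \<nu>) \<ge> \<kappa> * t"
    using \<rho> by auto
  have "G (?R q) \<bullet> ?L \<nu> - G q \<bullet> \<nu> \<ge> \<kappa>"
  proof (rule dir)
    show "G q \<bullet> \<nu> > 0" using ng c0 by (simp add: \<nu>_def)
    show "\<forall>\<^sub>F t in at_right 0. \<kappa> * t \<le> excess (q + t *\<^sub>R \<nu>)"
      unfolding eventually_at_right_field using \<kappa>(2) \<rho>(1) by (auto intro!: exI[of _ "\<rho>/2"])
  qed
  moreover have "G (?R q) \<bullet> ?L \<nu> = G q \<bullet> \<nu>" using gq by (simp add: g_def inner_reflect_0)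
  ultimately show False using \<kappa> by simp
qed

end

context overdetermined
begin

text \<open>Near \<open>q\<close> the direction \<open>e + \<eta> *\<^sub>R G q\<close> leads inside
  and \<open>e - \<eta> *\<^sub>R G q\<close> outside, for otherwise \<open>inward\<close> would
  push \<open>q\<close> itself into \<Omega>. The segment between the two points crosses the
  frontier. This stands in for a boundary curve tangent to \<open>e\<close>.\<close>

lemma frontier_near_tangent:
  assumes q: "q \<in> frontier \<Omega>" and tan: "G q \<bullet> e = 0" and \<eta>: "\<eta> > 0"
  shows "\<forall>\<^sub>F s in at_right 0. \<exists>\<theta>. \<bar>\<theta>\<bar> \<le> \<eta> \<and> q + s *\<^sub>R (e + \<theta> *\<^sub>R G q) \<in> frontier \<Omega>"
proof -
  have Gq: "G q \<bullet> G q > 0" using grad_nz frontierD[OF q] by simp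
  have p1: "G q \<bullet> (e + \<eta> *\<^sub>R G q) > 0" and p2: "G q \<bullet> (- e + \<eta> *\<^sub>R G q) > 0"
    using \<eta> Gq tan by (simp_all add: inner_add_right inner_diff_right)
  obtain \<delta> where \<delta>: "\<delta> > 0" and in2: "\<And>x t. x \<in> closure \<Omega> \<inter> ball q \<delta> \<Longrightarrow> t > 0 \<Longrightarrow>
      x + t *\<^sub>R (- e + \<eta> *\<^sub>R G q) \<in> ball q \<delta> \<Longrightarrow> x + t *\<^sub>R (- e + \<eta> *\<^sub>R G q) \<in> \<Omega>"
    using inward[OF q p2] by blast
  have near: "\<forall>\<^sub>F s in at_right 0. q + s *\<^sub>R (e - \<eta> *\<^sub>R G q) \<in> ball q \<delta>"
    by (rule eventually_ray_in_open) (use \<delta> in auto)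
  show ?thesis
    using inward_ray[OF q p1] near eventually_at_right_less[of 0]
  proof eventually_elim
    case (elim s)
    let ?p = "q + s *\<^sub>R (e - \<eta> *\<^sub>R G q)" and ?p' = "q + s *\<^sub>R (e + \<eta> *\<^sub>R G q)"
    have eq: "?p + s *\<^sub>R (- e + \<eta> *\<^sub>R G q) = q" by (simp add: algebra_simps)
    have "?p \<notin> \<Omega>"
    proof
      assume "?p \<in> \<Omega>"
      then have "?p + s *\<^sub>R (- e + \<eta> *\<^sub>R G q) \<in> \<Omega>"
        using elim \<Omega>_closure \<delta> by (intro in2) (simp_all only: eq Int_iff simp_thms centre_in_ball)
      then have "q \<in> \<Omega>" by (simp only: eq)
      then show False using frontierD[OF q] by simp
    qed
    then have "closed_segment ?p ?p' \<inter> frontier \<Omega> \<noteq> {}"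
      using elim(1) by (intro connected_Int_frontier) auto
    then obtain y where y: "y \<in> frontier \<Omega>" "y \<in> closed_segment ?p ?p'" by blast
    then obtain v where v: "0 \<le> v" "v \<le> 1" "y = (1 - v) *\<^sub>R ?p + v *\<^sub>R ?p'"
      by (auto simp: in_segment)
    have "y = q + s *\<^sub>R (e + ((2 * v - 1) * \<eta>) *\<^sub>R G q)"
      unfolding v(3) by (simp add: algebra_simps) (simp flip: scaleR_add_left)
    moreover have "\<bar>(2 * v - 1) * \<eta>\<bar> \<le> 1 * \<eta>"
      unfolding abs_mult using v \<eta> by (intro mult_mono) auto
    ultimately show ?case using y(1) by (intro exI[of _ "(2 * v - 1) * \<eta>"]) simp
  qed
qed

text \<open>Differentiating \<open>|\<nabla>\<phi>|\<^sup>2 = c0\<^sup>2\<close> along the boundary.\<close>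

lemma hessian_tangential:
  assumes q: "q \<in> frontier \<Omega>" and tan: "G q \<bullet> e = 0"
  shows "K q e \<bullet> G q = 0"
proof (rule ccontr)
  assume nz: "K q e \<bullet> G q \<noteq> 0"
  note qD = frontierD[OF q]
  \<comment> \<open>The frontier points used deviate from the direction \<open>e\<close> by at most
    \<eta>; the errors of the expansion of the squared length of \<open>G\<close> at them add up to
    at most \<open>\<eta> * m\<close>, and \<eta> is chosen to keep this below the value assumed
    nonzero.\<close>
  define m where "m = norm e + norm (G q) + \<bar>K q (G q) \<bullet> G q\<bar> + 1"
  have m: "m > 0" by (simp add: m_def add_nonneg_pos)
  define \<eta> where "\<eta> = min 1 (\<bar>K q e \<bullet> G q\<bar> / (2 * m))"
  have \<eta>: "\<eta> > 0" "\<eta> \<le> 1" "\<eta> * m < \<bar>K q e \<bullet> G q\<bar>"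
  proof -
    show "\<eta> > 0" "\<eta> \<le> 1" using nz m by (auto simp: \<eta>_def)
    have "\<eta> * m \<le> \<bar>K q e \<bullet> G q\<bar> / (2 * m) * m" using m by (intro mult_right_mono) (auto simp: \<eta>_def)
    then show "\<eta> * m < \<bar>K q e \<bullet> G q\<bar>" using nz m by simp
  qed
  have lin: "linear (K q)" using hess[OF qD(1)] has_derivative_linear by blast
  have "((\<lambda>x. G x \<bullet> G x) has_derivative (\<lambda>h. G q \<bullet> K q h + K q h \<bullet> G q)) (at q within closure \<Omega>)"
    by (intro has_derivative_inner hess[OF qD(1)])
  then obtain d where d: "d > 0" and D: "\<And>y. y \<in> closure \<Omega> \<Longrightarrow> norm (y - q) < d \<Longrightarrow>
      norm (G y \<bullet> G y - G q \<bullet> G q - (G q \<bullet> K q (y - q) + K q (y - q) \<bullet> G q)) \<le> 2 * \<eta> * norm (y - q)"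
    using \<eta>(1) unfolding has_derivative_within_alt
    by (metis (no_types, lifting) mult_pos_pos zero_less_numeral)
  have "((\<lambda>s. s * (norm e + norm (G q))) \<longlongrightarrow> 0 * (norm e + norm (G q))) (at_right 0)"
    by (intro tendsto_intros)
  then have "\<forall>\<^sub>F s in at_right 0. s * (norm e + norm (G q)) < d"
    by (rule order_tendstoD) (use d in simp)
  moreover have "\<forall>\<^sub>F s in at_right (0::real). 0 < s" by (rule eventually_at_right_less)
  ultimately have "\<forall>\<^sub>F s in at_right (0::real). False"
    using frontier_near_tangent[OF q tan \<eta>(1)]
  proof eventually_elim
    case (elim s)
    then obtain \<theta> where \<theta>: "\<bar>\<theta>\<bar> \<le> \<eta>" "q + s *\<^sub>R (e + \<theta> *\<^sub>R G q) \<in> frontier \<Omega>" by blast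
    let ?v = "e + \<theta> *\<^sub>R G q"
    have "\<bar>\<theta>\<bar> * norm (G q) \<le> 1 * norm (G q)" using \<theta> \<eta> by (intro mult_right_mono) auto
    then have nv: "norm ?v \<le> norm e + norm (G q)"
      using norm_triangle_ineq[of e "\<theta> *\<^sub>R G q"] by simp
    have "norm (s *\<^sub>R ?v) \<le> s * (norm e + norm (G q))"
      using nv elim by (simp add: mult_left_mono)
    then have "norm (s *\<^sub>R ?v) < d" using elim by linarith
    moreover have "G (q + s *\<^sub>R ?v) \<bullet> G (q + s *\<^sub>R ?v) = G q \<bullet> G q"
      using grad_frontier[OF q] grad_frontier[OF \<theta>(2)] by (simp flip: power2_norm_eq_inner)
    ultimately have "\<bar>2 * (K q (s *\<^sub>R ?v) \<bullet> G q)\<bar> \<le> 2 * \<eta> * norm (s *\<^sub>R ?v)"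
      using D[OF frontierD(1)[OF \<theta>(2), THEN DiffD1]] by (simp add: inner_commute)
    then have "s * \<bar>K q ?v \<bullet> G q\<bar> \<le> s * (\<eta> * norm ?v)"
      using elim by (simp add: linear_cmul[OF lin] abs_mult mult_ac)
    then have "\<bar>K q ?v \<bullet> G q\<bar> \<le> \<eta> * norm ?v" using elim by simp
    also have "\<dots> \<le> \<eta> * (norm e + norm (G q))" using nv \<eta> by (intro mult_left_mono) auto
    finally have "\<bar>K q e \<bullet> G q + \<theta> * (K q (G q) \<bullet> G q)\<bar> \<le> \<eta> * (norm e + norm (G q))"
      by (simp add: linear_add[OF lin] linear_cmul[OF lin] inner_add_left)
    moreover have "\<bar>\<theta> * (K q (G q) \<bullet> G q)\<bar> \<le> \<eta> * \<bar>K q (G q) \<bullet> G q\<bar>"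
      unfolding abs_mult using \<theta> by (intro mult_right_mono) auto
    ultimately have "\<bar>K q e \<bullet> G q\<bar> \<le> \<eta> * (norm e + norm (G q)) + \<eta> * \<bar>K q (G q) \<bullet> G q\<bar>" by linarith
    also have "\<dots> \<le> \<eta> * m" using \<eta> by (simp add: m_def algebra_simps)
    finally show False using \<eta> by simp
  qed
  then show False by simp
qed

end

context moving_plane
begin

lemma corner_second_order:
  assumes q: "q \<in> frontier \<Omega>" "q \<bullet> e = a" and v: "G q \<bullet> v > 0"
  shows "((\<lambda>t. (\<phi> (q + t *\<^sub>R v) - t * (G q \<bullet> v)) / t\<^sup>2) \<longlongrightarrow> (K q v \<bullet> v) / 2) (at_right 0)"
proof -
  note qD = frontierD[OF q(1)]
  let ?S = "closure \<Omega> - {xs}"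
  have "((\<lambda>t. (\<phi> (q + t *\<^sub>R v) - \<phi> q - t * (G q \<bullet> v)) / t\<^sup>2) \<longlongrightarrow> (K q v \<bullet> v) / 2) (at_right 0)"
  proof (rule second_order_tendsto)
    show "(\<phi> has_derivative (\<lambda>h. G y \<bullet> h)) (at y within ?S)" if "y \<in> ?S" for y
      by (rule has_derivative_subset[OF grad[OF that]]) auto
    show "(G has_derivative K q) (at q within ?S)"
      by (rule has_derivative_subset[OF hess[OF qD(1)]]) auto
    have "\<forall>\<^sub>F t in at_right 0. q + t *\<^sub>R v \<in> - {xs}"
      by (rule eventually_ray_in_open) (use qD in auto)
    then show "\<forall>\<^sub>F t in at_right 0. q + t *\<^sub>R v \<in> ?S"
      using inward_ray[OF q(1) v] by eventually_elim (use \<Omega>_closure in auto)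
  qed (use qD in auto)
  then show ?thesis using zero qD by simp
qed

text \<open>\<open>serrin_corner\<close> would give the excess quadratic growth along
  \<open>e + \<nu>\<close>. But the second order expansions of \<phi> along \<open>e + \<nu>\<close>
  and its mirror direction \<open>- e + \<nu>\<close> agree: they differ by mixed terms in
  \<open>e\<close> and \<nu>, which vanish by \<open>hessian_tangential\<close> and symmetry of the
  Hessian.\<close>

lemma not_orthogonal:
  assumes q: "q \<in> frontier \<Omega>" "q \<bullet> e = a"
  shows "G q \<bullet> e \<noteq> 0"
proof
  assume tan: "G q \<bullet> e = 0"
  note qD = frontierD[OF q(1)]
  have c0: "c0 > 0" using c0_pos[OF q(1)] .
  define \<nu> where "\<nu> = G q /\<^sub>R c0"
  have \<nu>: "norm \<nu> = 1" "e \<bullet> \<nu> = 0" "\<nu> \<bullet> e = 0" "G q \<bullet> \<nu> = c0"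
    using grad_frontier[OF q(1)] c0 tan
    by (auto simp: \<nu>_def inner_commute power2_eq_square simp flip: power2_norm_eq_inner)
  have exq: "excess q = 0" using excess_fixed q by simp
  obtain r C where r: "r > 0" "\<And>y. y \<in> ball q r \<Longrightarrow> y \<in> \<Omega> \<Longrightarrow> y \<bullet> e > a \<Longrightarrow>
     \<exists>L. has_laplacian excess L y \<and> L \<le> C * excess y"
    using excess_laplacian[of q] q qD exq by force
  obtain \<rho> where \<rho>: "\<rho> > 0" "cball (q + \<rho> *\<^sub>R \<nu>) \<rho> - {q} \<subseteq> \<Omega>"
    "cball (q + \<rho> *\<^sub>R \<nu>) \<rho> \<subseteq> ball q r"
    unfolding \<nu>_def by (rule small_interior_ball[OF q(1) r(1)])
  define c where "c = q + \<rho> *\<^sub>R \<nu>"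
  have s: "(x - q) \<bullet> e = x \<bullet> e - a" for x using q by (simp add: inner_diff_left)
  have "\<exists>\<kappa>>0. \<forall>t\<in>{0..\<rho>/4}. excess (q + t *\<^sub>R (e + \<nu>)) \<ge> \<kappa> * t\<^sup>2"
  proof (rule serrin_corner[OF \<rho>(1) e \<nu>(1,2) c_def excess_cont])
    show "excess x \<ge> 0" if "(x - q) \<bullet> e \<ge> 0" for x
      using that excess_nonneg[of x] by (simp add: s)
    show pos: "excess x > 0" if "x \<in> cball c \<rho> - {q}" "(x - q) \<bullet> e > 0" for x
      using that \<rho>(2) excess_pos[of x] by (auto simp: c_def s)
    show "\<exists>L. has_laplacian excess L x \<and> L \<le> C * excess x"
      if x: "x \<in> ball c \<rho>" "(x - q) \<bullet> e > 0" for x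
    proof -
      have "x \<noteq> q" using x by auto
      moreover have "x \<in> cball c \<rho>" using x by auto
      ultimately have "x \<in> \<Omega>" "x \<in> ball q r" using \<rho>(2,3) by (auto simp: c_def)
      then show ?thesis using r(2) x by (simp add: s)
    qed
    fix x assume x: "x \<in> cball c \<rho> - {q}" "(x - q) \<bullet> e = 0"
    have x\<Omega>: "x \<in> \<Omega>" and xe: "x \<bullet> e = a" using x \<rho>(2) by (auto simp: c_def s)
    \<comment> \<open>Verification of \<open>flat\<close>: near a point of the plane inside
      \<Omega>, \<phi> grows to the left at a uniform rate \<kappa>.\<close>
    have "G x \<bullet> (- e) > 0" using grad_flat_neg[OF x\<Omega> xe] by simp
    then obtain \<kappa> r' where \<kappa>: "\<kappa> > 0" "r' > 0" and inc: "\<And>y t. y \<in> \<Omega> \<inter> ball x r' \<Longrightarrow> t \<ge> 0 \<Longrightarrow>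
        y + t *\<^sub>R (- e) \<in> ball x r' \<Longrightarrow> \<phi> (y + t *\<^sub>R (- e)) \<ge> \<phi> y + \<kappa> * t"
      using increasing_along[of x "- e"] x\<Omega> \<Omega>_closure right_ne[of x] xe by auto
    have "open (\<Omega> \<inter> ball x r')" using open_\<Omega> by auto
    then have "\<forall>\<^sub>F y in nhds x. y \<in> \<Omega> \<inter> ball x r'"
      using x\<Omega> \<kappa> by (intro eventually_nhds_in_open) auto
    then have 1: "\<forall>\<^sub>F y in at x. y \<in> \<Omega> \<inter> ball x r'" by (simp add: eventually_at_filter eventually_mono)
    have "(reflect e a \<longlongrightarrow> reflect e a x) (at x)" using continuous_reflect isCont_def by blast
    then have 2: "\<forall>\<^sub>F y in at x. reflect e a y \<in> ball x r'"
      by (rule topological_tendstoD) (use \<kappa> xe in \<open>auto simp: reflect_fixed\<close>)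
    show "\<exists>\<epsilon>>0. \<forall>\<^sub>F y in at x. y \<in> cball c \<rho> \<longrightarrow> (y - q) \<bullet> e > 0 \<longrightarrow> excess y \<ge> \<epsilon> * ((y - q) \<bullet> e)"
    proof (intro exI conjI)
      \<comment> \<open>A point and its mirror image are twice as far apart as the point is from the
        plane.\<close>
      show "2 * \<kappa> > 0" using \<kappa> by simp
      show "\<forall>\<^sub>F y in at x. y \<in> cball c \<rho> \<longrightarrow> (y - q) \<bullet> e > 0 \<longrightarrow> excess y \<ge> 2 * \<kappa> * ((y - q) \<bullet> e)"
        using 1 2
      proof eventually_elim
        case (elim y)
        show ?case
        proof (intro impI)
          assume "(y - q) \<bullet> e > 0"
          then have "\<phi> (y + (2 * (y \<bullet> e - a)) *\<^sub>R (- e)) \<ge> \<phi> y + \<kappa> * (2 * (y \<bullet> e - a))"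
            using elim by (intro inc) (simp_all add: s reflect_def)
          then have "excess y \<ge> \<kappa> * (2 * (y \<bullet> e - a))" by (simp add: excess_def reflect_def)
          then show "excess y \<ge> 2 * \<kappa> * ((y - q) \<bullet> e)" by (simp add: s mult_ac)
        qed
      qed
    qed
  qed
  then obtain \<kappa> where \<kappa>: "\<kappa> > 0" "\<And>t. t \<in> {0..\<rho>/4} \<Longrightarrow> excess (q + t *\<^sub>R (e + \<nu>)) \<ge> \<kappa> * t\<^sup>2" by blast
  let ?d = "e + \<nu>" and ?d' = "- e + \<nu>"
  have R0d: "reflect e 0 ?d = ?d'" using \<nu>(3) ee by (simp add: reflect_def inner_add_left scaleR_2)
  have Gd: "G q \<bullet> ?d = c0" "G q \<bullet> ?d' = c0" using \<nu> tan by (simp_all add: inner_add_right inner_diff_right)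
  have "((\<lambda>t. (\<phi> (q + t *\<^sub>R ?d') - t * (G q \<bullet> ?d')) / t\<^sup>2 - (\<phi> (q + t *\<^sub>R ?d) - t * (G q \<bullet> ?d)) / t\<^sup>2)
     \<longlongrightarrow> (K q ?d' \<bullet> ?d') / 2 - (K q ?d \<bullet> ?d) / 2) (at_right 0)"
    by (intro tendsto_diff corner_second_order q) (use Gd c0 in auto)
  moreover have "(\<phi> (q + t *\<^sub>R ?d') - t * (G q \<bullet> ?d')) / t\<^sup>2 - (\<phi> (q + t *\<^sub>R ?d) - t * (G q \<bullet> ?d)) / t\<^sup>2
      = excess (q + t *\<^sub>R ?d) / t\<^sup>2" for t
    unfolding excess_def reflect_add_scaleR R0d reflect_fixed[OF q(2)] Gd
    by (simp add: diff_divide_distrib)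
  moreover have "(K q ?d' \<bullet> ?d') / 2 - (K q ?d \<bullet> ?d) / 2 = 0"
  proof -
    have lin: "linear (K q)" using hess[OF qD(1)] has_derivative_linear by blast
    have k1: "K q e \<bullet> \<nu> = 0" using hessian_tangential[OF q(1) tan] by (simp add: \<nu>_def)
    have k2: "K q \<nu> \<bullet> e = 0" using hess_symmetric[OF q(1), of e \<nu>] k1 by (simp add: inner_commute)
    show ?thesis
      by (simp add: linear_add[OF lin] linear_neg[OF lin] inner_add_left inner_add_right
          inner_diff_left inner_diff_right linear_diff[OF lin] k1 k2)
  qed
  ultimately have lim: "((\<lambda>t. excess (q + t *\<^sub>R ?d) / t\<^sup>2) \<longlongrightarrow> 0) (at_right 0)" by simp
  have "0 \<ge> \<kappa>"
  proof (rule tendsto_lowerbound[OF lim])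
    have "\<forall>\<^sub>F t in at_right 0. 0 < t \<and> t < \<rho>/4"
      unfolding eventually_at_right_field using \<rho>(1) by (intro exI[of _ "\<rho>/4"]) auto
    then show "\<forall>\<^sub>F t in at_right 0. \<kappa> \<le> excess (q + t *\<^sub>R ?d) / t\<^sup>2"
      by eventually_elim (use \<kappa>(2) in \<open>simp add: pos_le_divide_eq\<close>)
  qed simp
  then show False using \<kappa> by simp
qed

text \<open>If \<open>e\<close> pointed inward at \<open>q\<close>, points slightly to the right of
  \<open>q\<close> would be in \<Omega>, and so would their mirror images to the left; there \<phi>
  \<ge> 0 contradicts a negative derivative along \<open>- e\<close>.\<close>

lemma grad_boundary_neg:
  assumes q: "q \<in> frontier \<Omega>" "q \<bullet> e = a"
  shows "G q \<bullet> e < 0"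
proof (rule ccontr)
  assume "\<not> G q \<bullet> e < 0"
  then have p: "G q \<bullet> e > 0" using not_orthogonal[OF q] by simp
  note qD = frontierD[OF q(1)]
  have ev: "\<forall>\<^sub>F t in at_right 0. q + t *\<^sub>R (- e) \<in> \<Omega>"
    using inward_ray[OF q(1) p] eventually_at_right_less[of 0]
  proof eventually_elim
    case (elim t)
    then have "reflect e a (q + t *\<^sub>R e) \<in> \<Omega>" using q(2) ee
      by (intro reflect_mem) (auto simp: inner_add_left)
    then show ?case
      unfolding reflect_add_scaleR reflect_fixed[OF q(2)] using ee by (simp add: reflect_def scaleR_2)
  qed
  have "G q \<bullet> (- e) \<ge> 0"
  proof (rule directional_derivative_ge[OF grad[OF qD(1)]])
    show "\<forall>\<^sub>F t in at_right 0. q + t *\<^sub>R (- e) \<in> closure \<Omega> \<and> 0 * t \<le> \<phi> (q + t *\<^sub>R (- e)) - \<phi> q"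
      using ev by eventually_elim (use \<Omega>_closure nonneg zero[OF qD(2)] in auto)
  qed
  then show False using p by simp
qed

end

section \<open>Moving the plane to the null point\<close>

context overdetermined
begin

text \<open>At the supremum \<open>a1\<close> of the bad positions the inequality still holds by
  continuity, and violations at bad positions tending to \<open>a1\<close> accumulate at a zero
  \<open>z\<close> of the excess. \<open>excess_pos\<close> and \<open>reflect_frontier_pos\<close>
  force \<open>z\<close> onto the plane, where uniform growth of \<phi> across the plane excludes
  the violations.\<close>

lemma reflection_increases:
  assumes e: "norm e = 1" and a: "a > xs \<bullet> e" and x: "x \<bullet> e > a"
  shows "\<phi> x \<le> \<phi> (reflect e a x)"
proof (rule ccontr)
  assume bad: "\<not> \<phi> x \<le> \<phi> (reflect e a x)"
  define P where "P a \<longleftrightarrow> (\<forall>x. x \<bullet> e > a \<longrightarrow> \<phi> x \<le> \<phi> (reflect e a x))" for a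
  define S where "S = {a. a > xs \<bullet> e \<and> \<not> P a}"
  have aS: "a \<in> S" using bad a x by (auto simp: S_def P_def)
  obtain b where b: "\<And>x. x \<in> \<Omega> \<Longrightarrow> norm x \<le> b" using bounded_\<Omega> bounded_iff by blast
  have bdd: "bdd_above S"
  proof (rule bdd_aboveI)
    fix c assume "c \<in> S"
    then obtain y where y: "y \<bullet> e > c" "\<phi> y > \<phi> (reflect e c y)" by (auto simp: S_def P_def)
    then have "y \<in> \<Omega>" using zero[of y] nonneg[of "reflect e c y"] by force
    then show "c \<le> b" using b[of y] y Cauchy_Schwarz_ineq2[of y e] e by simp
  qed
  define a1 where "a1 = Sup S"
  have a1: "a1 > xs \<bullet> e" using cSup_upper[OF aS bdd] a by (simp add: a1_def)
  have P: "P c" if "c > a1" for c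
    using that a1 cSup_upper[OF _ bdd, of c] by (force simp: a1_def S_def)
  have "P a1" unfolding P_def
  proof (intro allI impI)
    fix y assume y: "y \<bullet> e > a1"
    have "((\<lambda>c. reflect e c y) \<longlongrightarrow> reflect e a1 y) (at_right a1)"
      unfolding reflect_def by (intro tendsto_intros)
    then have "((\<lambda>c. \<phi> (reflect e c y)) \<longlongrightarrow> \<phi> (reflect e a1 y)) (at_right a1)"
      by (rule isCont_tendsto_compose[OF cont_at])
    moreover have "\<forall>\<^sub>F c in at_right a1. c < y \<bullet> e \<and> a1 < c"
      unfolding eventually_at_right_field using y by (intro exI[of _ "y \<bullet> e"]) auto
    then have "\<forall>\<^sub>F c in at_right a1. \<phi> y \<le> \<phi> (reflect e c y)"
      by eventually_elim (use P in \<open>auto simp: P_def\<close>)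
    ultimately show "\<phi> y \<le> \<phi> (reflect e a1 y)"
      by (intro tendsto_lowerbound[where F = "at_right a1"]) auto
  qed
  then interpret mp: moving_plane \<Omega> \<phi> \<omega> G K xs c0 e a1
    by unfold_locales (use e a1 in \<open>auto simp: P_def\<close>)
  have "a1 \<in> closure S" unfolding a1_def using closure_contains_Sup aS bdd by blast
  then obtain A where A: "\<And>n. A n \<in> S" "A \<longlonglongrightarrow> a1" using closure_sequential by blast
  then have "\<exists>y. y \<bullet> e > A n \<and> \<phi> y > \<phi> (reflect e (A n) y)" for n
    by (force simp: S_def P_def not_le)
  then obtain X where X: "\<And>n. X n \<bullet> e > A n" "\<And>n. \<phi> (X n) > \<phi> (reflect e (A n) (X n))" by metis
  have X\<Omega>: "X n \<in> \<Omega>" for n using zero[of "X n"] nonneg[of "reflect e (A n) (X n)"] X(2)[of n] by force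
  obtain z r where r: "strict_mono r" and z: "z \<in> closure \<Omega>" "(X \<circ> r) \<longlonglongrightarrow> z"
    using bounded_\<Omega> X\<Omega> \<Omega>_closure unfolding compact_closure[symmetric] compact_def by metis
  have Xl: "(\<lambda>n. X (r n)) \<longlonglongrightarrow> z" using z(2) by (simp add: o_def)
  have Al: "(\<lambda>n. A (r n)) \<longlonglongrightarrow> a1" using LIMSEQ_subseq_LIMSEQ[OF A(2) r] by (simp add: o_def)
  have Rl: "(\<lambda>n. reflect e (A (r n)) (X (r n))) \<longlonglongrightarrow> reflect e a1 z"
    unfolding reflect_def by (intro tendsto_intros Xl Al)
  have ze: "z \<bullet> e \<ge> a1"
    by (rule tendsto_le[OF _ tendsto_inner[OF Xl tendsto_const] Al])
       (use X(1) in \<open>auto intro!: always_eventually less_imp_le\<close>)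
  have "\<phi> (reflect e a1 z) \<le> \<phi> z"
    by (rule tendsto_le[OF _ isCont_tendsto_compose[OF cont_at Xl] isCont_tendsto_compose[OF cont_at Rl]])
       (use X(2) in \<open>auto intro!: always_eventually less_imp_le\<close>)
  then have exz: "mp.excess z = 0" using mp.excess_nonneg[OF ze] by (simp add: mp.excess_def)
  show False
  proof (cases "z \<bullet> e > a1")
    case True
    show False
    proof (cases "z \<in> \<Omega>")
      case False
      then have "z \<in> frontier \<Omega>" using z by (simp add: frontier_eq)
      then show False
        using mp.reflect_frontier_pos[OF _ True] exz zero[OF False] by (simp add: mp.excess_def)
    qed (use mp.excess_pos[OF _ True] exz in simp)
  next
    case False
    then have eq: "z \<bullet> e = a1" using ze by simp
    \<comment> \<open>Inside \<Omega> this is Hopf's lemma on the plane; at a frontier point it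
      rests on the exclusion of the corner.\<close>
    have "G z \<bullet> (- e) > 0"
      using mp.grad_flat_neg[OF _ eq] mp.grad_boundary_neg[OF _ eq] z
      by (cases "z \<in> \<Omega>") (auto simp: frontier_eq)
    then obtain \<kappa> r' where \<kappa>: "\<kappa> > 0" "r' > 0" and inc: "\<And>y t. y \<in> \<Omega> \<inter> ball z r' \<Longrightarrow> t \<ge> 0 \<Longrightarrow>
        y + t *\<^sub>R (- e) \<in> ball z r' \<Longrightarrow> \<phi> (y + t *\<^sub>R (- e)) \<ge> \<phi> y + \<kappa> * t"
      using increasing_along[of z "- e"] z mp.right_ne[OF ze] by auto
    have "\<forall>\<^sub>F n in sequentially. X (r n) \<in> ball z r'"
      by (rule topological_tendstoD[OF Xl]) (use \<kappa> in auto)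
    moreover have "\<forall>\<^sub>F n in sequentially. reflect e (A (r n)) (X (r n)) \<in> ball z r'"
      by (rule topological_tendstoD[OF Rl]) (use \<kappa> eq in \<open>auto simp: reflect_fixed\<close>)
    ultimately have "\<forall>\<^sub>F n in sequentially. False"
    proof eventually_elim
      case (elim n)
      let ?t = "2 * (X (r n) \<bullet> e - A (r n))"
      have eqr: "reflect e (A (r n)) (X (r n)) = X (r n) + ?t *\<^sub>R (- e)" by (simp add: reflect_def)
      have t: "?t \<ge> 0" using X(1)[of "r n"] by simp
      have "\<phi> (X (r n)) + \<kappa> * ?t \<le> \<phi> (reflect e (A (r n)) (X (r n)))"
        using inc[OF _ t, of "X (r n)"] elim X\<Omega> unfolding eqr by blast
      moreover have "\<kappa> * ?t \<ge> 0" using \<kappa> t by (intro mult_nonneg_nonneg) auto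
      ultimately show False using X(2)[of "r n"] by linarith
    qed
    then show False by simp
  qed
qed

text \<open>In the limit of planes tending to \<open>xs\<close>, the inequalities for
  \<open>e\<close> and \<open>- e\<close> concern the same reflection and are opposite to each
  other.\<close>

lemma reflection_symmetric:
  assumes e: "norm e = 1"
  shows "\<phi> (reflect e (xs \<bullet> e) x) = \<phi> x"
proof -
  have le: "\<phi> y \<le> \<phi> (reflect v (xs \<bullet> v) y)" if v: "norm v = 1" and y: "y \<bullet> v > xs \<bullet> v" for v y
  proof -
    have "((\<lambda>c. reflect v c y) \<longlongrightarrow> reflect v (xs \<bullet> v) y) (at_right (xs \<bullet> v))"
      unfolding reflect_def by (intro tendsto_intros)
    then have "((\<lambda>c. \<phi> (reflect v c y)) \<longlongrightarrow> \<phi> (reflect v (xs \<bullet> v) y)) (at_right (xs \<bullet> v))"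
      by (rule isCont_tendsto_compose[OF cont_at])
    moreover have "\<forall>\<^sub>F c in at_right (xs \<bullet> v). xs \<bullet> v < c \<and> c < y \<bullet> v"
      unfolding eventually_at_right_field using y by (intro exI[of _ "y \<bullet> v"]) auto
    then have "\<forall>\<^sub>F c in at_right (xs \<bullet> v). \<phi> y \<le> \<phi> (reflect v c y)"
      by eventually_elim (use reflection_increases[OF v] in auto)
    ultimately show ?thesis
      by (intro tendsto_lowerbound[where F = "at_right (xs \<bullet> v)"]) auto
  qed
  have right: "\<phi> (reflect e (xs \<bullet> e) y) = \<phi> y" if y: "y \<bullet> e > xs \<bullet> e" for y
  proof (rule antisym)
    let ?y = "reflect e (xs \<bullet> e) y"
    have "?y \<bullet> (- e) > xs \<bullet> (- e)" using y reflect_inner[OF e, of "xs \<bullet> e" y] by simp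
    from le[OF _ this] have "\<phi> ?y \<le> \<phi> (reflect (- e) (- (xs \<bullet> e)) ?y)" using e by simp
    then show "\<phi> ?y \<le> \<phi> y" by (simp only: reflect_minus reflect_reflect[OF e])
  qed (rule le[OF e y])
  consider "x \<bullet> e > xs \<bullet> e" | "x \<bullet> e = xs \<bullet> e" | "x \<bullet> e < xs \<bullet> e" by linarith
  then show ?thesis
  proof cases
    case 3
    then have "reflect e (xs \<bullet> e) x \<bullet> e > xs \<bullet> e" using reflect_inner[OF e, of "xs \<bullet> e" x] by simp
    from right[OF this] show ?thesis by (simp add: reflect_reflect[OF e])
  qed (auto simp: right reflect_fixed)
qed

text \<open>Points equidistant from \<open>xs\<close> are mirror images in their perpendicular
  bisector, a hyperplane through \<open>xs\<close>.\<close>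

theorem radial:
  assumes "dist x xs = dist y xs"
  shows "\<phi> x = \<phi> y"
proof (cases "x = y")
  case False
  define e where "e = (x - y) /\<^sub>R norm (x - y)"
  have e: "norm e = 1" using False by (simp add: e_def)
  have n: "norm (x - y) > 0" using False by simp
  have "(x - xs) \<bullet> (x - xs) = (y - xs) \<bullet> (y - xs)"
    using assms by (simp add: dist_norm flip: power2_norm_eq_inner)
  then have "2 * ((x - xs) \<bullet> (x - y)) = (norm (x - y))\<^sup>2"
    unfolding power2_norm_eq_inner by (simp add: algebra_simps inner_commute)
  moreover have "(x - xs) \<bullet> e = ((x - xs) \<bullet> (x - y)) / norm (x - y)"
    by (simp add: e_def divide_inverse mult.commute)
  ultimately have "2 * ((x - xs) \<bullet> e) = (norm (x - y))\<^sup>2 / norm (x - y)" by simp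
  then have "2 * ((x - xs) \<bullet> e) = norm (x - y)"
    using n by (simp add: power2_eq_square)
  then have "reflect e (xs \<bullet> e) x = x - norm (x - y) *\<^sub>R e"
    by (simp add: reflect_def inner_diff_left)
  also have "\<dots> = y" using n by (simp add: e_def)
  finally show ?thesis using reflection_symmetric[OF e, of x] by simp
qed simp

end

section \<open>Level sets\<close>

text \<open>The level set is parametrized by \<open>s \<mapsto> z + s(y - z) + \<tau>(s)d\<close> with \<open>d\<close> normal to it; this curve is
  Lipschitz, and \<open>g - k A\<close> has zero derivative at each of its points.\<close>

lemma locally_constant_on_level:
  fixes A g :: "'a::euclidean_space \<Rightarrow> real"
  assumes U: "open U" "z \<in> U"
    and dA: "\<And>x. x \<in> U \<Longrightarrow> (A has_derivative (\<lambda>h. gA x \<bullet> h)) (at x)"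
    and cA: "continuous_on U gA" and nz: "gA z \<noteq> 0"
    and dg: "\<And>x. x \<in> U \<Longrightarrow> (g has_derivative (\<lambda>h. k x * (gA x \<bullet> h))) (at x)"
  shows "\<exists>\<delta>>0. \<forall>y\<in>ball z \<delta>. A y = A z \<longrightarrow> g y = g z"
proof -
  \<comment> \<open>On the ball chosen below \<open>gA\<close> deviates from \<open>gA z\<close> by
    less than \<open>m\<close>, half its length: along \<open>d\<close> the slope of
    \<open>A\<close> is at least \<open>m\<close>, and \<open>A\<close> is Lipschitz with constant
    \<open>3 * m\<close>.\<close>
  define m where "m = norm (gA z) / 2"
  have m: "m > 0" using nz by (simp add: m_def)
  define d where "d = gA z /\<^sub>R norm (gA z)"
  have d: "norm d = 1" "gA z \<bullet> d = 2 * m"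
    using nz by (auto simp: d_def m_def power2_eq_square simp flip: power2_norm_eq_inner)
  have "isCont gA z" using cA U continuous_on_eq_continuous_at by blast
  then have "\<forall>\<^sub>F x in nhds z. dist (gA x) (gA z) < m"
    using m tendsto_at_iff_tendsto_nhds[of gA z] by (simp add: isCont_def tendsto_iff)
  moreover have "\<forall>\<^sub>F x in nhds z. x \<in> U" using U by (simp add: eventually_nhds_in_open)
  ultimately have "\<forall>\<^sub>F x in nhds z. dist (gA x) (gA z) < m \<and> x \<in> U" by (rule eventually_conj)
  then obtain r where r: "r > 0" "\<And>x. x \<in> ball z r \<Longrightarrow> dist (gA x) (gA z) < m"
      "\<And>x. x \<in> ball z r \<Longrightarrow> x \<in> U"
    unfolding eventually_nhds_metric by (auto simp: dist_commute)
  have low: "gA x \<bullet> d \<ge> m" if "x \<in> ball z r" for x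
  proof -
    have "\<bar>(gA x - gA z) \<bullet> d\<bar> \<le> m"
      using Cauchy_Schwarz_ineq2[of "gA x - gA z" d] d r(2)[OF that] by (simp add: dist_norm)
    then show ?thesis using d by (simp add: inner_diff_left)
  qed
  have up: "norm (gA x) \<le> 3 * m" if "x \<in> ball z r" for x
    using norm_triangle_ineq2[of "gA x" "gA z"] r(2)[OF that] by (simp add: dist_norm m_def)
  have lip: "\<bar>A x - A y\<bar> \<le> 3 * m * norm (x - y)" if "x \<in> ball z r" "y \<in> ball z r" for x y
  proof -
    have "norm (A x - A y) \<le> 3 * m * norm (x - y)"
    proof (rule differentiable_bound[of "ball z r" A "\<lambda>x h. gA x \<bullet> h"])
      show "(A has_derivative (\<lambda>h. gA x \<bullet> h)) (at x within ball z r)" if "x \<in> ball z r" for x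
        using dA r(3)[OF that] has_derivative_at_withinI by blast
      show "onorm (\<lambda>h. gA x \<bullet> h) \<le> 3 * m" if "x \<in> ball z r" for x
      proof (rule onorm_le)
        fix h
        have "\<bar>gA x \<bullet> h\<bar> \<le> norm (gA x) * norm h" by (rule Cauchy_Schwarz_ineq2)
        also have "\<dots> \<le> 3 * m * norm h" using up[OF that] by (rule mult_right_mono) simp
        finally show "norm (gA x \<bullet> h) \<le> 3 * m * norm h" by simp
      qed
    qed (use that in auto)
    then show ?thesis by simp
  qed
  have mono0: "A (x + t *\<^sub>R d) - A x \<ge> m * t" if x: "x \<in> ball z r" "x + t *\<^sub>R d \<in> ball z r" "t \<ge> 0" for x t
  proof -
    have "A (x + t *\<^sub>R d) \<ge> A x + m * t"
      using ball_segment[OF x(1,2)] by (intro growth_along_line[OF x(3), of A gA] dA r(3) low)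
    then show ?thesis by simp
  qed
  have mono: "m * \<bar>t - t'\<bar> \<le> \<bar>A (x + t *\<^sub>R d) - A (x + t' *\<^sub>R d)\<bar>"
    if x: "x + t *\<^sub>R d \<in> ball z r" "x + t' *\<^sub>R d \<in> ball z r" for x t t'
  proof -
    have "m * (b - a) \<le> A (x + b *\<^sub>R d) - A (x + a *\<^sub>R d)"
      if "a \<le> b" "x + a *\<^sub>R d \<in> ball z r" "x + b *\<^sub>R d \<in> ball z r" for a b
      using mono0[of "x + a *\<^sub>R d" "b - a"] that by (simp add: algebra_simps)
    from this[of t t'] this[of t' t] show ?thesis
      using x m by (cases "t \<le> t'") (auto simp: abs_if)
  qed
  \<comment> \<open>Moving from \<open>z\<close> by at most \<delta> changes \<open>A\<close> by at
    most \<open>3 * m * \<delta>\<close>, which a shift of size at most \<open>4 * \<delta>\<close>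
    along \<open>d\<close> compensates; 16 leaves room for both displacements in the ball.\<close>
  define \<delta> where "\<delta> = r / 16"
  have \<delta>: "\<delta> > 0" "r = 16 * \<delta>" using r by (auto simp: \<delta>_def)
  show ?thesis
  proof (intro exI conjI ballI impI)
    show "\<delta> > 0" by fact
    fix y assume y: "y \<in> ball z \<delta>" "A y = A z"
    define v where "v = y - z"
    have v: "norm v < \<delta>" using y by (simp add: v_def dist_norm norm_minus_commute)
    define p where "p s = z + s *\<^sub>R v" for s
    have inb: "p s + t *\<^sub>R d \<in> ball z r" if "s \<in> {0..1}" "\<bar>t\<bar> \<le> 4 * \<delta>" for s t
    proof -
      have "norm (s *\<^sub>R v + t *\<^sub>R d) \<le> s * norm v + \<bar>t\<bar>"
        using norm_triangle_ineq[of "s *\<^sub>R v" "t *\<^sub>R d"] d that by simp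
      also have "s * norm v \<le> 1 * norm v" using that by (intro mult_right_mono) auto
      finally have "norm (s *\<^sub>R v + t *\<^sub>R d) < r" using that v \<delta> by simp
      moreover have "dist z (z + w) = norm w" for w by (simp add: dist_norm)
      ultimately show ?thesis unfolding p_def add.assoc mem_ball by simp
    qed
    have pin: "p s \<in> ball z r" if "s \<in> {0..1}" for s using inb[OF that, of 0] \<delta> by simp
    have "\<exists>t. \<bar>t\<bar> \<le> 4 * \<delta> \<and> A (p s + t *\<^sub>R d) = A z" if s: "s \<in> {0..1}" for s
    proof -
      have "norm (p s - z) \<le> 1 * norm v"
        using s by (simp add: p_def mult_left_le_one_le)
      then have "3 * m * norm (p s - z) \<le> 3 * m * \<delta>" using v m by (intro mult_left_mono) auto
      then have *: "\<bar>A (p s) - A z\<bar> \<le> 3 * m * \<delta>"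
        using lip[OF pin[OF s], of z] r(1) by simp
      have md: "m * \<delta> > 0" using m \<delta> by simp
      have "A (p s + (4 * \<delta>) *\<^sub>R d) - A (p s) \<ge> m * (4 * \<delta>)"
        using inb[OF s] pin[OF s] \<delta> by (intro mono0) auto
      moreover have "A (p s) - A (p s + (- 4 * \<delta>) *\<^sub>R d) \<ge> m * (4 * \<delta>)"
        using mono0[of "p s + (- 4 * \<delta>) *\<^sub>R d" "4 * \<delta>"] inb[OF s, of "- 4 * \<delta>"] pin[OF s] \<delta> by simp
      ultimately have "A (p s + (- 4 * \<delta>) *\<^sub>R d) \<le> A z" "A z \<le> A (p s + (4 * \<delta>) *\<^sub>R d)"
        using * md by linarith+
      moreover have "continuous_on {- 4 * \<delta>..4 * \<delta>} (\<lambda>t. A (p s + t *\<^sub>R d))"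
      proof (rule continuous_on_compose2[of "ball z r" A])
        show "continuous_on (ball z r) A"
          by (intro continuous_at_imp_continuous_on ballI has_derivative_continuous[OF dA[OF r(3)]])
      qed (use inb[OF s] in \<open>auto intro!: continuous_intros simp: abs_le_iff\<close>)
      moreover have "- 4 * \<delta> \<le> 4 * \<delta>" using \<delta>(1) by simp
      ultimately obtain t where "- 4 * \<delta> \<le> t" "t \<le> 4 * \<delta>" "A (p s + t *\<^sub>R d) = A z"
        using IVT'[of "\<lambda>t. A (p s + t *\<^sub>R d)" "- 4 * \<delta>" "A z" "4 * \<delta>"] by blast
      then show ?thesis by (intro exI[of _ t]) auto
    qed
    then obtain \<tau> where \<tau>: "\<And>s. s \<in> {0..1} \<Longrightarrow> \<bar>\<tau> s\<bar> \<le> 4 * \<delta>"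
      "\<And>s. s \<in> {0..1} \<Longrightarrow> A (p s + \<tau> s *\<^sub>R d) = A z" by metis
    define \<Gamma> where "\<Gamma> s = p s + \<tau> s *\<^sub>R d" for s
    \<comment> \<open>The summand 1 keeps \<open>L\<close> positive when
      \<open>y = z\<close>.\<close>
    define L where "L = 4 * norm v + 1"
    have L: "L > 0" by (simp add: L_def add_nonneg_pos)
    have \<Gamma>in: "\<Gamma> s \<in> ball z r" if "s \<in> {0..1}" for s using inb \<tau>(1) that by (simp add: \<Gamma>_def)
    have \<Gamma>L: "norm (\<Gamma> s' - \<Gamma> s) \<le> L * \<bar>s' - s\<bar>" if s: "s \<in> {0..1}" "s' \<in> {0..1}" for s s'
    proof -
      have i: "p s + \<tau> s *\<^sub>R d \<in> ball z r" "p s + \<tau> s' *\<^sub>R d \<in> ball z r" "p s' + \<tau> s' *\<^sub>R d \<in> ball z r"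
        using inb \<tau>(1) s by auto
      have n: "norm (p s' - p s) = \<bar>s' - s\<bar> * norm v"
        by (simp add: p_def flip: scaleR_diff_left)
      have "m * \<bar>\<tau> s - \<tau> s'\<bar> \<le> \<bar>A (p s + \<tau> s *\<^sub>R d) - A (p s + \<tau> s' *\<^sub>R d)\<bar>"
        by (rule mono[OF i(1,2)])
      also have "\<dots> = \<bar>A (p s' + \<tau> s' *\<^sub>R d) - A (p s + \<tau> s' *\<^sub>R d)\<bar>" using \<tau>(2) s by simp
      also have "\<dots> \<le> 3 * m * norm (p s' - p s)" using lip[OF i(3,2)] by simp
      finally have "m * \<bar>\<tau> s - \<tau> s'\<bar> \<le> m * (3 * norm (p s' - p s))" by simp
      then have t: "\<bar>\<tau> s' - \<tau> s\<bar> \<le> 3 * norm (p s' - p s)" using m by (simp add: abs_minus_commute)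
      have "\<Gamma> s' - \<Gamma> s = (p s' - p s) + (\<tau> s' - \<tau> s) *\<^sub>R d" by (simp add: \<Gamma>_def algebra_simps)
      then have "norm (\<Gamma> s' - \<Gamma> s) \<le> norm (p s' - p s) + \<bar>\<tau> s' - \<tau> s\<bar>"
        using norm_triangle_ineq[of "p s' - p s" "(\<tau> s' - \<tau> s) *\<^sub>R d"] d by simp
      also have "\<dots> \<le> 4 * (\<bar>s' - s\<bar> * norm v)" using t n by linarith
      also have "\<dots> \<le> L * \<bar>s' - s\<bar>" by (simp add: L_def algebra_simps)
      finally show ?thesis .
    qed
    have "\<exists>c. \<forall>s\<in>{0..1}. g (\<Gamma> s) = c"
    proof (rule has_derivative_zero_constant)
      fix s :: real assume s: "s \<in> {0..1}"
      \<comment> \<open>The factor \<open>k\<close> is frozen at the current point; since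
        \<open>A\<close> is constant along \<Gamma>, increments of \<open>g\<close> and of
        \<open>F\<close> along \<Gamma> agree.\<close>
      define F where "F x = g x - k (\<Gamma> s) * A x" for x
      have "(F has_derivative (\<lambda>h. k (\<Gamma> s) * (gA (\<Gamma> s) \<bullet> h) - k (\<Gamma> s) * (gA (\<Gamma> s) \<bullet> h))) (at (\<Gamma> s))"
        unfolding F_def by (intro derivative_intros dA dg r(3) \<Gamma>in s)
      then have F: "(F has_derivative (\<lambda>h. 0)) (at (\<Gamma> s))" by simp
      show "((\<lambda>s. g (\<Gamma> s)) has_derivative (\<lambda>h. 0)) (at s within {0..1})"
        unfolding has_derivative_within_alt
      proof (intro conjI allI impI bounded_linear_zero)
        fix \<epsilon> :: real assume \<epsilon>: "\<epsilon> > 0"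
        then obtain d1 where d1: "d1 > 0" "\<And>x. norm (x - \<Gamma> s) < d1 \<Longrightarrow>
            norm (F x - F (\<Gamma> s) - 0) \<le> (\<epsilon> / L) * norm (x - \<Gamma> s)"
          using F L unfolding has_derivative_within_alt by (metis UNIV_I divide_pos_pos)
        show "\<exists>d>0. \<forall>y\<in>{0..1}. norm (y - s) < d \<longrightarrow> norm (g (\<Gamma> y) - g (\<Gamma> s) - 0) \<le> \<epsilon> * norm (y - s)"
        proof (intro exI conjI ballI impI)
          show "d1 / L > 0" using d1 L by simp
          fix s' assume s': "s' \<in> {0..1}" "norm (s' - s) < d1 / L"
          have l: "norm (\<Gamma> s' - \<Gamma> s) \<le> L * \<bar>s' - s\<bar>" by (rule \<Gamma>L[OF s s'(1)])
          moreover have "L * \<bar>s' - s\<bar> < d1" using s'(2) L by (simp add: field_simps)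
          ultimately have "norm (F (\<Gamma> s') - F (\<Gamma> s)) \<le> (\<epsilon> / L) * norm (\<Gamma> s' - \<Gamma> s)" using d1(2) by force
          also have "\<dots> \<le> (\<epsilon> / L) * (L * \<bar>s' - s\<bar>)" using l \<epsilon> L by (intro mult_left_mono) auto
          also have "\<dots> = \<epsilon> * \<bar>s' - s\<bar>" using L by simp
          finally show "norm (g (\<Gamma> s') - g (\<Gamma> s) - 0) \<le> \<epsilon> * norm (s' - s)"
            using \<tau>(2) s s' by (simp add: F_def \<Gamma>_def)
        qed
      qed
    qed simp
    then have eq: "g (\<Gamma> 0) = g (\<Gamma> 1)" by auto
    \<comment> \<open>At both ends the level is already right, and strict monotonicity along
      \<open>d\<close> leaves no other shift.\<close>
    have "\<tau> 0 = 0"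
      using mono[of z "\<tau> 0" 0] inb[of 0 "\<tau> 0"] inb[of 0 0] \<tau>[of 0] m \<delta> by (simp add: p_def mult_le_0_iff)
    moreover have "\<tau> 1 = 0"
      using mono[of y "\<tau> 1" 0] inb[of 1 "\<tau> 1"] inb[of 1 0] \<tau>[of 1] m \<delta> y by (simp add: p_def v_def mult_le_0_iff)
    ultimately show "g y = g z" using eq by (simp add: \<Gamma>_def p_def v_def)
  qed
qed

section \<open>Connectedness of level sets\<close>

text \<open>The characterization \<open>simply_connected_iff_simple\<close> concerns the complex
  plane, so the domain is carried there by the linear isomorphism \<open>f\<close> and the
  complement back by its inverse \<open>g\<close>.\<close>

lemma connected_Compl_of_simply_connected:
  fixes \<Omega> :: "(real^2) set"
  assumes "open \<Omega>" "bounded \<Omega>" "simply_connected \<Omega>"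
  shows "connected (- \<Omega>)"
proof -
  define f :: "real^2 \<Rightarrow> complex" where "f x = Complex (x $ 1) (x $ 2)" for x
  define g :: "complex \<Rightarrow> real^2" where "g z = vector [Re z, Im z]" for z
  have fg: "f (g z) = z" for z by (simp add: f_def g_def)
  have gf: "g (f x) = x" for x by (simp add: f_def g_def vec_eq_iff forall_2)
  have f: "bounded_linear f" unfolding f_def
    by (intro linear_conv_bounded_linear[THEN iffD1] linearI) (simp_all add: complex_eq_iff)
  have g: "bounded_linear g" unfolding g_def
    by (intro linear_conv_bounded_linear[THEN iffD1] linearI) (simp_all add: vec_eq_iff forall_2)
  have fc: "continuous_on S f" for S using f linear_continuous_on by blast
  have gc: "continuous_on S g" for S using g linear_continuous_on by blast
  have img: "f ` S = g -` S" for S using fg gf by (auto simp: image_iff) (metis fg)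
  have "open (f ` \<Omega>)" unfolding img by (rule open_vimage[OF assms(1) gc])
  moreover have "bounded (f ` \<Omega>)" using assms(2) f by (rule bounded_linear_image)
  moreover have "simply_connected (f ` \<Omega>)"
  proof (rule homeomorphic_simply_connected[OF _ assms(3)])
    show "\<Omega> homeomorphic f ` \<Omega>"
      unfolding homeomorphic_def homeomorphism_def using fg gf fc gc
      by (intro exI[of _ f] exI[of _ g]) (auto simp: image_image)
  qed
  ultimately have "connected (- f ` \<Omega>)" using simply_connected_iff_simple by blast
  moreover have "- f ` \<Omega> = f ` (- \<Omega>)" unfolding img by auto
  ultimately have "connected (g ` f ` (- \<Omega>))" using gc connected_continuous_image by metis
  then show ?thesis by (simp add: image_image gf)
qed

text \<open>The sign is normalized so that \<open>xs\<close> is the maximum of \<open>A\<close>;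
  simple connectedness enters as connectedness of the complement.\<close>

locale level_sets =
  fixes \<Omega> :: "'a::euclidean_space set" and A :: "'a \<Rightarrow> real" and gA :: "'a \<Rightarrow> 'a" and xs :: 'a
  assumes open_\<Omega>: "open \<Omega>" and bounded_\<Omega>: "bounded \<Omega>" and xs: "xs \<in> \<Omega>"
    and compl: "connected (- \<Omega>)"
    and contA: "continuous_on (closure \<Omega>) A"
    and zeroA: "\<And>x. x \<in> frontier \<Omega> \<Longrightarrow> A x = 0"
    and gradA: "\<And>x. x \<in> \<Omega> - {xs} \<Longrightarrow> (A has_derivative (\<lambda>h. gA x \<bullet> h)) (at x)"
    and gradA_nz: "\<And>x. x \<in> \<Omega> - {xs} \<Longrightarrow> gA x \<noteq> 0"
    and gradA_cont: "continuous_on (\<Omega> - {xs}) gA"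
    and pos_xs: "A xs > 0"
begin

lemma frontier_eq: "frontier \<Omega> = closure \<Omega> - \<Omega>"
  by (simp add: frontier_def interior_open open_\<Omega>)

lemma \<Omega>_closure: "x \<in> \<Omega> \<Longrightarrow> x \<in> closure \<Omega>"
  using closure_subset by blast

lemma closure_cases: "x \<in> closure \<Omega> \<Longrightarrow> x \<in> \<Omega> \<or> x \<in> frontier \<Omega>"
  by (auto simp: frontier_eq)

lemma no_local_extremum:
  assumes "x \<in> V" "open V" "V \<subseteq> \<Omega>" "x \<noteq> xs"
  shows "(\<exists>y\<in>V. A y < A x) \<and> (\<exists>y\<in>V. A y > A x)"
proof (rule ccontr)
  assume "\<not> ?thesis"
  then have "(\<forall>y\<in>V. A y \<le> A x) \<or> (\<forall>y\<in>V. A x \<le> A y)" by force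
  moreover have "(A has_derivative (\<lambda>h. gA x \<bullet> h)) (at x)" using gradA assms by auto
  ultimately have "(\<lambda>h. gA x \<bullet> h) = (\<lambda>h. 0)"
    using differential_zero_maxmin[OF assms(1,2)] by blast
  then have "gA x \<bullet> gA x = 0" by meson
  then show False using gradA_nz assms by auto
qed

lemma A_pos: "x \<in> \<Omega> \<Longrightarrow> A x > 0"
proof -
  obtain m where m: "m \<in> closure \<Omega>" "\<And>y. y \<in> closure \<Omega> \<Longrightarrow> A m \<le> A y"
    using continuous_attains_inf[OF _ _ contA] bounded_\<Omega> xs \<Omega>_closure by (metis compact_closure empty_iff)
  have min: "A y > A m" if "y \<in> \<Omega>" "y \<noteq> xs" for y
    using no_local_extremum[OF that(1) open_\<Omega> order_refl that(2)] m(2) \<Omega>_closure by force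
  have "A m \<ge> 0"
  proof (rule ccontr)
    assume "\<not> A m \<ge> 0"
    then have "m \<in> \<Omega>" "m \<noteq> xs" using closure_cases[OF m(1)] zeroA pos_xs by auto
    then show False using min by force
  qed
  then show "A x > 0" if "x \<in> \<Omega>" using min[OF that] pos_xs by (cases "x = xs") auto
qed

lemma A_nonneg: "x \<in> closure \<Omega> \<Longrightarrow> A x \<ge> 0"
  using closure_cases A_pos zeroA by force

lemma A_less_max: assumes "x \<in> closure \<Omega>" "x \<noteq> xs" shows "A x < A xs"
proof -
  obtain m where m: "m \<in> closure \<Omega>" "\<And>y. y \<in> closure \<Omega> \<Longrightarrow> A y \<le> A m"
    using continuous_attains_sup[OF _ _ contA] bounded_\<Omega> xs \<Omega>_closure by (metis compact_closure empty_iff)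
  have max: "A y < A m" if "y \<in> \<Omega>" "y \<noteq> xs" for y
    using no_local_extremum[OF that(1) open_\<Omega> order_refl that(2)] m(2) \<Omega>_closure by force
  have "m \<in> \<Omega>" using closure_cases[OF m(1)] zeroA m(2)[OF \<Omega>_closure[OF xs]] pos_xs by force
  then have "m = xs" using max by force
  then show ?thesis using max[of x] closure_cases[OF assms(1)] zeroA pos_xs assms(2) by auto
qed

text \<open>The maximum of \<open>A\<close> over the closure of a component exceeds
  \<open>c\<close>, so it is not on the frontier of \<Omega> and belongs to the component itself.
  Hence it is \<open>xs\<close>, and all components contain \<open>xs\<close>.\<close>

lemma connected_superlevel:
  assumes c: "c > 0"
  shows "connected {x \<in> \<Omega>. A x > c}"
proof -
  let ?U = "{x \<in> \<Omega>. A x > c}"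
  have "?U = \<Omega> \<inter> A -` {c<..}" by auto
  then have op: "open ?U"
    using continuous_open_preimage[OF continuous_on_subset[OF contA closure_subset] open_\<Omega>] by simp
  have key: "connected_component ?U x xs" if x: "x \<in> ?U" for x
  proof -
    define V where "V = connected_component_set ?U x"
    have V: "open V" "x \<in> V" "V \<subseteq> ?U"
      using op x connected_component_refl_eq connected_component_subset
      by (auto simp: V_def open_connected_component)
    have cV: "closure V \<subseteq> closure \<Omega>" using V by (intro closure_mono) auto
    have "compact (closure V)"
      using V bounded_\<Omega> by (auto intro: bounded_subset)
    then obtain m where m: "m \<in> closure V" "\<And>y. y \<in> closure V \<Longrightarrow> A y \<le> A m"
      using continuous_attains_sup[of "closure V" A] continuous_on_subset[OF contA cV] V(2) closure_subset
      by (metis empty_iff subsetD)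
    have "A m > c" using m(2)[of x] V closure_subset[of V] by force
    then have "m \<in> \<Omega>" using closure_cases[of m] m(1) cV zeroA c by force
    then have mU: "m \<in> ?U" using \<open>A m > c\<close> by simp
    obtain r where r: "r > 0" "ball m r \<subseteq> ?U" using op mU openE by blast
    obtain y where y: "y \<in> V" "y \<in> ball m r"
      using m(1) r(1) closure_approachable by (metis dist_commute mem_ball)
    have "ball m r \<subseteq> connected_component_set ?U y"
      using y r by (intro connected_component_maximal) auto
    also have "\<dots> = V" using y connected_component_eq unfolding V_def by metis
    finally have mV: "m \<in> V" using r by auto
    have "m = xs"
    proof (rule ccontr)
      assume "m \<noteq> xs"
      then obtain y where "y \<in> V" "A y > A m" using no_local_extremum[OF mV V(1)] V(3) by blast
      then show False using m(2) closure_subset[of V] by force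
    qed
    then show ?thesis using mV by (simp add: V_def)
  qed
  show ?thesis unfolding connected_iff_connected_component
  proof (intro ballI)
    fix x y assume "x \<in> ?U" "y \<in> ?U"
    then show "connected_component ?U x y"
      using connected_component_trans[OF key connected_component_sym[OF key]] by blast
  qed
qed

text \<open>A component inside \<Omega> would be compact. From a point where \<open>A\<close> is
  minimal on it, a short step against the gradient lowers \<open>A\<close> and stays in the
  component. So every component reaches the complement of \<Omega>, which is connected.\<close>

lemma connected_compl_superlevel:
  assumes c: "c < A xs"
  shows "connected (- {x \<in> \<Omega>. A x > c})"
proof -
  let ?W = "- {x \<in> \<Omega>. A x > c}"
  have "{x \<in> \<Omega>. A x > c} = \<Omega> \<inter> A -` {c<..}" by auto
  then have "open {x \<in> \<Omega>. A x > c}"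
    using continuous_open_preimage[OF continuous_on_subset[OF contA closure_subset] open_\<Omega>] by simp
  then have cl: "closed ?W" by (rule closed_Compl)
  have key: "\<exists>w\<in>- \<Omega>. connected_component ?W x w" if x: "x \<in> ?W" for x
  proof (rule ccontr)
    assume no: "\<not> ?thesis"
    define C where "C = connected_component_set ?W x"
    have C: "x \<in> C" "closed C" "C \<subseteq> \<Omega>" "C \<subseteq> ?W" "connected C"
      using x no cl connected_component_refl_eq[of ?W x] connected_component_subset[of ?W x]
      by (auto simp: C_def closed_connected_component)
    have "compact C" using C bounded_\<Omega> bounded_subset compact_eq_bounded_closed by blast
    then obtain m where m: "m \<in> C" "\<And>y. y \<in> C \<Longrightarrow> A m \<le> A y"
      using continuous_attains_inf[of C A] continuous_on_subset[OF contA] C \<Omega>_closure by blast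
    have Am: "A m \<le> c" and m\<Omega>: "m \<in> \<Omega>" using m C by auto
    then have mx: "m \<noteq> xs" using c by auto
    have dA: "((\<lambda>x. A x) has_derivative (\<lambda>h. gA m \<bullet> h)) (at m)" using gradA m\<Omega> mx by auto
    have "((\<lambda>t. A (m + t *\<^sub>R (- gA m))) has_real_derivative gA m \<bullet> (- gA m)) (at 0)"
      by (rule line_derivative[where S = UNIV and D = "\<lambda>h. gA m \<bullet> h"]) (use dA in auto)
    moreover have "gA m \<bullet> (- gA m) < 0" using gradA_nz m\<Omega> mx by simp
    ultimately have "\<exists>d1>0. \<forall>t>0. t < d1 \<longrightarrow> A (m + (0 + t) *\<^sub>R (- gA m)) < A (m + 0 *\<^sub>R (- gA m))"
      by (rule DERIV_neg_dec_right)
    then obtain d1 where d1: "d1 > 0" "\<And>t. 0 < t \<Longrightarrow> t < d1 \<Longrightarrow> A (m + t *\<^sub>R (- gA m)) < A m"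
      unfolding scaleR_zero_left add_0_left add_0_right by blast
    \<comment> \<open>A segment instead of a ball: the component need not contain a neighbourhood of
      \<open>m\<close>.\<close>
    define S where "S = (\<lambda>t. m + t *\<^sub>R (- gA m)) ` {0..d1/2}"
    have "connected S" unfolding S_def by (intro connected_continuous_image continuous_intros) auto
    moreover have "m \<in> S" using d1 by (force simp: S_def)
    moreover have "S \<subseteq> ?W"
    proof
      fix y assume "y \<in> S"
      then obtain t where t: "0 \<le> t" "t \<le> d1/2" "y = m + t *\<^sub>R (- gA m)" by (auto simp: S_def)
      then have "A y \<le> A m" using d1 by (cases "t = 0") (auto intro: less_imp_le)
      then show "y \<in> ?W" using Am by auto
    qed
    ultimately have "S \<subseteq> connected_component_set ?W m" by (intro connected_component_maximal)
    also have "\<dots> = C" using m(1) connected_component_eq unfolding C_def by metis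
    finally have "S \<subseteq> C" .
    moreover have "m + (d1/2) *\<^sub>R (- gA m) \<in> S" unfolding S_def by (rule imageI) (use d1 in auto)
    ultimately have "m + (d1/2) *\<^sub>R (- gA m) \<in> C" by blast
    then show False using m(2) d1(2)[of "d1/2"] d1(1) by force
  qed
  have sub: "connected_component ?W w w'" if "w \<in> - \<Omega>" "w' \<in> - \<Omega>" for w w'
  proof -
    have "- \<Omega> \<subseteq> connected_component_set ?W w"
      by (rule connected_component_maximal[OF that(1) compl]) auto
    then show ?thesis using that(2) by auto
  qed
  show ?thesis unfolding connected_iff_connected_component
  proof (intro ballI)
    fix x y assume "x \<in> ?W" "y \<in> ?W"
    then obtain w w' where "w \<in> - \<Omega>" "connected_component ?W x w" "w' \<in> - \<Omega>" "connected_component ?W y w'"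
      using key by blast
    then show "connected_component ?W x y"
      using sub[of w w'] connected_component_sym connected_component_trans by meson
  qed
qed

text \<open>A connected set with connected complement has connected frontier. That of the superlevel
  set is the full level set because no point of \<Omega> other than \<open>xs\<close> is a local
  maximum of \<open>A\<close>.\<close>

lemma connected_level:
  assumes c: "0 < c" "c < A xs"
  shows "connected {x \<in> \<Omega>. A x = c}"
proof -
  let ?U = "{x \<in> \<Omega>. A x > c}"
  have "?U = \<Omega> \<inter> A -` {c<..}" by auto
  then have op: "open ?U"
    using continuous_open_preimage[OF continuous_on_subset[OF contA closure_subset] open_\<Omega>] by simp
  have "frontier ?U = {x \<in> \<Omega>. A x = c}"
  proof (intro equalityI subsetI)
    fix y assume "y \<in> frontier ?U"
    then have y: "y \<in> closure ?U" "y \<notin> ?U" using op by (auto simp: frontier_def interior_open)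
    have "?U \<subseteq> {x \<in> closure \<Omega>. A x \<ge> c}" using \<Omega>_closure by auto
    moreover have "closed {x \<in> closure \<Omega>. A x \<ge> c}"
      using continuous_closed_preimage[OF contA closed_closure, of "{c..}"] by (simp add: vimage_def Int_def)
    ultimately have "closure ?U \<subseteq> {x \<in> closure \<Omega>. A x \<ge> c}" by (rule closure_minimal)
    then have "y \<in> closure \<Omega>" "A y \<ge> c" using y by auto
    then show "y \<in> {x \<in> \<Omega>. A x = c}" using closure_cases[of y] zeroA c y(2) by auto
  next
    fix y assume y: "y \<in> {x \<in> \<Omega>. A x = c}"
    have "y \<in> closure ?U" unfolding closure_approachable
    proof (intro allI impI)
      fix \<epsilon> :: real assume "\<epsilon> > 0"
      then have "\<exists>y'\<in>ball y \<epsilon> \<inter> \<Omega>. A y' > A y"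
        using no_local_extremum[of y "ball y \<epsilon> \<inter> \<Omega>"] y open_\<Omega> c by auto
      then show "\<exists>y'\<in>?U. dist y' y < \<epsilon>" using y by (auto simp: dist_commute)
    qed
    then show "y \<in> frontier ?U" using y op by (auto simp: frontier_def interior_open)
  qed
  then show ?thesis
    using connected_frontier_simple[OF connected_superlevel[OF c(1)] connected_compl_superlevel[OF c(2)]] by simp
qed

section \<open>Functions whose gradient is parallel to that of \<open>A\<close>\<close>

text \<open>Local constancy on a connected level gives constancy; the top level consists of
  \<open>xs\<close> alone.\<close>

lemma constant_on_level:
  assumes dg: "\<And>x. x \<in> \<Omega> - {xs} \<Longrightarrow> (g has_derivative (\<lambda>h. k x * (gA x \<bullet> h))) (at x)"
    and xy: "x \<in> \<Omega>" "y \<in> \<Omega>" "A x = A y"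
  shows "g x = g y"
proof (cases "x = xs \<or> y = xs")
  case True
  then show ?thesis using A_less_max[of x] A_less_max[of y] xy \<Omega>_closure by force
next
  case False
  define c where "c = A x"
  have c: "0 < c" "c < A xs" using A_pos[OF xy(1)] A_less_max[of x] \<Omega>_closure xy False by (auto simp: c_def)
  let ?L = "{x \<in> \<Omega>. A x = c}"
  show ?thesis
  proof (rule connected_local_const[OF connected_level[OF c]])
    show "x \<in> ?L" "y \<in> ?L" using xy by (auto simp: c_def)
    show "\<forall>z\<in>?L. \<forall>\<^sub>F y in at z within ?L. g z = g y"
    proof
      fix z assume z: "z \<in> ?L"
      then have "z \<in> \<Omega> - {xs}" using c by auto
      then have "\<exists>\<delta>>0. \<forall>y\<in>ball z \<delta>. A y = A z \<longrightarrow> g y = g z"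
        using open_\<Omega> by (intro locally_constant_on_level[OF _ _ gradA gradA_cont gradA_nz dg]) auto
      then obtain \<delta> where \<delta>: "\<delta> > 0" "\<And>y. y \<in> ball z \<delta> \<Longrightarrow> A y = A z \<Longrightarrow> g y = g z" by blast
      show "\<forall>\<^sub>F y in at z within ?L. g z = g y"
        unfolding eventually_at
      proof (intro exI conjI ballI impI)
        fix y assume "y \<in> ?L" "y \<noteq> z \<and> dist y z < \<delta>"
        then show "g z = g y" using \<delta>(2)[of y] z by (simp add: dist_commute)
      qed (rule \<delta>(1))
    qed
  qed
qed

text \<open>The intermediate value theorem on the gradient line through \<open>x\<close> takes the
  place of an implicit function: difference quotients of \<open>A\<close> at \<open>x\<close> exceed
  some \<open>m > 0\<close>, so a nearby value \<open>b\<close> is attained at a distance of order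
  \<open>\<bar>b - A x\<bar>\<close>.\<close>

lemma transversal:
  assumes x: "x \<in> \<Omega>" "x \<noteq> xs"
  shows "\<exists>\<delta>>0. \<exists>C. \<forall>b. \<bar>b - A x\<bar> < \<delta> \<longrightarrow> (\<exists>P\<in>\<Omega>. A P = b \<and> norm (P - x) \<le> C * \<bar>b - A x\<bar>)"
proof -
  define d where "d = gA x"
  have dA: "(A has_derivative (\<lambda>h. gA x \<bullet> h)) (at x)" using gradA x by auto
  have dd: "gA x \<bullet> d > 0" using gradA_nz x by (simp add: d_def)
  define m where "m = gA x \<bullet> d / 2"
  have m: "m > 0" using dd by (simp add: m_def)
  have "((\<lambda>t. A (x + t *\<^sub>R d)) has_real_derivative gA x \<bullet> d) (at 0)"
    by (rule line_derivative[where S = UNIV and D = "\<lambda>h. gA x \<bullet> h"]) (use dA in auto)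
  then have "((\<lambda>t. (A (x + t *\<^sub>R d) - A x) / t) \<longlongrightarrow> gA x \<bullet> d) (at 0)"
    by (simp add: has_field_derivative_iff)
  then have "\<forall>\<^sub>F t in at 0. (A (x + t *\<^sub>R d) - A x) / t > m"
    by (rule order_tendstoD) (use dd in \<open>simp add: m_def\<close>)
  then obtain b1 where b1: "b1 > 0" "\<And>t. t \<noteq> 0 \<Longrightarrow> \<bar>t\<bar> < b1 \<Longrightarrow> (A (x + t *\<^sub>R d) - A x) / t > m"
    unfolding eventually_at by (auto simp: dist_real_def)
  obtain r where r: "r > 0" "ball x r \<subseteq> \<Omega>" using x open_\<Omega> openE by blast
  have nd: "norm d + 1 > 0" by (simp add: add_nonneg_pos)
  define r' where "r' = r / (norm d + 1)"
  have r': "r' > 0" using r nd by (simp add: r'_def)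
  define b where "b = min b1 r' / 2"
  have b: "b > 0" "b < b1" "b < r'" using b1 r' by (auto simp: b_def)
  have seg: "x + t *\<^sub>R d \<in> \<Omega>" if "\<bar>t\<bar> \<le> b" for t
  proof -
    have "b * (norm d + 1) < r" using nd b(3) by (simp add: r'_def pos_less_divide_eq)
    moreover have "\<bar>t\<bar> * norm d \<le> b * (norm d + 1)" using that b by (intro mult_mono) auto
    ultimately have "norm (t *\<^sub>R d) < r" by simp
    then show ?thesis using r(2) by (auto simp: dist_norm)
  qed
  have up: "A (x + t *\<^sub>R d) - A x \<ge> m * t" if "0 \<le> t" "t \<le> b" for t
    using b1(2)[of t] that b by (cases "t = 0") (auto simp: pos_less_divide_eq)
  have dn: "A (x + t *\<^sub>R d) - A x \<le> m * t" if "- b \<le> t" "t \<le> 0" for t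
    using b1(2)[of t] that b by (cases "t = 0") (auto simp: neg_less_divide_eq)
  have ct: "continuous_on {- b..b} (\<lambda>t. A (x + t *\<^sub>R d))"
    by (rule continuous_on_compose2[OF contA]) (auto intro!: continuous_intros \<Omega>_closure seg)
  show ?thesis
  proof (intro exI conjI allI impI)
    show "m * b > 0" using m b by simp
    fix v assume v: "\<bar>v - A x\<bar> < m * b"
    have "A (x + (- b) *\<^sub>R d) \<le> v" "v \<le> A (x + b *\<^sub>R d)" using up[of b] dn[of "- b"] v b by auto
    then obtain t where t: "- b \<le> t" "t \<le> b" "A (x + t *\<^sub>R d) = v"
      using IVT'[of "\<lambda>t. A (x + t *\<^sub>R d)" "- b" v b] ct b by auto
    have "m * \<bar>t\<bar> \<le> \<bar>v - A x\<bar>"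
      using up[of t] dn[of t] t m by (cases "t \<ge> 0") (auto simp: abs_if)
    then have "\<bar>t\<bar> \<le> \<bar>v - A x\<bar> / m" using m by (simp add: pos_le_divide_eq mult.commute)
    then have "\<bar>t\<bar> * norm d \<le> (\<bar>v - A x\<bar> / m) * norm d" by (rule mult_right_mono) simp
    then show "\<exists>P\<in>\<Omega>. A P = v \<and> norm (P - x) \<le> (norm d / m) * \<bar>v - A x\<bar>"
      using seg[of t] t by (intro bexI[of _ "x + t *\<^sub>R d"]) (auto simp: abs_le_iff mult.commute)
  qed
qed

text \<open>As \<open>g\<close> is constant on levels, \<open>k\<close> is its derivative with
  respect to \<open>A\<close>. The increments of \<open>g\<close> from \<open>x\<close> and from
  \<open>y\<close> to a common nearby level, taken at points supplied by \<open>transversal\<close>,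
  must agree.\<close>

lemma gradient_factor_constant_on_level:
  assumes dg: "\<And>x. x \<in> \<Omega> - {xs} \<Longrightarrow> (g has_derivative (\<lambda>h. k x * (gA x \<bullet> h))) (at x)"
    and xy: "x \<in> \<Omega> - {xs}" "y \<in> \<Omega> - {xs}" "A x = A y"
  shows "k x = k y"
proof (rule ccontr)
  assume ne: "k x \<noteq> k y"
  have near: "\<exists>\<delta>>0. \<exists>C>0. \<forall>b. \<bar>b - A x\<bar> < \<delta> \<longrightarrow> (\<exists>P\<in>\<Omega>. A P = b \<and> norm (P - x) \<le> C * \<bar>b - A x\<bar>)"
    if "x \<in> \<Omega> - {xs}" for x
  proof -
    obtain \<delta> C where *: "\<delta> > 0" "\<And>b. \<bar>b - A x\<bar> < \<delta> \<Longrightarrow> \<exists>P\<in>\<Omega>. A P = b \<and> norm (P - x) \<le> C * \<bar>b - A x\<bar>"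
      using transversal[of x] \<open>x \<in> \<Omega> - {xs}\<close> by blast
    have le: "C * \<bar>t\<bar> \<le> (\<bar>C\<bar> + 1) * \<bar>t\<bar>" for t :: real by (intro mult_right_mono) auto
    show ?thesis
    proof (intro exI conjI allI impI)
      show "\<delta> > 0" "\<bar>C\<bar> + 1 > 0" using * by auto
      fix b assume "\<bar>b - A x\<bar> < \<delta>"
      then obtain P where "P \<in> \<Omega>" "A P = b" "norm (P - x) \<le> C * \<bar>b - A x\<bar>" using *(2) by blast
      then show "\<exists>P\<in>\<Omega>. A P = b \<and> norm (P - x) \<le> (\<bar>C\<bar> + 1) * \<bar>b - A x\<bar>"
        using order_trans[OF _ le] by blast
    qed
  qed
  have est: "\<forall>\<epsilon>>0. \<exists>\<delta>>0. \<forall>b. \<bar>b - A x\<bar> < \<delta> \<longrightarrow>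
      (\<exists>P\<in>\<Omega>. A P = b \<and> \<bar>g P - g x - k x * (b - A x)\<bar> \<le> \<epsilon> * \<bar>b - A x\<bar>)"
    if x: "x \<in> \<Omega> - {xs}" for x
  proof (intro allI impI)
    fix \<epsilon> :: real assume \<epsilon>: "\<epsilon> > 0"
    obtain \<delta> C where C: "\<delta> > 0" "C > 0" "\<And>b. \<bar>b - A x\<bar> < \<delta> \<Longrightarrow> \<exists>P\<in>\<Omega>. A P = b \<and> norm (P - x) \<le> C * \<bar>b - A x\<bar>"
      using near[OF x] by blast
    define F where "F p = g p - k x * A p" for p
    have "(F has_derivative (\<lambda>h. k x * (gA x \<bullet> h) - k x * (gA x \<bullet> h))) (at x)"
      unfolding F_def by (intro derivative_intros gradA dg x)
    then have "(F has_derivative (\<lambda>h. 0)) (at x)" by simp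
    then obtain d1 where d1: "d1 > 0" "\<And>p. norm (p - x) < d1 \<Longrightarrow> norm (F p - F x - 0) \<le> (\<epsilon> / C) * norm (p - x)"
      using \<epsilon> C unfolding has_derivative_within_alt by (metis UNIV_I divide_pos_pos)
    show "\<exists>\<delta>>0. \<forall>b. \<bar>b - A x\<bar> < \<delta> \<longrightarrow>
      (\<exists>P\<in>\<Omega>. A P = b \<and> \<bar>g P - g x - k x * (b - A x)\<bar> \<le> \<epsilon> * \<bar>b - A x\<bar>)"
    proof (intro exI conjI allI impI)
      show "min \<delta> (d1 / C) > 0" using C d1 by simp
      fix b assume b: "\<bar>b - A x\<bar> < min \<delta> (d1 / C)"
      then obtain P where P: "P \<in> \<Omega>" "A P = b" "norm (P - x) \<le> C * \<bar>b - A x\<bar>" using C(3)[of b] by auto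
      have "C * \<bar>b - A x\<bar> < d1" using b C by (simp add: field_simps)
      then have "norm (F P - F x) \<le> (\<epsilon> / C) * norm (P - x)" using d1(2)[of P] P by simp
      also have "\<dots> \<le> (\<epsilon> / C) * (C * \<bar>b - A x\<bar>)" using P \<epsilon> C by (intro mult_left_mono) auto
      also have "\<dots> = \<epsilon> * \<bar>b - A x\<bar>" using C by simp
      finally show "\<exists>P\<in>\<Omega>. A P = b \<and> \<bar>g P - g x - k x * (b - A x)\<bar> \<le> \<epsilon> * \<bar>b - A x\<bar>"
        using P by (intro bexI[of _ P]) (auto simp: F_def algebra_simps)
    qed
  qed
  \<comment> \<open>Two errors of \<epsilon> per unit increment leave \<open>2 * \<epsilon>\<close>,
    less than the assumed difference \<open>3 * \<epsilon>\<close>.\<close>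
  define \<epsilon> where "\<epsilon> = \<bar>k x - k y\<bar> / 3"
  have \<epsilon>: "\<epsilon> > 0" using ne by (simp add: \<epsilon>_def)
  obtain \<delta>1 where \<delta>1: "\<delta>1 > 0" "\<And>b. \<bar>b - A x\<bar> < \<delta>1 \<Longrightarrow> \<exists>P\<in>\<Omega>. A P = b \<and> \<bar>g P - g x - k x * (b - A x)\<bar> \<le> \<epsilon> * \<bar>b - A x\<bar>"
    using est[OF xy(1), rule_format, OF \<epsilon>] by blast
  obtain \<delta>2 where \<delta>2: "\<delta>2 > 0" "\<And>b. \<bar>b - A y\<bar> < \<delta>2 \<Longrightarrow> \<exists>P\<in>\<Omega>. A P = b \<and> \<bar>g P - g y - k y * (b - A y)\<bar> \<le> \<epsilon> * \<bar>b - A y\<bar>"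
    using est[OF xy(2), rule_format, OF \<epsilon>] by blast
  define t where "t = min \<delta>1 \<delta>2 / 2"
  have t: "0 < t" "t < \<delta>1" "t < \<delta>2" using \<delta>1 \<delta>2 by (auto simp: t_def)
  obtain P where P: "P \<in> \<Omega>" "A P = A x + t" "\<bar>g P - g x - k x * t\<bar> \<le> \<epsilon> * t"
    using \<delta>1(2)[of "A x + t"] t by auto
  obtain Q where Q: "Q \<in> \<Omega>" "A Q = A y + t" "\<bar>g Q - g y - k y * t\<bar> \<le> \<epsilon> * t"
    using \<delta>2(2)[of "A y + t"] t by auto
  have "g P = g Q" using constant_on_level[OF dg P(1) Q(1)] P Q xy by simp
  moreover have "g x = g y" using constant_on_level[OF dg _ _ xy(3)] xy by simp
  ultimately have "\<bar>(k x - k y) * t\<bar> \<le> 2 * (\<epsilon> * t)" using P(3) Q(3) by (simp add: algebra_simps)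
  then have "\<bar>k x - k y\<bar> * t \<le> (2 * \<epsilon>) * t" using t by (simp add: abs_mult)
  then have "\<bar>k x - k y\<bar> \<le> 2 * \<epsilon>" using t by simp
  then show False using \<epsilon> by (simp add: \<epsilon>_def)
qed

text \<open>The frontier is a limit of levels: on two rays entering \<Omega> from \<open>x\<close>
  and \<open>y\<close> there are points of equal level arbitrarily near the ends, where
  \<open>g\<close> agrees; continuity up to the boundary does the rest.\<close>

lemma constant_on_frontier:
  assumes dg: "\<And>x. x \<in> \<Omega> - {xs} \<Longrightarrow> (g has_derivative (\<lambda>h. k x * (gA x \<bullet> h))) (at x)"
    and cg: "continuous_on (closure \<Omega> - {xs}) g"
    and ray: "\<And>z. z \<in> frontier \<Omega> \<Longrightarrow> \<exists>d. \<forall>\<^sub>F t in at_right 0. z + t *\<^sub>R d \<in> \<Omega>"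
    and xy: "x \<in> frontier \<Omega>" "y \<in> frontier \<Omega>"
  shows "g x = g y"
proof -
  have fin: "z \<in> closure \<Omega> - {xs}" "z \<in> closure \<Omega>" if "z \<in> frontier \<Omega>" for z using that xs by (auto simp: frontier_eq)
  have key: "\<exists>d b. b > 0 \<and> (\<forall>t. 0 < t \<longrightarrow> t < b \<longrightarrow> z + t *\<^sub>R d \<in> \<Omega>)"
    if "z \<in> frontier \<Omega>" for z using ray[OF that] unfolding eventually_at_right_field by blast
  obtain d1 b1 where 1: "b1 > 0" "\<And>t. 0 < t \<Longrightarrow> t < b1 \<Longrightarrow> x + t *\<^sub>R d1 \<in> \<Omega>" using key[OF xy(1)] by blast
  obtain d2 b2 where 2: "b2 > 0" "\<And>t. 0 < t \<Longrightarrow> t < b2 \<Longrightarrow> y + t *\<^sub>R d2 \<in> \<Omega>" using key[OF xy(2)] by blast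
  have ivt: "\<exists>t. 0 < t \<and> t \<le> s \<and> A (z + t *\<^sub>R d) = c"
    if z: "z \<in> frontier \<Omega>" and s: "0 < s" "s < b" and seg: "\<And>t. 0 < t \<Longrightarrow> t < b \<Longrightarrow> z + t *\<^sub>R d \<in> \<Omega>"
      and c: "0 < c" "c \<le> A (z + s *\<^sub>R d)" for z d b s c
  proof -
    have "continuous_on {0..s} (\<lambda>t. A (z + t *\<^sub>R d))"
    proof (rule continuous_on_compose2[OF contA])
      show "(\<lambda>t. z + t *\<^sub>R d) ` {0..s} \<subseteq> closure \<Omega>"
      proof safe
        fix t assume "t \<in> {0..s}"
        then show "z + t *\<^sub>R d \<in> closure \<Omega>"
          using seg[of t] s fin[OF z] \<Omega>_closure by (cases "t = 0") auto
      qed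
    qed (intro continuous_intros)
    then obtain t where t: "0 \<le> t" "t \<le> s" "A (z + t *\<^sub>R d) = c"
      using IVT'[of "\<lambda>t. A (z + t *\<^sub>R d)" 0 c s] zeroA[OF z] c s by auto
    then have "t \<noteq> 0" using zeroA[OF z] c by auto
    then show ?thesis using t by (intro exI[of _ t]) auto
  qed
  define b where "b = min b1 b2"
  have b: "b > 0" "b \<le> b1" "b \<le> b2" using 1 2 by (auto simp: b_def)
  \<comment> \<open>Starting the denominators at 2 keeps \<open>s n\<close> strictly below
    \<open>b\<close> from the first index on.\<close>
  define s where "s n = b / (2 + real n)" for n
  have s: "0 < s n" "s n < b" for n
    using divide_strict_left_mono[of 1 "2 + real n" b] b by (auto simp: s_def)
  have "\<exists>t t'. 0 < t \<and> t \<le> s n \<and> 0 < t' \<and> t' \<le> s n \<and> A (x + t *\<^sub>R d1) = A (y + t' *\<^sub>R d2)" for n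
  proof -
    \<comment> \<open>The lower of the two end values is attained on both rays, since
      \<open>A\<close> starts from 0 on each.\<close>
    define c where "c = min (A (x + s n *\<^sub>R d1)) (A (y + s n *\<^sub>R d2))"
    have c: "0 < c" "c \<le> A (x + s n *\<^sub>R d1)" "c \<le> A (y + s n *\<^sub>R d2)"
      using A_pos[OF 1(2)[of "s n"]] A_pos[OF 2(2)[of "s n"]] s[of n] b by (auto simp: c_def)
    have "\<exists>t. 0 < t \<and> t \<le> s n \<and> A (x + t *\<^sub>R d1) = c"
      using ivt[OF xy(1) s(1)[of n] _ 1(2) c(1,2)] s(2)[of n] b by auto
    moreover have "\<exists>t. 0 < t \<and> t \<le> s n \<and> A (y + t *\<^sub>R d2) = c"
      using ivt[OF xy(2) s(1)[of n] _ 2(2) c(1,3)] s(2)[of n] b by auto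
    ultimately show ?thesis by metis
  qed
  then obtain t t' where t: "\<And>n. 0 < t n" "\<And>n. t n \<le> s n" and t': "\<And>n. 0 < t' n" "\<And>n. t' n \<le> s n"
    and eq: "\<And>n. A (x + t n *\<^sub>R d1) = A (y + t' n *\<^sub>R d2)" by metis
  have in1: "x + t n *\<^sub>R d1 \<in> \<Omega>" "y + t' n *\<^sub>R d2 \<in> \<Omega>" for n
    using 1(2)[of "t n"] 2(2)[of "t' n"] t[of n] t'[of n] s[of n] b by auto
  have geq: "g (x + t n *\<^sub>R d1) = g (y + t' n *\<^sub>R d2)" for n
    by (rule constant_on_level[OF dg in1 eq])
  have "s \<longlonglongrightarrow> 0" unfolding s_def
    by (intro real_tendsto_divide_at_top[OF tendsto_const]
        filterlim_tendsto_add_at_top[OF tendsto_const] filterlim_real_sequentially)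
  note s0 = tendsto_sandwich[OF _ _ tendsto_const this]
  have t0: "t \<longlonglongrightarrow> 0" by (rule s0) (simp_all add: t(2) less_imp_le[OF t(1)])
  have t0': "t' \<longlonglongrightarrow> 0" by (rule s0) (simp_all add: t'(2) less_imp_le[OF t'(1)])
  have lim: "(\<lambda>n. g (z + \<tau> n *\<^sub>R d)) \<longlonglongrightarrow> g z"
    if z: "z \<in> frontier \<Omega>" and \<tau>: "\<tau> \<longlonglongrightarrow> 0" and i: "\<And>n. z + \<tau> n *\<^sub>R d \<in> \<Omega>" for z \<tau> d
  proof -
    have "(\<lambda>n. z + \<tau> n *\<^sub>R d) \<longlonglongrightarrow> z + 0 *\<^sub>R d" by (intro tendsto_intros \<tau>)
    then have l: "(\<lambda>n. z + \<tau> n *\<^sub>R d) \<longlonglongrightarrow> z" by simp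
    have "\<forall>\<^sub>F n in sequentially. z + \<tau> n *\<^sub>R d \<in> - {xs}"
      by (rule topological_tendstoD[OF l]) (use fin[OF z] in auto)
    then have "\<forall>\<^sub>F n in sequentially. z + \<tau> n *\<^sub>R d \<in> closure \<Omega> - {xs}"
      by eventually_elim (use i \<Omega>_closure in auto)
    then show ?thesis using continuous_on_tendsto_compose[OF cg l fin(1)[OF z]] by blast
  qed
  have "(\<lambda>n. g (x + t n *\<^sub>R d1)) \<longlonglongrightarrow> g x" "(\<lambda>n. g (x + t n *\<^sub>R d1)) \<longlonglongrightarrow> g y"
    using lim[OF xy(1) t0 in1(1)] lim[OF xy(2) t0' in1(2)] by (simp_all add: geq)
  then show ?thesis using LIMSEQ_unique by blast
qed

end

section \<open>Functions of class \<open>C\<^sup>k\<close> and domains with \<open>C\<^sup>1\<close> boundary\<close>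

lemma Ck_on_imp_continuous_on: "Ck_on k S f \<Longrightarrow> continuous_on S f"
  by (cases k) (auto simp: continuous_on_eq_continuous_within intro: has_derivative_continuous)

lemma Ck_on_subset: "Ck_on k S f \<Longrightarrow> T \<subseteq> S \<Longrightarrow> Ck_on k T f"
proof (induction k arbitrary: f)
  case (Suc k)
  then obtain g where "\<forall>x\<in>S. (f has_derivative (\<lambda>h. \<Sum>i\<in>Basis. (h \<bullet> i) *\<^sub>R g i x)) (at x within S)"
    "\<forall>i\<in>Basis. Ck_on k S (g i)" by auto
  then show ?case using Suc has_derivative_subset by (auto intro!: exI[of _ g]) blast
qed (auto intro: continuous_on_subset)

lemma Ck_on_SucD: "Ck_on (Suc k) S f \<Longrightarrow> Ck_on k S f"
proof (induction k arbitrary: f)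
  case 0
  then show ?case using Ck_on_imp_continuous_on[OF 0] by simp
next
  case (Suc k)
  then obtain g where "\<forall>x\<in>S. (f has_derivative (\<lambda>h. \<Sum>i\<in>Basis. (h \<bullet> i) *\<^sub>R g i x)) (at x within S)"
    "\<forall>i\<in>Basis. Ck_on (Suc k) S (g i)" by (subst (asm) Ck_on.simps(2)) blast
  then show ?case using Suc.IH unfolding Ck_on.simps(2)[of k] by blast
qed

lemma Ck_on_le: "Ck_on k S f \<Longrightarrow> j \<le> k \<Longrightarrow> Ck_on j S f"
  by (induction k) (auto simp: le_Suc_eq dest: Ck_on_SucD simp del: Ck_on.simps)

lemma Ck_on_bounded_linear:
  assumes L: "bounded_linear L"
  shows "Ck_on k S f \<Longrightarrow> Ck_on k S (\<lambda>x. L (f x))"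
proof (induction k arbitrary: f)
  case 0
  then show ?case using bounded_linear.continuous_on[OF L] by simp
next
  case (Suc k)
  then obtain g where g: "\<And>x. x \<in> S \<Longrightarrow> (f has_derivative (\<lambda>h. \<Sum>i\<in>Basis. (h \<bullet> i) *\<^sub>R g i x)) (at x within S)"
    "\<And>i. i \<in> Basis \<Longrightarrow> Ck_on k S (g i)" by auto
  have "((\<lambda>x. L (f x)) has_derivative (\<lambda>h. \<Sum>i\<in>Basis. (h \<bullet> i) *\<^sub>R L (g i x))) (at x within S)"
    if "x \<in> S" for x
    using bounded_linear.has_derivative[OF L g(1)[OF that]] bounded_linear.linear[OF L]
    by (simp add: linear_sum linear_cmul)
  then show ?case using Suc.IH[OF g(2)] by (auto intro!: exI[of _ "\<lambda>i x. L (g i x)"])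
qed

lemma Ck_on_const: "Ck_on k S (\<lambda>x. c)"
proof (induction k arbitrary: c)
  case (Suc k)
  then show ?case by (auto intro!: exI[of _ "\<lambda>_ _. 0"])
qed simp

lemma Ck_on_add:
  "Ck_on k S f \<Longrightarrow> Ck_on k S f' \<Longrightarrow> Ck_on k S (\<lambda>x. f x + f' x)"
proof (induction k arbitrary: f f')
  case (Suc k)
  obtain g where g: "\<And>x. x \<in> S \<Longrightarrow> (f has_derivative (\<lambda>h. \<Sum>i\<in>Basis. (h \<bullet> i) *\<^sub>R g i x)) (at x within S)"
    "\<And>i. i \<in> Basis \<Longrightarrow> Ck_on k S (g i)" using Suc.prems(1) by auto
  obtain g' where g': "\<And>x. x \<in> S \<Longrightarrow> (f' has_derivative (\<lambda>h. \<Sum>i\<in>Basis. (h \<bullet> i) *\<^sub>R g' i x)) (at x within S)"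
    "\<And>i. i \<in> Basis \<Longrightarrow> Ck_on k S (g' i)" using Suc.prems(2) by auto
  have "((\<lambda>x. f x + f' x) has_derivative (\<lambda>h. \<Sum>i\<in>Basis. (h \<bullet> i) *\<^sub>R (g i x + g' i x))) (at x within S)"
    if "x \<in> S" for x
    using has_derivative_add[OF g(1)[OF that] g'(1)[OF that]]
    by (simp add: scaleR_add_right sum.distrib)
  then show ?case using Suc.IH g(2) g'(2) by (auto intro!: exI[of _ "\<lambda>i x. g i x + g' i x"])
qed (auto intro: continuous_intros)

lemma Ck_on_mult:
  fixes f f' :: "'a::euclidean_space \<Rightarrow> real"
  shows "Ck_on k S f \<Longrightarrow> Ck_on k S f' \<Longrightarrow> Ck_on k S (\<lambda>x. f x * f' x)"
proof (induction k arbitrary: f f')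
  case (Suc k)
  obtain g where g: "\<And>x. x \<in> S \<Longrightarrow> (f has_derivative (\<lambda>h. \<Sum>i\<in>Basis. (h \<bullet> i) *\<^sub>R g i x)) (at x within S)"
    "\<And>i. i \<in> Basis \<Longrightarrow> Ck_on k S (g i)" using Suc.prems(1) by auto
  obtain g' where g': "\<And>x. x \<in> S \<Longrightarrow> (f' has_derivative (\<lambda>h. \<Sum>i\<in>Basis. (h \<bullet> i) *\<^sub>R g' i x)) (at x within S)"
    "\<And>i. i \<in> Basis \<Longrightarrow> Ck_on k S (g' i)" using Suc.prems(2) by auto
  have "((\<lambda>x. f x * f' x) has_derivative (\<lambda>h. \<Sum>i\<in>Basis. (h \<bullet> i) *\<^sub>R (f x * g' i x + g i x * f' x))) (at x within S)"
    if "x \<in> S" for x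
    using has_derivative_mult[OF g(1)[OF that] g'(1)[OF that]]
    by (simp add: distrib_left sum.distrib sum_distrib_left sum_distrib_right mult_ac)
  moreover have "Ck_on k S (\<lambda>x. f x * g' i x + g i x * f' x)" if "i \<in> Basis" for i
    using Ck_on_SucD[OF Suc.prems(1)] Ck_on_SucD[OF Suc.prems(2)] g(2) g'(2) that
    by (intro Ck_on_add Suc.IH)
  ultimately show ?case by (auto intro!: exI[of _ "\<lambda>i x. f x * g' i x + g i x * f' x"])
qed (auto intro: continuous_intros)

text \<open>The derivative contains, besides partial derivatives of \<open>f\<close>, only
  \<open>inverse f\<close> again, so the induction on \<open>k\<close> closes with \<open>f\<close>
  fixed. The sign is written as a constant factor so that the product rule suffices.\<close>

lemma Ck_on_inverse:
  fixes f :: "'a::euclidean_space \<Rightarrow> real"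
  assumes nz: "\<And>x. x \<in> S \<Longrightarrow> f x \<noteq> 0"
  shows "Ck_on k S f \<Longrightarrow> Ck_on k S (\<lambda>x. inverse (f x))"
proof (induction k)
  case 0
  then show ?case using nz by (auto intro: continuous_on_inverse)
next
  case (Suc k)
  obtain g where g: "\<And>x. x \<in> S \<Longrightarrow> (f has_derivative (\<lambda>h. \<Sum>i\<in>Basis. (h \<bullet> i) *\<^sub>R g i x)) (at x within S)"
    "\<And>i. i \<in> Basis \<Longrightarrow> Ck_on k S (g i)" using Suc.prems(1) by auto
  have "((\<lambda>x. inverse (f x)) has_derivative
      (\<lambda>h. \<Sum>i\<in>Basis. (h \<bullet> i) *\<^sub>R ((- 1) * (inverse (f x) * inverse (f x) * g i x)))) (at x within S)"
    if "x \<in> S" for x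
    using Deriv.has_derivative_inverse[OF nz[OF that] g(1)[OF that]]
    by (simp add: sum_distrib_left sum_distrib_right mult_ac sum_negf)
  moreover have "Ck_on k S (\<lambda>x. (- 1) * (inverse (f x) * inverse (f x) * g i x))" if "i \<in> Basis" for i
    using Suc.IH[OF Ck_on_SucD[OF Suc.prems]] g(2)[OF that] by (intro Ck_on_mult Ck_on_const)
  ultimately show ?case
    by (auto intro!: exI[of _ "\<lambda>i x. (- 1) * (inverse (f x) * inverse (f x) * g i x)"])
qed

text \<open>The derivative contains, besides partial derivatives of \<open>f\<close>, only the
  inverse of the root, which \<open>Ck_on_inverse\<close> controls at the lower order.\<close>

lemma Ck_on_sqrt:
  fixes f :: "'a::euclidean_space \<Rightarrow> real"
  assumes pos: "\<And>x. x \<in> S \<Longrightarrow> f x > 0"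
  shows "Ck_on k S f \<Longrightarrow> Ck_on k S (\<lambda>x. sqrt (f x))"
proof (induction k)
  case 0
  then show ?case by (auto intro: continuous_intros)
next
  case (Suc k)
  obtain g where g: "\<And>x. x \<in> S \<Longrightarrow> (f has_derivative (\<lambda>h. \<Sum>i\<in>Basis. (h \<bullet> i) *\<^sub>R g i x)) (at x within S)"
    "\<And>i. i \<in> Basis \<Longrightarrow> Ck_on k S (g i)" using Suc.prems(1) by auto
  have "((\<lambda>x. sqrt (f x)) has_derivative
      (\<lambda>h. \<Sum>i\<in>Basis. (h \<bullet> i) *\<^sub>R ((1 / 2) * (inverse (sqrt (f x)) * g i x)))) (at x within S)"
    if "x \<in> S" for x
  proof (rule has_derivative_eq_rhs[OF has_derivative_real_sqrt[OF pos[OF that] g(1)[OF that]]], rule ext)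
    fix h
    have eq: "(\<Sum>i\<in>Basis. (h \<bullet> i) *\<^sub>R ((1 / 2) * (inverse (sqrt (f x)) * g i x)))
        = (\<Sum>i\<in>Basis. (h \<bullet> i) *\<^sub>R g i x) * ((1 / 2) * inverse (sqrt (f x)))"
      unfolding sum_distrib_right by (rule sum.cong) auto
    show "(\<Sum>i\<in>Basis. (h \<bullet> i) *\<^sub>R g i x) * (inverse (sqrt (f x)) / 2)
        = (\<Sum>i\<in>Basis. (h \<bullet> i) *\<^sub>R ((1 / 2) * (inverse (sqrt (f x)) * g i x)))"
      unfolding eq by simp
  qed
  moreover have "Ck_on k S (\<lambda>x. (1 / 2) * (inverse (sqrt (f x)) * g i x))" if "i \<in> Basis" for i
  proof -
    have "Ck_on k S (\<lambda>x. inverse (sqrt (f x)))"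
      by (rule Ck_on_inverse[OF _ Suc.IH[OF Ck_on_SucD[OF Suc.prems]]]) (auto dest: pos)
    then show ?thesis by (intro Ck_on_mult Ck_on_const g(2)[OF that])
  qed
  ultimately show ?case
    by (auto intro!: exI[of _ "\<lambda>i x. (1 / 2) * (inverse (sqrt (f x)) * g i x)"])
qed

section \<open>Coordinates in the plane\<close>

lemma Basis_real2: "(Basis :: (real^2) set) = {axis 1 1, axis 2 1}"
  by (auto simp: Basis_vec_def UNIV_2)

lemma sum_Basis_real2: "(\<Sum>i\<in>Basis. f i) = f (axis 1 1 :: real^2) + f (axis 2 1)"
  by (simp add: Basis_real2 axis_eq_axis)

lemma inner_real2: "x \<bullet> y = x $ 1 * y $ 1 + x $ 2 * y $ 2" for x y :: "real^2"
  by (simp add: inner_vec_def UNIV_2)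

lemma Ck_on_partials:
  fixes f :: "real^2 \<Rightarrow> real"
  assumes "Ck_on (Suc k) S f"
  obtains f1 f2 where "Ck_on k S f1" "Ck_on k S f2"
    "\<And>x. x \<in> S \<Longrightarrow> (f has_derivative (\<lambda>h. f1 x * h $ 1 + f2 x * h $ 2)) (at x within S)"
proof -
  obtain g where g: "\<And>x. x \<in> S \<Longrightarrow> (f has_derivative (\<lambda>h. \<Sum>i\<in>Basis. (h \<bullet> i) *\<^sub>R g i x)) (at x within S)"
    "\<And>i. i \<in> Basis \<Longrightarrow> Ck_on k S (g i)" using assms by auto
  show thesis
  proof (rule that[of "g (axis 1 1)" "g (axis 2 1)"])
    show "Ck_on k S (g (axis 1 1))" "Ck_on k S (g (axis 2 1))" by (auto intro!: g(2) simp: Basis_real2)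
    show "(f has_derivative (\<lambda>h. g (axis 1 1) x * h $ 1 + g (axis 2 1) x * h $ 2)) (at x within S)"
      if "x \<in> S" for x
      using g(1)[OF that] by (simp add: sum_Basis_real2 inner_axis mult.commute)
  qed
qed

lemma has_derivative_grad:
  assumes "f differentiable F"
  shows "(f has_derivative (\<lambda>h. grad f F \<bullet> h)) F"
proof -
  have d: "(f has_derivative frechet_derivative f F) F" using assms frechet_derivative_works by blast
  have lin: "linear (frechet_derivative f F)" using has_derivative_linear[OF d] .
  have "frechet_derivative f F h = grad f F \<bullet> h" for h
  proof -
    have h: "h = (h $ 1) *\<^sub>R axis 1 1 + (h $ 2) *\<^sub>R axis 2 1"
      by (simp add: vec_eq_iff forall_2 axis_def)
    show ?thesis
      by (subst h) (simp add: linear_add[OF lin] linear_cmul[OF lin] grad_def inner_real2 mult.commute)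
  qed
  then show ?thesis using d by (metis (no_types, lifting) ext)
qed

lemma has_derivative_vector2:
  assumes "(f1 has_derivative D1) (at a within S)" "(f2 has_derivative D2) (at a within S)"
  shows "((\<lambda>x. vector [f1 x, f2 x] :: real^2) has_derivative (\<lambda>h. vector [D1 h, D2 h])) (at a within S)"
  using assms by (subst has_derivative_componentwise_within) (simp add: Basis_real2 inner_axis)

section \<open>Rays entering a domain with C1 boundary\<close>

text \<open>Near \<open>z\<close> the defining function is at most 0 on the closure and strictly
  decreases along \<open>d\<close>, so any positive step ends where it is negative. The
  neighbourhood does not depend on the starting point.\<close>

lemma local_defining_function_ray:
  assumes ldf: "local_defining_function \<Omega> z r \<Phi> g" and d: "g z \<bullet> d < 0"
  shows "\<exists>\<delta>>0. \<forall>x\<in>closure \<Omega> \<inter> ball z \<delta>. \<forall>t>0. x + t *\<^sub>R d \<in> ball z \<delta> \<longrightarrow> x + t *\<^sub>R d \<in> \<Omega>"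
proof -
  note L = ldf[unfolded local_defining_function_def]
  have r: "r > 0" and dPhi: "\<And>y. y \<in> ball z r \<Longrightarrow> (\<Phi> has_derivative (\<lambda>h. g y \<bullet> h)) (at y)"
    and cg: "continuous_on (ball z r) g" and \<Omega>: "\<And>y. y \<in> ball z r \<Longrightarrow> y \<in> \<Omega> \<longleftrightarrow> \<Phi> y < 0"
    using L by auto
  have "((\<lambda>y. g y \<bullet> d) \<longlongrightarrow> g z \<bullet> d) (at z)"
  proof (rule tendsto_inner[OF _ tendsto_const])
    have "isCont g z" using cg r continuous_on_eq_continuous_at[OF open_ball] by (metis centre_in_ball)
    then show "(g \<longlongrightarrow> g z) (at z)" by (simp add: isCont_def)
  qed
  then have "\<forall>\<^sub>F y in at z. g y \<bullet> d < 0" using d by (rule order_tendstoD)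
  then obtain \<delta>1 where \<delta>1: "\<delta>1 > 0" "\<And>y. y \<noteq> z \<Longrightarrow> dist y z < \<delta>1 \<Longrightarrow> g y \<bullet> d < 0"
    unfolding eventually_at by auto
  define \<delta> where "\<delta> = min \<delta>1 r"
  have \<delta>: "\<delta> > 0" using \<delta>1 r by (simp add: \<delta>_def)
  have neg: "g y \<bullet> d < 0" if "y \<in> ball z \<delta>" for y
    using \<delta>1(2)[of y] that d by (cases "y = z") (auto simp: \<delta>_def dist_commute)
  have sub: "y \<in> ball z r" if "y \<in> ball z \<delta>" for y using that by (simp add: \<delta>_def)
  show ?thesis
  proof (intro exI conjI ballI allI impI)
    show "\<delta> > 0" by fact
    fix x t assume x: "x \<in> closure \<Omega> \<inter> ball z \<delta>" and t: "(t::real) > 0" "x + t *\<^sub>R d \<in> ball z \<delta>"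
    \<comment> \<open>Where \<Phi> is positive, a whole neighbourhood misses \<Omega>.\<close>
    have "\<Phi> x \<le> 0"
    proof (rule ccontr)
      assume "\<not> \<Phi> x \<le> 0"
      have xr: "x \<in> ball z r" using x sub by blast
      have "isCont \<Phi> x" using dPhi[OF xr] has_derivative_continuous by blast
      then have "\<forall>\<^sub>F y in nhds x. \<Phi> y > 0"
        using \<open>\<not> \<Phi> x \<le> 0\<close> order_tendstoD(1)[of \<Phi> "\<Phi> x" "nhds x" 0] tendsto_at_iff_tendsto_nhds[of \<Phi> x]
        by (simp add: isCont_def)
      moreover have "\<forall>\<^sub>F y in nhds x. y \<in> ball z r" by (rule eventually_nhds_in_open[OF open_ball xr])
      ultimately have "\<forall>\<^sub>F y in nhds x. y \<notin> \<Omega>" by eventually_elim (use \<Omega> in force)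
      then obtain \<epsilon> where "\<epsilon> > 0" "\<And>y. dist y x < \<epsilon> \<Longrightarrow> y \<notin> \<Omega>" unfolding eventually_nhds_metric by blast
      then show False using x closure_approachable[of x \<Omega>] by auto
    qed
    have seg: "x + s *\<^sub>R d \<in> ball z \<delta>" if "0 \<le> s" "s \<le> t" for s
      using ball_segment[OF _ t(2) that] x by blast
    have der: "((\<lambda>t. \<Phi> (x + t *\<^sub>R d)) has_real_derivative g (x + s *\<^sub>R d) \<bullet> d) (at s)"
      if "0 \<le> s" "s \<le> t" for s
      by (rule line_derivative[where S = UNIV and D = "\<lambda>h. g (x + s *\<^sub>R d) \<bullet> h"])
         (use dPhi[OF sub[OF seg]] that in auto)
    obtain s where s: "0 < s" "s < t" "\<Phi> (x + t *\<^sub>R d) - \<Phi> (x + 0 *\<^sub>R d) = (t - 0) * (g (x + s *\<^sub>R d) \<bullet> d)"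
      using MVT2[OF t(1) der] by blast
    have "t * (g (x + s *\<^sub>R d) \<bullet> d) < 0" using neg[OF seg[of s]] s t by (intro mult_pos_neg) auto
    then have "\<Phi> (x + t *\<^sub>R d) < 0" using s(3) \<open>\<Phi> x \<le> 0\<close> by simp
    then show "x + t *\<^sub>R d \<in> \<Omega>" using \<Omega>[OF sub[OF t(2)]] by simp
  qed
qed

text \<open>Since \<open>f\<close> is positive inside and zero at \<open>z\<close>, its gradient
  \<open>v\<close> has nonnegative product with every direction entering the domain. A half space in
  which this holds is the one with inner normal \<open>- g z\<close>, so
  \<open>v \<bullet> d > 0\<close> forces \<open>g z \<bullet> d < 0\<close>.\<close>

lemma inward_of_C1_boundary:
  assumes C1: "C1_boundary \<Omega>" and z: "z \<in> frontier \<Omega>"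
    and df: "(f has_derivative (\<lambda>h. v \<bullet> h)) (at z within closure \<Omega>)"
    and f: "f z = 0" "\<And>x. x \<in> \<Omega> \<Longrightarrow> f x > 0" and d: "v \<bullet> d > 0"
  shows "\<exists>\<delta>>0. \<forall>x\<in>closure \<Omega> \<inter> ball z \<delta>. \<forall>t>0. x + t *\<^sub>R d \<in> ball z \<delta> \<longrightarrow> x + t *\<^sub>R d \<in> \<Omega>"
proof -
  obtain r \<Phi> g where ldf: "local_defining_function \<Omega> z r \<Phi> g" using C1 z unfolding C1_boundary_def by blast
  have gz: "g z \<noteq> 0" using ldf unfolding local_defining_function_def by simp
  have zc: "z \<in> closure \<Omega>" using z by (simp add: frontier_def)
  have half: "v \<bullet> w \<ge> 0" if w: "g z \<bullet> w < 0" for w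
  proof -
    have "\<forall>\<^sub>F t in at_right 0. z + t *\<^sub>R w \<in> \<Omega>"
      by (rule eventually_ray_inward[OF local_defining_function_ray[OF ldf w] zc])
    then have "\<forall>\<^sub>F t in at_right 0. z + t *\<^sub>R w \<in> closure \<Omega> \<and> f (z + t *\<^sub>R w) - f z \<ge> 0 * t"
      by eventually_elim (use f closure_subset in \<open>auto intro: less_imp_le\<close>)
    then show ?thesis by (rule directional_derivative_ge[OF df])
  qed
  have "g z \<bullet> d < 0"
  proof (rule ccontr)
    assume "\<not> g z \<bullet> d < 0"
    define q where "q = \<bar>v \<bullet> g z\<bar> + 1"
    have q: "q > 0" by (simp add: q_def add_nonneg_pos)
    \<comment> \<open>Small enough that tilting \<open>- d\<close> by a multiple \<eta> of
      \<open>g z\<close> into the half space of \<open>half\<close> costs at most half of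
      \<open>v \<bullet> d\<close>.\<close>
    define \<eta> where "\<eta> = v \<bullet> d / (2 * q)"
    have \<eta>: "\<eta> > 0" using d q by (simp add: \<eta>_def)
    have "g z \<bullet> g z > 0" using gz by simp
    then have "\<eta> * (g z \<bullet> g z) > 0" using \<eta> by simp
    then have "g z \<bullet> (- d - \<eta> *\<^sub>R g z) < 0" using \<open>\<not> g z \<bullet> d < 0\<close> by (simp add: inner_diff_right)
    from half[OF this] have "v \<bullet> d \<le> - \<eta> * (v \<bullet> g z)" by (simp add: inner_diff_right)
    also have "\<dots> \<le> \<eta> * q" using mult_left_mono[of "- (v \<bullet> g z)" q \<eta>] \<eta> by (simp add: q_def)
    also have "\<dots> = v \<bullet> d / 2" using q by (simp add: \<eta>_def)
    finally show False using d by simp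
  qed
  then show ?thesis by (rule local_defining_function_ray[OF ldf])
qed

section \<open>The overdetermined problem\<close>

text \<open>\<open>Q\<close> is the Bernoulli function of the Euler flow with stream function \<open>h(A)\<close>, where \<open>h'(A) = sig\<close>;
  \<open>om\<close> is its vorticity.\<close>

locale euler_core =
  fixes \<Omega> :: "(real^2) set" and A sig om Q ks :: "real^2 \<Rightarrow> real" and gA G :: "real^2 \<Rightarrow> real^2"
    and K :: "real^2 \<Rightarrow> real^2 \<Rightarrow> real^2" and xs :: "real^2" and s0 :: real
  assumes open_\<Omega>: "open \<Omega>" and conn: "connected \<Omega>" and bdd: "bounded \<Omega>" and compl: "connected (- \<Omega>)"
    and C1: "C1_boundary \<Omega>" and xs: "xs \<in> \<Omega>"
    and gradA: "\<And>x. x \<in> closure \<Omega> \<Longrightarrow> (A has_derivative (\<lambda>h. gA x \<bullet> h)) (at x within closure \<Omega>)"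
    and zeroA: "\<And>x. x \<in> frontier \<Omega> \<Longrightarrow> A x = 0" and pos_xs: "A xs > 0"
    and gA_nz: "\<And>x. x \<in> closure \<Omega> - {xs} \<Longrightarrow> gA x \<noteq> 0"
    and gA_cont: "continuous_on (closure \<Omega> - {xs}) gA"
    and sig_pos: "\<And>x. x \<in> closure \<Omega> - {xs} \<Longrightarrow> sig x > 0"
    and sig_cont: "continuous_on (closure \<Omega> - {xs}) sig"
    and sig_lim: "(sig \<longlongrightarrow> s0) (at xs)"
    and sig_grad: "\<And>x. x \<in> \<Omega> - {xs} \<Longrightarrow> (sig has_derivative (\<lambda>h. ks x * (gA x \<bullet> h))) (at x)"
    and G_eq: "\<And>x. G x = sig x *\<^sub>R gA x"
    and hess: "\<And>x. x \<in> closure \<Omega> - {xs} \<Longrightarrow> (G has_derivative K x) (at x within (closure \<Omega> - {xs}))"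
    and symK: "\<And>x h k. x \<in> closure \<Omega> - {xs} \<Longrightarrow> K x h \<bullet> k = h \<bullet> K x k"
    and traceK: "\<And>x. x \<in> \<Omega> - {xs} \<Longrightarrow> om x = (\<Sum>i\<in>Basis. K x i \<bullet> i)"
    and om_C1: "Ck_on (Suc 0) (closure \<Omega> - {xs}) om"
    and Q_cont: "continuous_on (closure \<Omega> - {xs}) Q"
    and Q_grad: "\<And>x. x \<in> \<Omega> - {xs} \<Longrightarrow> (Q has_derivative (\<lambda>h. (om x * sig x) * (gA x \<bullet> h))) (at x)"
    and Q_frontier: "\<And>x. x \<in> frontier \<Omega> \<Longrightarrow> Q x = (norm (G x))\<^sup>2 / 2"
begin

lemma at_within_interior_closure: "x \<in> \<Omega> \<Longrightarrow> at x within closure \<Omega> = at x"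
  using open_\<Omega> closure_subset by (meson at_within_interior in_mono interior_maximal)

sublocale L: level_sets \<Omega> A gA xs
proof
  show "continuous_on (closure \<Omega>) A"
    using gradA has_derivative_continuous continuous_on_eq_continuous_within by blast
  show "(A has_derivative (\<lambda>h. gA x \<bullet> h)) (at x)" if "x \<in> \<Omega> - {xs}" for x
    using gradA[of x] that at_within_interior_closure[of x] closure_subset by auto
  show "gA x \<noteq> 0" if "x \<in> \<Omega> - {xs}" for x using gA_nz[of x] that closure_subset by auto
  show "continuous_on (\<Omega> - {xs}) gA" by (rule continuous_on_subset[OF gA_cont]) (use closure_subset in auto)
qed (use open_\<Omega> bdd xs compl zeroA pos_xs in auto)

lemma frontierD: "z \<in> frontier \<Omega> \<Longrightarrow> z \<in> closure \<Omega> - {xs}" "z \<in> frontier \<Omega> \<Longrightarrow> z \<notin> \<Omega>"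
  using xs by (auto simp: L.frontier_eq)

lemma inward:
  assumes "z \<in> frontier \<Omega>" "gA z \<bullet> d > 0"
  shows "\<exists>\<delta>>0. \<forall>x\<in>closure \<Omega> \<inter> ball z \<delta>. \<forall>t>0. x + t *\<^sub>R d \<in> ball z \<delta> \<longrightarrow> x + t *\<^sub>R d \<in> \<Omega>"
  using assms frontierD[of z] L.A_pos zeroA by (intro inward_of_C1_boundary[OF C1 _ gradA]) auto

lemma inward_ray:
  assumes "z \<in> frontier \<Omega>" "gA z \<bullet> d > 0"
  shows "\<forall>\<^sub>F t in at_right 0. z + t *\<^sub>R d \<in> \<Omega>"
  using eventually_ray_inward[OF inward[OF assms]] frontierD(1)[OF assms(1)] by blast

lemma ray: assumes "z \<in> frontier \<Omega>" shows "\<exists>d. \<forall>\<^sub>F t in at_right 0. z + t *\<^sub>R d \<in> \<Omega>"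
proof -
  have "gA z \<bullet> gA z > 0" using gA_nz[OF frontierD(1)[OF assms]] by simp
  then show ?thesis using inward_ray[OF assms] by blast
qed

text \<open>Positive levels lie in \<Omega>; level 0 is the frontier, which is reached by
  approximation from inside.\<close>

lemma constant_on_closure_level:
  assumes "\<And>x. x \<in> \<Omega> - {xs} \<Longrightarrow> (g has_derivative (\<lambda>h. k x * (gA x \<bullet> h))) (at x)"
    and "continuous_on (closure \<Omega> - {xs}) g"
    and xy: "x \<in> closure \<Omega>" "y \<in> closure \<Omega>" "A x = A y"
  shows "g x = g y"
proof (cases "x \<in> \<Omega>")
  case True
  then have "y \<in> \<Omega>" using xy L.A_pos[OF True] L.closure_cases[of y] zeroA by force
  then show ?thesis using L.constant_on_level[OF assms(1) True _ xy(3)] by blast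
next
  case False
  then have x: "x \<in> frontier \<Omega>" using xy L.closure_cases by blast
  then have "y \<in> frontier \<Omega>" using xy L.A_pos[of y] L.closure_cases[of y] zeroA[OF x] by force
  then show ?thesis using L.constant_on_frontier[OF assms(1,2) ray x] by blast
qed

section \<open>The stream function as a function of \<open>A\<close>\<close>

definition sig' :: "real^2 \<Rightarrow> real" where "sig' x = (if x = xs then s0 else sig x)"

text \<open>The factor \<open>sig\<close> as a function of the value of \<open>A\<close>; by
  \<open>H_A\<close> the choice of the point on the level does not matter.\<close>

definition H :: "real \<Rightarrow> real" where "H a = sig' (SOME x. x \<in> closure \<Omega> \<and> A x = a)"

text \<open>The primitive with value 0 at 0, which makes \<phi> vanish on the frontier.\<close>

definition h :: "real \<Rightarrow> real" where "h a = integral {0..a} H"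

definition \<phi> :: "real^2 \<Rightarrow> real" where "\<phi> x = (if x \<in> \<Omega> then h (A x) else 0)"

lemma A_bounds: "x \<in> closure \<Omega> \<Longrightarrow> A x \<in> {0..A xs}"
  using L.A_nonneg L.A_less_max by (metis atLeastAtMost_iff less_eq_real_def order_refl)

lemma H_A: assumes "x \<in> closure \<Omega>" shows "H (A x) = sig' x"
proof -
  define y where "y = (SOME y. y \<in> closure \<Omega> \<and> A y = A x)"
  have y: "y \<in> closure \<Omega>" "A y = A x"
    using someI[of "\<lambda>y. y \<in> closure \<Omega> \<and> A y = A x" x] assms by (auto simp: y_def)
  have "sig' y = sig' x"
  proof (cases "x = xs \<or> y = xs")
    case True
    then have "x = y" using L.A_less_max y assms by force
    then show ?thesis by simp
  next
    case False
    then show ?thesis using constant_on_closure_level[OF sig_grad sig_cont y(1) assms y(2)]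
      by (simp add: sig'_def)
  qed
  then show ?thesis by (simp add: H_def y_def)
qed

lemma sig'_cont: "continuous_on (closure \<Omega>) sig'"
  unfolding continuous_on_eq_continuous_within
proof
  fix x assume x: "x \<in> closure \<Omega>"
  show "continuous (at x within closure \<Omega>) sig'"
  proof (cases "x = xs")
    case True
    have "(sig' \<longlongrightarrow> s0) (at xs)"
      using sig_lim by (rule Lim_transform_eventually) (simp add: sig'_def eventually_at_filter)
    then show ?thesis
      using True at_within_interior_closure[OF xs] by (simp add: continuous_within sig'_def)
  next
    case False
    have "(sig \<longlongrightarrow> sig x) (at x within (closure \<Omega> - {xs}))"
      using sig_cont x False by (auto simp: continuous_on_def)
    moreover have "at x within (closure \<Omega> - {xs}) = at x within closure \<Omega>"
      by (rule at_within_nhd[of x "- {xs}"]) (use False in auto)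
    ultimately have "(sig \<longlongrightarrow> sig x) (at x within closure \<Omega>)" by simp
    moreover have "\<forall>\<^sub>F y in at x within closure \<Omega>. sig y = sig' y"
      using eventually_neq_at_within[of xs x] by eventually_elim (simp add: sig'_def)
    ultimately have "(sig' \<longlongrightarrow> sig x) (at x within closure \<Omega>)" by (rule Lim_transform_eventually)
    then show ?thesis using False by (simp add: continuous_within sig'_def)
  qed
qed

lemma frontier_nonempty: "frontier \<Omega> \<noteq> {}"
  using frontier_not_empty[of \<Omega>] xs bdd not_bounded_UNIV by blast

lemma A_image: "A ` closure \<Omega> = {0..A xs}"
proof
  show "A ` closure \<Omega> \<subseteq> {0..A xs}" using A_bounds by blast
  obtain z where z: "z \<in> frontier \<Omega>" using frontier_nonempty by blast
  have "connected (A ` closure \<Omega>)"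
    using connected_continuous_image[OF L.contA] connected_imp_connected_closure[OF conn] by blast
  moreover have "0 \<in> A ` closure \<Omega>" using zeroA[OF z] frontierD(1)[OF z] by force
  moreover have "A xs \<in> A ` closure \<Omega>" using xs L.\<Omega>_closure by blast
  ultimately show "{0..A xs} \<subseteq> A ` closure \<Omega>" by (rule connected_contains_Icc)
qed

text \<open>\<open>A\<close> maps a compact set onto the interval and is therefore a quotient map:
  the preimage of a closed set under \<open>H\<close> is the image under \<open>A\<close> of a
  compact set.\<close>

lemma H_cont: "continuous_on {0..A xs} H"
  unfolding continuous_on_closed_vimage[OF closed_atLeastAtMost]
proof (intro allI impI)
  fix C :: "real set" assume "closed C"
  have "H -` C \<inter> {0..A xs} = A ` (sig' -` C \<inter> closure \<Omega>)"
    using H_A unfolding A_image[symmetric] by force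
  moreover have "closed (sig' -` C \<inter> closure \<Omega>)"
    using continuous_on_closed_vimage[OF closed_closure, of \<Omega> sig'] sig'_cont \<open>closed C\<close> by blast
  then have "compact (sig' -` C \<inter> closure \<Omega>)"
    using bdd bounded_subset[OF bounded_closure[OF bdd]] compact_eq_bounded_closed by (metis inf_le2)
  then have "compact (A ` (sig' -` C \<inter> closure \<Omega>))"
    by (intro compact_continuous_image continuous_on_subset[OF L.contA]) auto
  ultimately show "closed (H -` C \<inter> {0..A xs})" by (simp add: compact_imp_closed)
qed

lemma H_pos: assumes "0 \<le> a" "a < A xs" shows "H a > 0"
proof -
  have "a \<in> A ` closure \<Omega>" using assms by (simp add: A_image)
  then obtain x where x: "x \<in> closure \<Omega>" "A x = a" by blast
  then have "x \<noteq> xs" using assms by auto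
  then show ?thesis using H_A[OF x(1)] x sig_pos[of x] by (simp add: sig'_def)
qed

lemma h_deriv: "a \<in> {0..A xs} \<Longrightarrow> (h has_real_derivative H a) (at a within {0..A xs})"
  unfolding h_def[abs_def] by (rule integral_has_real_derivative[OF H_cont])

lemma h_0: "h 0 = 0"
  by (simp add: h_def)

text \<open>Positivity of \<open>H\<close> is known below the top value \<open>A xs\<close>, and the
  mean value point is strictly below it.\<close>

lemma h_strict_mono: assumes "0 \<le> a" "a < b" "b \<le> A xs" shows "h a < h b"
proof -
  have "\<exists>x\<in>{a<..<b}. h b - h a = H x * (b - a)"
  proof (rule mvt_simple[OF assms(2)])
    fix x assume "a \<le> x" "x \<le> b"
    then have "(h has_real_derivative H x) (at x within {a..b})"
      using h_deriv[of x] assms by (auto intro: DERIV_subset)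
    then show "(h has_derivative (\<lambda>y. H x * y)) (at x within {a..b})" by (simp add: has_field_derivative_def)
  qed
  then obtain x where "a < x" "x < b" "h b - h a = H x * (b - a)" by auto
  moreover have "H x * (b - a) > 0" using H_pos[of x] calculation assms by simp
  ultimately show ?thesis by simp
qed

lemma h_inj: "a \<in> {0..A xs} \<Longrightarrow> b \<in> {0..A xs} \<Longrightarrow> h a = h b \<Longrightarrow> a = b"
  using h_strict_mono[of a b] h_strict_mono[of b a] by (metis atLeastAtMost_iff linorder_neqE_linordered_idom order_less_irrefl)

lemma \<phi>_closure: "x \<in> closure \<Omega> \<Longrightarrow> \<phi> x = h (A x)"
  using L.closure_cases[of x] zeroA[of x] by (auto simp: \<phi>_def h_0)

lemma \<phi>_pos: "x \<in> \<Omega> \<Longrightarrow> \<phi> x > 0"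
  using h_strict_mono[of 0 "A x"] L.A_pos[of x] A_bounds[of x] L.\<Omega>_closure[of x] by (simp add: \<phi>_def h_0)

lemma \<phi>_cont: "continuous_on UNIV \<phi>"
proof -
  have "continuous_on {0..A xs} h"
    using h_deriv DERIV_continuous continuous_on_eq_continuous_within by blast
  then have "continuous_on (closure \<Omega>) (\<lambda>x. h (A x))"
    by (rule continuous_on_compose2[OF _ L.contA]) (use A_bounds in auto)
  then have "continuous_on (closure \<Omega>) \<phi>" by (rule continuous_on_eq) (simp add: \<phi>_closure)
  moreover have "continuous_on (- \<Omega>) \<phi>"
    by (rule continuous_on_eq[OF continuous_on_const[of _ 0]]) (simp add: \<phi>_def)
  moreover have "closed (- \<Omega>)" using open_\<Omega> by (rule closed_Compl)
  ultimately have "continuous_on (closure \<Omega> \<union> - \<Omega>) \<phi>" by (intro continuous_on_closed_Un) auto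
  moreover have "closure \<Omega> \<union> - \<Omega> = UNIV" using closure_subset by blast
  ultimately show ?thesis by simp
qed

lemma \<phi>_grad:
  assumes x: "x \<in> closure \<Omega> - {xs}"
  shows "(\<phi> has_derivative (\<lambda>v. G x \<bullet> v)) (at x within closure \<Omega>)"
proof (rule has_derivative_transform)
  show "x \<in> closure \<Omega>" using x by simp
  show "\<phi> y = h (A y)" if "y \<in> closure \<Omega>" for y by (rule \<phi>_closure[OF that])
  have "(h has_derivative (\<lambda>t. H (A x) * t)) (at (A x) within A ` closure \<Omega>)"
    unfolding A_image using h_deriv[OF A_bounds] x by (simp add: has_field_derivative_def)
  from has_derivative_in_compose[OF gradA this]
  have "((\<lambda>y. h (A y)) has_derivative (\<lambda>v. H (A x) * (gA x \<bullet> v))) (at x within closure \<Omega>)"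
    using x by auto
  then show "((\<lambda>y. h (A y)) has_derivative (\<lambda>v. G x \<bullet> v)) (at x within closure \<Omega>)"
    using x H_A[of x] by (simp add: G_eq sig'_def)
qed

section \<open>Vorticity, boundary condition and the overdetermined problem\<close>

lemma at_within_closure_minus: "x \<noteq> xs \<Longrightarrow> at x within (closure \<Omega> - {xs}) = at x within closure \<Omega>"
  by (rule at_within_nhd[of x "- {xs}"]) auto

lemma hess_closure:
  assumes "x \<in> closure \<Omega> - {xs}" shows "(G has_derivative K x) (at x within closure \<Omega>)"
  using hess[OF assms] at_within_closure_minus[of x] assms by simp

text \<open>\<open>om \<cdot> sig\<close> is the derivative of \<open>Q\<close> as a function of \<open>A\<close>.\<close>

lemma om_level:
  assumes "x \<in> \<Omega> - {xs}" "y \<in> \<Omega> - {xs}" "A x = A y"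
  shows "om x = om y"
proof -
  have "om x * sig x = om y * sig y"
    by (rule L.gradient_factor_constant_on_level[OF Q_grad assms])
  moreover have "sig x = sig y"
    using L.constant_on_level[OF sig_grad _ _ assms(3)] assms by blast
  moreover have "sig y > 0" using sig_pos assms L.\<Omega>_closure by blast
  ultimately show ?thesis by simp
qed

text \<open>The Bernoulli function is constant on the frontier and equals there half the squared
  length of \<open>G\<close>; \<open>SOME\<close> only gives the common value a name.\<close>

lemma grad_frontier: "x \<in> frontier \<Omega> \<Longrightarrow> norm (G x) = norm (G (SOME z. z \<in> frontier \<Omega>))"
proof -
  assume x: "x \<in> frontier \<Omega>"
  have z: "(SOME z. z \<in> frontier \<Omega>) \<in> frontier \<Omega>" using x by (rule someI)
  have "Q x = Q (SOME z. z \<in> frontier \<Omega>)"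
    by (rule L.constant_on_frontier[OF Q_grad Q_cont ray x z])
  then show ?thesis using Q_frontier[OF x] Q_frontier[OF z] by simp
qed

text \<open>On the gradient line through \<open>z\<close>, \<phi> increases at rate at least
  \<open>m\<close> and \<open>om\<close> is Lipschitz with constant \<open>C\<close>. Every point
  whose value of \<phi> is near \<open>\<phi> z\<close> shares its level with a point of this line,
  where \<open>om\<close> is the same; hence the constant \<open>C / m\<close>.\<close>

lemma om_lipschitz:
  assumes z: "z \<in> closure \<Omega> - {xs}"
  shows "\<exists>\<delta>>0. \<exists>C. \<forall>x\<in>\<Omega> - {xs}. \<forall>y\<in>\<Omega> - {xs}.
       \<bar>\<phi> x - \<phi> z\<bar> < \<delta> \<longrightarrow> \<bar>\<phi> y - \<phi> z\<bar> < \<delta> \<longrightarrow> \<bar>om x - om y\<bar> \<le> C * \<bar>\<phi> x - \<phi> y\<bar>"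
proof -
  let ?S = "closure \<Omega> - {xs}"
  obtain o1 o2 where o: "Ck_on 0 ?S o1" "Ck_on 0 ?S o2"
    "\<And>x. x \<in> ?S \<Longrightarrow> (om has_derivative (\<lambda>h. o1 x * h $ 1 + o2 x * h $ 2)) (at x within ?S)"
    using Ck_on_partials[OF om_C1] by blast
  define d where "d = gA z"
  have gd: "gA z \<bullet> d > 0" using gA_nz[OF z] by (simp add: d_def)
  have Gd: "G z \<bullet> d > 0" using gd sig_pos[OF z] by (simp add: G_eq)
  define m where "m = G z \<bullet> d / 2"
  have m: "m > 0" using Gd by (simp add: m_def)
  \<comment> \<open>A bound, near \<open>z\<close>, for the derivative of \<open>om\<close> along
    \<open>d\<close>; the summands 1 absorb the variation of the partial derivatives.\<close>
  define C where "C = (\<bar>o1 z\<bar> + 1) * \<bar>d $ 1\<bar> + (\<bar>o2 z\<bar> + 1) * \<bar>d $ 2\<bar>"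
  have zz: "z \<noteq> xs" "z \<in> closure \<Omega>" using z by auto
  have lim0: "(f \<longlongrightarrow> f z) (at z within closure \<Omega>)" if "continuous_on ?S f" for f :: "real^2 \<Rightarrow> real"
  proof -
    have "(f \<longlongrightarrow> f z) (at z within ?S)" using that z unfolding continuous_on_def by blast
    then show ?thesis using at_within_closure_minus[OF zz(1)] by simp
  qed
  have "((\<lambda>x. G x \<bullet> d) \<longlongrightarrow> G z \<bullet> d) (at z within closure \<Omega>)"
    by (intro tendsto_inner tendsto_const)
       (use hess_closure[OF z] has_derivative_continuous continuous_within in blast)
  then have "\<forall>\<^sub>F x in at z within closure \<Omega>. G x \<bullet> d > m"
    by (rule order_tendstoD) (use Gd in \<open>simp add: m_def\<close>)
  moreover have "\<forall>\<^sub>F x in at z within closure \<Omega>. \<bar>o1 x\<bar> < \<bar>o1 z\<bar> + 1"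
    by (rule order_tendstoD(2)[OF tendsto_rabs[OF lim0]]) (use o(1) in auto)
  moreover have "\<forall>\<^sub>F x in at z within closure \<Omega>. \<bar>o2 x\<bar> < \<bar>o2 z\<bar> + 1"
    by (rule order_tendstoD(2)[OF tendsto_rabs[OF lim0]]) (use o(2) in auto)
  ultimately have "\<forall>\<^sub>F x in at z within closure \<Omega>. G x \<bullet> d > m \<and> \<bar>o1 x\<bar> < \<bar>o1 z\<bar> + 1 \<and> \<bar>o2 x\<bar> < \<bar>o2 z\<bar> + 1"
    by eventually_elim auto
  then obtain r1 where r1: "r1 > 0" "\<And>x. x \<in> closure \<Omega> \<Longrightarrow> x \<noteq> z \<Longrightarrow> dist x z < r1 \<Longrightarrow>
      G x \<bullet> d > m \<and> \<bar>o1 x\<bar> < \<bar>o1 z\<bar> + 1 \<and> \<bar>o2 x\<bar> < \<bar>o2 z\<bar> + 1"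
    unfolding eventually_at by blast
  define r where "r = min r1 (dist z xs)"
  have r: "r > 0" using r1 zz by (simp add: r_def)
  have near: "G x \<bullet> d \<ge> m \<and> \<bar>o1 x\<bar> \<le> \<bar>o1 z\<bar> + 1 \<and> \<bar>o2 x\<bar> \<le> \<bar>o2 z\<bar> + 1 \<and> x \<noteq> xs"
    if "x \<in> closure \<Omega>" "x \<in> ball z r" for x
    using r1(2)[of x] that m by (cases "x = z") (auto simp: r_def dist_commute m_def zz)
  have to_z: "((\<lambda>t. z + t *\<^sub>R d) \<longlongrightarrow> z + 0 *\<^sub>R d) (at 0 within T)" for T by (intro tendsto_intros)
  \<comment> \<open>\<open>lo\<close> is the lower end of the usable piece of the line:
    \<open>- s\<close> at an interior point, 0 at a frontier point, from which only half of the line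
    enters \<Omega>.\<close>
  have "\<exists>s>0. \<exists>lo. (lo = - s \<and> z \<in> \<Omega> \<or> lo = 0 \<and> z \<notin> \<Omega>) \<and>
      (\<forall>t. lo \<le> t \<longrightarrow> t \<le> s \<longrightarrow> z + t *\<^sub>R d \<in> ball z r \<and> (z + t *\<^sub>R d \<in> \<Omega> \<or> t = 0))"
  proof (cases "z \<in> \<Omega>")
    case True
    have "open (\<Omega> \<inter> ball z r)" using open_\<Omega> by auto
    from topological_tendstoD[OF to_z[of UNIV] this]
    obtain s where s: "s > 0" "\<And>t. t \<noteq> 0 \<Longrightarrow> \<bar>t\<bar> < s \<Longrightarrow> z + t *\<^sub>R d \<in> \<Omega> \<inter> ball z r"
      using True r unfolding eventually_at by (auto simp: dist_real_def)
    have "z + t *\<^sub>R d \<in> ball z r \<and> (z + t *\<^sub>R d \<in> \<Omega> \<or> t = 0)" if "- (s/2) \<le> t" "t \<le> s/2" for t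
      using s(2)[of t] s(1) that r by (cases "t = 0") auto
    then show ?thesis using s True by (intro exI[of _ "s/2"]) auto
  next
    case False
    then have zf: "z \<in> frontier \<Omega>" using zz L.closure_cases by blast
    have "\<forall>\<^sub>F t in at_right 0. z + t *\<^sub>R d \<in> ball z r"
      by (rule topological_tendstoD[OF to_z]) (use r in auto)
    with inward_ray[OF zf gd] have "\<forall>\<^sub>F t in at_right 0. z + t *\<^sub>R d \<in> \<Omega> \<and> z + t *\<^sub>R d \<in> ball z r"
      by (rule eventually_conj)
    then obtain s where s: "s > 0" "\<And>t. 0 < t \<Longrightarrow> t < s \<Longrightarrow> z + t *\<^sub>R d \<in> \<Omega> \<and> z + t *\<^sub>R d \<in> ball z r"
      unfolding eventually_at_right_field by blast
    have "z + t *\<^sub>R d \<in> ball z r \<and> (z + t *\<^sub>R d \<in> \<Omega> \<or> t = 0)" if "0 \<le> t" "t \<le> s/2" for t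
      using s(2)[of t] s(1) that r by (cases "t = 0") auto
    then show ?thesis using s False by (intro exI[of _ "s/2"]) auto
  qed
  then obtain s lo where s: "s > 0" and lo: "lo = - s \<and> z \<in> \<Omega> \<or> lo = 0 \<and> z \<notin> \<Omega>"
    and seg: "\<And>t. lo \<le> t \<Longrightarrow> t \<le> s \<Longrightarrow> z + t *\<^sub>R d \<in> ball z r \<and> (z + t *\<^sub>R d \<in> \<Omega> \<or> t = 0)" by blast
  have lo0: "lo \<le> 0" using lo s by auto
  have segc: "z + t *\<^sub>R d \<in> ?S" "z + t *\<^sub>R d \<in> closure \<Omega>" "z + t *\<^sub>R d \<in> ball z r" if "lo \<le> t" "t \<le> s" for t
  proof -
    show b: "z + t *\<^sub>R d \<in> ball z r" using seg[OF that] by blast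
    show c: "z + t *\<^sub>R d \<in> closure \<Omega>" using seg[OF that] L.\<Omega>_closure zz by auto
    show "z + t *\<^sub>R d \<in> ?S" using near[OF c b] c by blast
  qed
  define f where "f t = \<phi> (z + t *\<^sub>R d)" for t
  have f_inc: "f b - f a \<ge> m * (b - a)" if ab: "lo \<le> a" "a < b" "b \<le> s" for a b
  proof -
    have "\<exists>t\<in>{a<..<b}. f b - f a = (G (z + t *\<^sub>R d) \<bullet> d) * (b - a)"
    proof (rule mvt_simple[OF ab(2)])
      fix t assume t: "a \<le> t" "t \<le> b"
      have "(f has_real_derivative G (z + t *\<^sub>R d) \<bullet> d) (at t within {a..b})"
        unfolding f_def
        by (rule line_derivative[where S = "closure \<Omega>" and D = "\<lambda>h. G (z + t *\<^sub>R d) \<bullet> h"])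
           (use \<phi>_grad segc t ab in auto)
      then show "(f has_derivative (\<lambda>y. (G (z + t *\<^sub>R d) \<bullet> d) * y)) (at t within {a..b})"
        by (simp add: has_field_derivative_def)
    qed
    then obtain t where t: "a < t" "t < b" "f b - f a = (G (z + t *\<^sub>R d) \<bullet> d) * (b - a)" by auto
    have "G (z + t *\<^sub>R d) \<bullet> d \<ge> m" using near[OF segc(2,3)[of t]] t ab by auto
    then show ?thesis using t(3) ab by (simp add: mult_right_mono)
  qed
  have om_bd: "\<bar>om (z + b *\<^sub>R d) - om (z + a *\<^sub>R d)\<bar> \<le> C * (b - a)" if ab: "lo \<le> a" "a < b" "b \<le> s" for a b
  proof -
    let ?D = "\<lambda>t. o1 (z + t *\<^sub>R d) * d $ 1 + o2 (z + t *\<^sub>R d) * d $ 2"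
    have "\<exists>t\<in>{a<..<b}. om (z + b *\<^sub>R d) - om (z + a *\<^sub>R d) = ?D t * (b - a)"
    proof (rule mvt_simple[OF ab(2)])
      fix t assume t: "a \<le> t" "t \<le> b"
      have "((\<lambda>t. om (z + t *\<^sub>R d)) has_real_derivative ?D t) (at t within {a..b})"
        by (rule line_derivative[where S = ?S and D = "\<lambda>h. o1 (z + t *\<^sub>R d) * h $ 1 + o2 (z + t *\<^sub>R d) * h $ 2"])
           (use o(3) segc t ab in auto)
      then show "((\<lambda>t. om (z + t *\<^sub>R d)) has_derivative (\<lambda>y. ?D t * y)) (at t within {a..b})"
        by (simp add: has_field_derivative_def)
    qed
    then obtain t where t: "a < t" "t < b" "om (z + b *\<^sub>R d) - om (z + a *\<^sub>R d) = ?D t * (b - a)" by auto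
    have n: "\<bar>o1 (z + t *\<^sub>R d)\<bar> \<le> \<bar>o1 z\<bar> + 1" "\<bar>o2 (z + t *\<^sub>R d)\<bar> \<le> \<bar>o2 z\<bar> + 1"
      using near[OF segc(2,3)[of t]] t ab by auto
    have "\<bar>?D t\<bar> \<le> \<bar>o1 (z + t *\<^sub>R d)\<bar> * \<bar>d $ 1\<bar> + \<bar>o2 (z + t *\<^sub>R d)\<bar> * \<bar>d $ 2\<bar>"
      using abs_triangle_ineq by (simp flip: abs_mult)
    also have "\<dots> \<le> C" unfolding C_def using n by (intro add_mono mult_right_mono) auto
    finally show ?thesis using t(3) ab by (simp add: abs_mult mult_right_mono)
  qed
  have fz: "f 0 = \<phi> z" by (simp add: f_def)
  have hit: "\<exists>t. lo \<le> t \<and> t \<le> s \<and> f t = \<phi> x \<and> om (z + t *\<^sub>R d) = om x"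
    if x: "x \<in> \<Omega> - {xs}" and close: "\<bar>\<phi> x - \<phi> z\<bar> < m * s" for x
  proof -
    have "f s \<ge> \<phi> x" using f_inc[of 0 s] lo0 s close fz by simp
    moreover have "f lo \<le> \<phi> x"
    proof (cases "z \<in> \<Omega>")
      case True
      then show ?thesis using f_inc[of lo 0] lo s close fz by auto
    next
      case False
      then show ?thesis using lo \<phi>_pos[of x] x by (auto simp: f_def \<phi>_def)
    qed
    moreover have "continuous_on {lo..s} f"
      unfolding f_def by (intro continuous_on_compose2[OF \<phi>_cont] continuous_intros) auto
    ultimately obtain t where t: "lo \<le> t" "t \<le> s" "f t = \<phi> x"
      using IVT'[of f lo "\<phi> x" s] lo0 s by auto
    let ?P = "z + t *\<^sub>R d"
    have "?P \<in> \<Omega>"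
    proof (rule ccontr)
      assume "?P \<notin> \<Omega>"
      then show False using t(3) \<phi>_pos[of x] x by (simp add: f_def \<phi>_def)
    qed
    then have P: "?P \<in> \<Omega> - {xs}" using segc(1)[OF t(1,2)] by blast
    have "h (A ?P) = h (A x)" using t(3) P x by (simp add: f_def \<phi>_def)
    then have "A ?P = A x" using h_inj A_bounds P x L.\<Omega>_closure by blast
    then have "om ?P = om x" using om_level[OF P x] by simp
    then show ?thesis using t by blast
  qed
  show ?thesis
  proof (intro exI conjI ballI impI)
    show "m * s > 0" using m s by simp
    fix x y assume x: "x \<in> \<Omega> - {xs}" and y: "y \<in> \<Omega> - {xs}"
      and cx: "\<bar>\<phi> x - \<phi> z\<bar> < m * s" and cy: "\<bar>\<phi> y - \<phi> z\<bar> < m * s"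
    obtain t where t: "lo \<le> t" "t \<le> s" "f t = \<phi> x" "om (z + t *\<^sub>R d) = om x" using hit[OF x cx] by blast
    obtain t' where t': "lo \<le> t'" "t' \<le> s" "f t' = \<phi> y" "om (z + t' *\<^sub>R d) = om y" using hit[OF y cy] by blast
    have C0: "C \<ge> 0" by (simp add: C_def)
    have key: "\<bar>om (z + b *\<^sub>R d) - om (z + a *\<^sub>R d)\<bar> \<le> C / m * \<bar>f b - f a\<bar>"
      if ab: "lo \<le> a" "a \<le> b" "b \<le> s" for a b
    proof (cases "a = b")
      case False
      then have ab': "a < b" using ab by simp
      have "b - a \<le> \<bar>f b - f a\<bar> / m" using f_inc[OF ab(1) ab' ab(3)] m
        by (simp add: pos_le_divide_eq mult.commute)
      then have "C * (b - a) \<le> C * (\<bar>f b - f a\<bar> / m)" using C0 by (rule mult_left_mono)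
      then show ?thesis using om_bd[OF ab(1) ab' ab(3)] by simp
    qed simp
    show "\<bar>om x - om y\<bar> \<le> C / m * \<bar>\<phi> x - \<phi> y\<bar>"
      using key[of t t'] key[of t' t] t t' by (cases "t \<le> t'") (auto simp: abs_minus_commute)
  qed
qed

sublocale M: overdetermined \<Omega> \<phi> om G K xs "norm (G (SOME z. z \<in> frontier \<Omega>))"
proof
  show "open \<Omega>" "bounded \<Omega>" "xs \<in> \<Omega>" by (rule open_\<Omega> bdd xs)+
  show "\<phi> x = 0" if "x \<notin> \<Omega>" for x using that by (simp add: \<phi>_def)
  show "\<phi> x > 0" if "x \<in> \<Omega>" for x by (rule \<phi>_pos[OF that])
  show "continuous_on UNIV \<phi>" by (rule \<phi>_cont)
  show "(\<phi> has_derivative (\<lambda>h. G x \<bullet> h)) (at x within closure \<Omega>)" if "x \<in> closure \<Omega> - {xs}" for x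
    by (rule \<phi>_grad[OF that])
  show "(G has_derivative K x) (at x within closure \<Omega>)" if "x \<in> closure \<Omega> - {xs}" for x
    by (rule hess_closure[OF that])
  show "K x h \<bullet> k = h \<bullet> K x k" if "x \<in> frontier \<Omega>" for x h k by (rule symK[OF frontierD(1)[OF that]])
  show "G x \<noteq> 0" if "x \<in> closure \<Omega> - {xs}" for x using gA_nz[OF that] sig_pos[OF that] by (simp add: G_eq)
  show "norm (G x) = norm (G (SOME z. z \<in> frontier \<Omega>))" if "x \<in> frontier \<Omega>" for x
    by (rule grad_frontier[OF that])
  show "om x = (\<Sum>i\<in>Basis. K x i \<bullet> i)" if "x \<in> \<Omega> - {xs}" for x by (rule traceK[OF that])
  show "\<exists>\<delta>>0. \<exists>C. \<forall>x\<in>\<Omega> - {xs}. \<forall>y\<in>\<Omega> - {xs}.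
       \<bar>\<phi> x - \<phi> z\<bar> < \<delta> \<longrightarrow> \<bar>\<phi> y - \<phi> z\<bar> < \<delta> \<longrightarrow> \<bar>om x - om y\<bar> \<le> C * \<bar>\<phi> x - \<phi> y\<bar>"
    if "z \<in> closure \<Omega> - {xs}" for z by (rule om_lipschitz[OF that])
  show "\<exists>\<delta>>0. \<forall>x\<in>closure \<Omega> \<inter> ball z \<delta>. \<forall>t>0. x + t *\<^sub>R d \<in> ball z \<delta> \<longrightarrow> x + t *\<^sub>R d \<in> \<Omega>"
    if "z \<in> frontier \<Omega>" "G z \<bullet> d > 0" for z d
  proof (rule inward[OF that(1)])
    show "gA z \<bullet> d > 0" using that(2) sig_pos[OF frontierD(1)[OF that(1)]]
      by (simp add: G_eq zero_less_mult_iff)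
  qed
qed

text \<open>\<Omega> is the set where \<phi> is positive, so the symmetry of \<phi> passes to
  it.\<close>

lemma radial_domain: "dist x xs = dist y xs \<Longrightarrow> x \<in> \<Omega> \<longleftrightarrow> y \<in> \<Omega>"
  using M.radial[of x y] \<phi>_pos[of x] \<phi>_pos[of y] by (cases "x \<in> \<Omega>"; cases "y \<in> \<Omega>") (auto simp: \<phi>_def)

lemma radial_A:
  assumes "dist x xs = dist y xs" "x \<in> closure \<Omega>" "y \<in> closure \<Omega>"
  shows "A x = A y"
  using M.radial[OF assms(1)] \<phi>_closure[OF assms(2)] \<phi>_closure[OF assms(3)] h_inj A_bounds assms by metis

end

section \<open>Reduction of the MHD system to an Euler flow\<close>

lemma partials_unique:
  fixes a b c d :: real
  assumes "(f has_derivative (\<lambda>h::real^2. a * h $ 1 + b * h $ 2)) (at x)"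
    and "(f has_derivative (\<lambda>h. c * h $ 1 + d * h $ 2)) (at x)"
  shows "a = c" "b = d"
proof -
  have eq: "(\<lambda>h::real^2. a * h $ 1 + b * h $ 2) = (\<lambda>h. c * h $ 1 + d * h $ 2)"
    by (rule has_derivative_unique[OF assms])
  from fun_cong[OF eq, of "axis 1 1"] fun_cong[OF eq, of "axis 2 1"]
  show "a = c" "b = d" by (simp_all add: axis_def)
qed

lemma partials_mult:
  fixes f g :: "real^2 \<Rightarrow> real"
  assumes "(f has_derivative (\<lambda>h. f1 * h $ 1 + f2 * h $ 2)) (at x within S)"
    and "(g has_derivative (\<lambda>h. g1 * h $ 1 + g2 * h $ 2)) (at x within S)"
  shows "((\<lambda>x. f x * g x) has_derivative
     (\<lambda>h. (f1 * g x + f x * g1) * h $ 1 + (f2 * g x + f x * g2) * h $ 2)) (at x within S)"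
  by (rule has_derivative_eq_rhs[OF has_derivative_mult[OF assms]]) (auto simp: algebra_simps)

text \<open>One component of the Euler equation for the velocity \<open>sig * b\<close> with
  pressure \<open>- eps * p\<close>, in Bernoulli form: the derivative of the total head equals the
  vorticity times the other velocity component. The second and third assumptions say that
  \<open>sig\<close> and \<open>lam\<close> are constant along field lines, which removes their
  derivatives from the advection terms.\<close>

lemma pressure_identity:
  fixes lam sig eps :: real
  assumes "sig * sig = eps * (1 - lam * lam)" "s1 * b1 + s2 * b2 = 0" "l1 * b1 + l2 * b2 = 0"
    and "(lam * b1) * (lam * b11 + l1 * b1) + (lam * b2) * (lam * b12 + l2 * b1) - (b1 * b11 + b2 * b12) = - p1"
  shows "(sig * b1) * (s1 * b1 + sig * b11) + (sig * b2) * (s1 * b2 + sig * b21) - eps * p1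
    = ((s1 * b2 + sig * b21) - (s2 * b1 + sig * b12)) * sig * b2"
proof -
  have "p1 = (1 - lam * lam) * (b1 * b11 + b2 * b12) - lam * b1 * (l1 * b1 + l2 * b2)"
    using assms(4) by (simp add: algebra_simps)
  then have "p1 = (1 - lam * lam) * (b1 * b11 + b2 * b12)" unfolding assms(3) by simp
  then have "eps * p1 = (eps * (1 - lam * lam)) * (b1 * b11 + b2 * b12)" by simp
  then have "eps * p1 = (sig * sig) * (b1 * b11 + b2 * b12)" unfolding assms(1) .
  moreover have "sig * b1 * (s1 * b1 + s2 * b2) = 0" using assms(2) by simp
  ultimately show ?thesis by (simp add: algebra_simps)
qed

text \<open>Components instead of vectors turn the equations into algebra with partial derivatives;
  the gradient of \<open>A\<close> is \<open>(b2, - b1)\<close> because B is its perpendicular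
  gradient. \<open>pde\<close> accepts any partial derivatives, so expressions computed from u = lam
  B can be inserted directly. \<open>l\<close> is the limit of the ratio of squared lengths.\<close>

locale mhd_core =
  fixes \<Omega> :: "(real^2) set" and A \<psi> b1 b2 u1 u2 p :: "real^2 \<Rightarrow> real" and xs :: "real^2" and l :: real
  assumes open_\<Omega>: "open \<Omega>" and conn: "connected \<Omega>" and bdd: "bounded \<Omega>" and compl: "connected (- \<Omega>)"
    and C1: "C1_boundary \<Omega>" and xs: "xs \<in> \<Omega>"
    and gradA: "\<And>x. x \<in> closure \<Omega> \<Longrightarrow> (A has_derivative (\<lambda>h. b2 x * h $ 1 - b1 x * h $ 2)) (at x within closure \<Omega>)"
    and grad\<psi>: "\<And>x. x \<in> closure \<Omega> \<Longrightarrow> (\<psi> has_derivative (\<lambda>h. u2 x * h $ 1 - u1 x * h $ 2)) (at x within closure \<Omega>)"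
    and zeroA: "\<And>x. x \<in> frontier \<Omega> \<Longrightarrow> A x = 0" and pos_xs: "A xs > 0"
    and Ck: "Ck_on (Suc (Suc 0)) (closure \<Omega>) b1" "Ck_on (Suc (Suc 0)) (closure \<Omega>) b2"
      "Ck_on (Suc (Suc 0)) (closure \<Omega>) u1" "Ck_on (Suc (Suc 0)) (closure \<Omega>) u2"
    and parallel: "\<And>x. x \<in> closure \<Omega> \<Longrightarrow> u1 x * b2 x = u2 x * b1 x"
    and nz: "\<And>x. x \<in> closure \<Omega> - {xs} \<Longrightarrow> b1 x * b1 x + b2 x * b2 x \<noteq> 0"
    and ne: "\<And>x. x \<in> closure \<Omega> - {xs} \<Longrightarrow> b1 x * b1 x + b2 x * b2 x \<noteq> u1 x * u1 x + u2 x * u2 x"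
    and lim: "((\<lambda>x. (u1 x * u1 x + u2 x * u2 x) / (b1 x * b1 x + b2 x * b2 x)) \<longlongrightarrow> l) (at xs)"
    and pde: "\<And>x b11 b12 b21 b22 u11 u12 u21 u22. x \<in> \<Omega> - {xs} \<Longrightarrow>
      (b1 has_derivative (\<lambda>h. b11 * h $ 1 + b12 * h $ 2)) (at x) \<Longrightarrow>
      (b2 has_derivative (\<lambda>h. b21 * h $ 1 + b22 * h $ 2)) (at x) \<Longrightarrow>
      (u1 has_derivative (\<lambda>h. u11 * h $ 1 + u12 * h $ 2)) (at x) \<Longrightarrow>
      (u2 has_derivative (\<lambda>h. u21 * h $ 1 + u22 * h $ 2)) (at x) \<Longrightarrow>
      b11 + b22 = 0 \<and> u11 + u22 = 0 \<and>
      (\<exists>p1 p2. (p has_derivative (\<lambda>h. p1 * h $ 1 + p2 * h $ 2)) (at x) \<and>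
         u1 x * u11 + u2 x * u12 - (b1 x * b11 + b2 x * b12) = - p1 \<and>
         u1 x * u21 + u2 x * u22 - (b1 x * b21 + b2 x * b22) = - p2)"
    and p_cont: "continuous_on (closure \<Omega>) p" and p_frontier: "\<And>x. x \<in> frontier \<Omega> \<Longrightarrow> p x = 0"
begin

abbreviation "S \<equiv> closure \<Omega> - {xs}"

text \<open>The factor in u = lam B, written as the projection of u on B so that its regularity
  follows from that of the fields.\<close>

definition lam :: "real^2 \<Rightarrow> real" where
  "lam x = (u1 x * b1 x + u2 x * b2 x) * inverse (b1 x * b1 x + b2 x * b2 x)"

lemma u_eq: assumes "x \<in> S" shows "u1 x = lam x * b1 x" "u2 x = lam x * b2 x"
proof -
  define N where "N = b1 x * b1 x + b2 x * b2 x"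
  have N: "N * inverse N = 1" using nz[OF assms] by (simp add: N_def)
  have p: "u1 x * b2 x = u2 x * b1 x" using parallel assms by blast
  have "lam x * b1 x = (u1 x * (b1 x * b1 x) + (u2 x * b1 x) * b2 x) * inverse N"
    by (simp add: lam_def N_def algebra_simps)
  also have "\<dots> = u1 x * (N * inverse N)" unfolding p[symmetric] by (simp add: N_def algebra_simps)
  finally show "u1 x = lam x * b1 x" using N by simp
  have "lam x * b2 x = ((u1 x * b2 x) * b1 x + u2 x * (b2 x * b2 x)) * inverse N"
    by (simp add: lam_def N_def algebra_simps)
  also have "\<dots> = u2 x * (N * inverse N)" unfolding p by (simp add: N_def algebra_simps)
  finally show "u2 x = lam x * b2 x" using N by simp
qed

lemma uu_eq: "x \<in> S \<Longrightarrow> u1 x * u1 x + u2 x * u2 x = (lam x * lam x) * (b1 x * b1 x + b2 x * b2 x)"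
  using u_eq[of x] by (simp add: algebra_simps)

lemma lam_ne: "x \<in> S \<Longrightarrow> 1 - lam x * lam x \<noteq> 0"
  using uu_eq[of x] ne[of x] by auto

lemma CkS: "Ck_on (Suc (Suc 0)) S b1" "Ck_on (Suc (Suc 0)) S b2"
  "Ck_on (Suc (Suc 0)) S u1" "Ck_on (Suc (Suc 0)) S u2"
  by (rule Ck_on_subset[OF Ck(1)] Ck_on_subset[OF Ck(2)] Ck_on_subset[OF Ck(3)] Ck_on_subset[OF Ck(4)]; blast)+

lemma lam_Ck: "Ck_on (Suc (Suc 0)) S lam"
  unfolding lam_def[abs_def]
  by (intro Ck_on_mult Ck_on_add Ck_on_inverse CkS) (use nz in auto)

text \<open>Deleting a point from a connected open planar set keeps it connected, and
  \<open>S\<close> lies between that set and its closure.\<close>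

lemma connected_S: "connected S"
proof -
  have "connected (\<Omega> - {xs})"
    using open_\<Omega> conn by (intro connected_open_delete) simp_all
  moreover have "S \<subseteq> closure (\<Omega> - {xs})"
  proof
    fix x assume x: "x \<in> S"
    have "x \<in> closure \<Omega>" "x \<noteq> xs" using x by auto
    show "x \<in> closure (\<Omega> - {xs})" unfolding closure_approachable
    proof (intro allI impI)
      fix e :: real assume "e > 0"
      then have "min e (dist x xs) > 0" using x by simp
      then obtain y where "y \<in> \<Omega>" "dist y x < min e (dist x xs)"
        using \<open>x \<in> closure \<Omega>\<close> closure_approachable by blast
      then show "\<exists>y\<in>\<Omega> - {xs}. dist y x < e" by (auto simp: dist_commute intro!: bexI[of _ y])
    qed
  qed
  moreover have "\<Omega> - {xs} \<subseteq> S" using closure_subset by blast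
  ultimately show ?thesis using connected_intermediate_closure by blast
qed

text \<open>The continuous function \<open>1 - lam x * lam x\<close> has no zero on the connected
  set \<open>S\<close>; \<open>eps\<close> is 1 if |u| < |B| throughout and -1 if |u| > |B|.\<close>

lemma sign_exists: "\<exists>eps. (eps = 1 \<or> eps = -1) \<and> (\<forall>x\<in>S. eps * (1 - lam x * lam x) > 0)"
proof (rule ccontr)
  assume no: "\<not> ?thesis"
  have "\<not> (\<forall>x\<in>S. 1 * (1 - lam x * lam x) > 0)" "\<not> (\<forall>x\<in>S. - 1 * (1 - lam x * lam x) > 0)"
    using no by blast+
  then obtain x y where "x \<in> S" "y \<in> S" "\<not> 1 - lam x * lam x > 0" "\<not> - (1 - lam y * lam y) > 0" by auto
  then have xy: "x \<in> S" "y \<in> S" "1 - lam x * lam x < 0" "1 - lam y * lam y > 0"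
    using lam_ne[of x] lam_ne[of y] by linarith+
  have "continuous_on S (\<lambda>x. 1 - lam x * lam x)"
    by (intro continuous_intros Ck_on_imp_continuous_on[OF lam_Ck])
  then have "connected ((\<lambda>x. 1 - lam x * lam x) ` S)" using connected_S by (rule connected_continuous_image)
  then have "{1 - lam x * lam x..1 - lam y * lam y} \<subseteq> (\<lambda>x. 1 - lam x * lam x) ` S"
    using xy by (intro connected_contains_Icc) auto
  moreover have "0 \<in> {1 - lam x * lam x..1 - lam y * lam y}" using xy by auto
  ultimately show False using lam_ne by fastforce
qed

theorem reduction:
  obtains sig om Q ks gA G K s0 where "euler_core \<Omega> A sig om Q ks gA G K xs s0"
    "\<And>x. x \<in> \<Omega> - {xs} \<Longrightarrow> (\<psi> has_derivative (\<lambda>h. lam x * (gA x \<bullet> h))) (at x)"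
proof -
  obtain eps where eps: "eps = 1 \<or> eps = -1" "\<And>x. x \<in> S \<Longrightarrow> eps * (1 - lam x * lam x) > 0"
    using sign_exists by blast
  define sig where "sig x = sqrt (eps * (1 + (-1) * (lam x * lam x)))" for x
  have sig_pos: "sig x > 0" if "x \<in> S" for x using eps(2)[OF that] by (simp add: sig_def)
  have sig_sq: "sig x * sig x = eps * (1 - lam x * lam x)" if "x \<in> S" for x
    using eps(2)[OF that] by (simp add: sig_def)
  have sig_Ck: "Ck_on (Suc (Suc 0)) S sig"
    unfolding sig_def[abs_def]
    by (intro Ck_on_sqrt Ck_on_mult Ck_on_add Ck_on_const lam_Ck) (use eps(2) in simp)
  obtain b11 b12 where b1: "Ck_on (Suc 0) S b11" "Ck_on (Suc 0) S b12"
    "\<And>x. x \<in> S \<Longrightarrow> (b1 has_derivative (\<lambda>h. b11 x * h $ 1 + b12 x * h $ 2)) (at x within S)"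
    using Ck_on_partials[OF CkS(1)] by blast
  obtain b21 b22 where b2: "Ck_on (Suc 0) S b21" "Ck_on (Suc 0) S b22"
    "\<And>x. x \<in> S \<Longrightarrow> (b2 has_derivative (\<lambda>h. b21 x * h $ 1 + b22 x * h $ 2)) (at x within S)"
    using Ck_on_partials[OF CkS(2)] by blast
  obtain l1 l2 where lm: "Ck_on (Suc 0) S l1" "Ck_on (Suc 0) S l2"
    "\<And>x. x \<in> S \<Longrightarrow> (lam has_derivative (\<lambda>h. l1 x * h $ 1 + l2 x * h $ 2)) (at x within S)"
    using Ck_on_partials[OF lam_Ck] by blast
  obtain s1 s2 where sg: "Ck_on (Suc 0) S s1" "Ck_on (Suc 0) S s2"
    "\<And>x. x \<in> S \<Longrightarrow> (sig has_derivative (\<lambda>h. s1 x * h $ 1 + s2 x * h $ 2)) (at x within S)"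
    using Ck_on_partials[OF sig_Ck] by blast
  have \<Omega>S: "x \<in> S" if "x \<in> \<Omega> - {xs}" for x using that closure_subset by blast
  have at_S: "at x within S = at x" if "x \<in> \<Omega> - {xs}" for x
    by (rule at_within_open_subset[OF that]) (use open_\<Omega> closure_subset in auto)
  have at_cl: "at x within closure \<Omega> = at x" if "x \<in> \<Omega>" for x
    by (rule at_within_open_subset[OF that open_\<Omega> closure_subset])
  define v11 where "v11 x = s1 x * b1 x + sig x * b11 x" for x
  define v12 where "v12 x = s2 x * b1 x + sig x * b12 x" for x
  define v21 where "v21 x = s1 x * b2 x + sig x * b21 x" for x
  define v22 where "v22 x = s2 x * b2 x + sig x * b22 x" for x
  have v1: "((\<lambda>x. sig x * b1 x) has_derivative (\<lambda>h. v11 x * h $ 1 + v12 x * h $ 2)) (at x within S)"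
    and v2: "((\<lambda>x. sig x * b2 x) has_derivative (\<lambda>h. v21 x * h $ 1 + v22 x * h $ 2)) (at x within S)"
    if "x \<in> S" for x
    unfolding v11_def v12_def v21_def v22_def using that by (intro partials_mult sg(3) b1(3) b2(3); simp)+
  have sigC: "Ck_on (Suc 0) S sig" and b1C: "Ck_on (Suc 0) S b1" and b2C: "Ck_on (Suc 0) S b2"
    using sig_Ck CkS Ck_on_SucD by blast+
  note cks = sigC b1C b2C b1(1,2) b2(1,2) sg(1,2)
  have vC: "Ck_on (Suc 0) S v11" "Ck_on (Suc 0) S v12" "Ck_on (Suc 0) S v21" "Ck_on (Suc 0) S v22"
    unfolding v11_def[abs_def] v12_def[abs_def] v21_def[abs_def] v22_def[abs_def]
    by (intro Ck_on_add Ck_on_mult cks)+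
  \<comment> \<open>The vorticity of this velocity; the sign is a constant factor to suit
    \<open>Ck_on_mult\<close>.\<close>
  define om where "om x = v21 x + (-1) * v12 x" for x
  have omC: "Ck_on (Suc 0) S om" unfolding om_def[abs_def]
    by (intro Ck_on_add Ck_on_mult Ck_on_const vC)
  define gA :: "real^2 \<Rightarrow> real^2" where "gA x = vector [b2 x, - b1 x]" for x
  define G :: "real^2 \<Rightarrow> real^2" where "G x = vector [sig x * b2 x, - (sig x * b1 x)]" for x
  \<comment> \<open>The derivative of \<open>G\<close>, the velocity after a quarter turn: its trace
    is \<open>om\<close>, and it is symmetric exactly when the velocity is divergence free.\<close>
  define K :: "real^2 \<Rightarrow> real^2 \<Rightarrow> real^2" where
    "K x h = vector [v21 x * h $ 1 + v22 x * h $ 2, - (v11 x * h $ 1 + v12 x * h $ 2)]" for x h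
  have gA_inner: "gA x \<bullet> h = b2 x * h $ 1 - b1 x * h $ 2" for x h
    by (simp add: gA_def inner_real2)
  \<comment> \<open>Kinetic energy plus the pressure \<open>- eps * p\<close> of the Euler
    flow.\<close>
  define Q where "Q x = (1/2) * ((sig x * b1 x) * (sig x * b1 x) + (sig x * b2 x) * (sig x * b2 x)) - eps * p x" for x
  have point: "v11 x + v22 x = 0 \<and> s1 x * b1 x + s2 x * b2 x = 0 \<and>
      (Q has_derivative (\<lambda>h. (om x * sig x) * (gA x \<bullet> h))) (at x)" if x: "x \<in> \<Omega> - {xs}" for x
  proof -
    have xS: "x \<in> S" by (rule \<Omega>S[OF x])
    note dB1 = b1(3)[OF xS, unfolded at_S[OF x]] and dB2 = b2(3)[OF xS, unfolded at_S[OF x]]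
      and dL = lm(3)[OF xS, unfolded at_S[OF x]] and dS = sg(3)[OF xS, unfolded at_S[OF x]]
    have op: "open (\<Omega> - {xs})" using open_\<Omega> by (rule open_delete)
    have dU1: "(u1 has_derivative (\<lambda>h. (l1 x * b1 x + lam x * b11 x) * h $ 1 + (l2 x * b1 x + lam x * b12 x) * h $ 2)) (at x)"
      by (rule has_derivative_transform_within_open[OF partials_mult[OF dL dB1] op x]) (use u_eq(1) \<Omega>S in auto)
    have dU2: "(u2 has_derivative (\<lambda>h. (l1 x * b2 x + lam x * b21 x) * h $ 1 + (l2 x * b2 x + lam x * b22 x) * h $ 2)) (at x)"
      by (rule has_derivative_transform_within_open[OF partials_mult[OF dL dB2] op x]) (use u_eq(2) \<Omega>S in auto)
    from pde[OF x dB1 dB2 dU1 dU2] obtain p1 p2 where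
      divB: "b11 x + b22 x = 0" and divU: "(l1 x * b1 x + lam x * b11 x) + (l2 x * b2 x + lam x * b22 x) = 0"
      and dp: "(p has_derivative (\<lambda>h. p1 * h $ 1 + p2 * h $ 2)) (at x)"
      and m1: "u1 x * (l1 x * b1 x + lam x * b11 x) + u2 x * (l2 x * b1 x + lam x * b12 x)
          - (b1 x * b11 x + b2 x * b12 x) = - p1"
      and m2: "u1 x * (l1 x * b2 x + lam x * b21 x) + u2 x * (l2 x * b2 x + lam x * b22 x)
          - (b1 x * b21 x + b2 x * b22 x) = - p2"
      by blast
    \<comment> \<open>Both fields are divergence free and u = lam B, so the derivative of
      \<open>lam\<close> along B vanishes.\<close>
    have "lam x * (b11 x + b22 x) = 0" using divB by simp
    then have lb: "l1 x * b1 x + l2 x * b2 x = 0" using divU by (simp add: algebra_simps)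
    \<comment> \<open>The derivative of \<open>sig * sig\<close> is computed in two ways; the
      comparison makes the gradients of \<open>sig\<close> and \<open>lam\<close> parallel, so
      \<open>sig\<close> too is constant along field lines.\<close>
    have "((\<lambda>x. sig x * sig x) has_derivative (\<lambda>h. (s1 x * sig x + sig x * s1 x) * h $ 1 +
        (s2 x * sig x + sig x * s2 x) * h $ 2)) (at x)"
      by (rule partials_mult[OF dS dS])
    moreover have "((\<lambda>x. sig x * sig x) has_derivative (\<lambda>h. (- eps * (l1 x * lam x + lam x * l1 x)) * h $ 1 +
        (- eps * (l2 x * lam x + lam x * l2 x)) * h $ 2)) (at x)"
    proof (rule has_derivative_transform_within_open[OF _ op x])
      have "((\<lambda>x. eps * (1 - lam x * lam x)) has_derivative (\<lambda>h. eps * (0 -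
         ((l1 x * lam x + lam x * l1 x) * h $ 1 + (l2 x * lam x + lam x * l2 x) * h $ 2)))) (at x)"
        by (intro derivative_intros partials_mult dL)
      then show "((\<lambda>x. eps * (1 - lam x * lam x)) has_derivative (\<lambda>h. (- eps * (l1 x * lam x + lam x * l1 x)) * h $ 1 +
        (- eps * (l2 x * lam x + lam x * l2 x)) * h $ 2)) (at x)"
        by (rule has_derivative_eq_rhs) (auto simp: algebra_simps)
    qed (use sig_sq \<Omega>S in auto)
    ultimately have e1: "s1 x * sig x + sig x * s1 x = - eps * (l1 x * lam x + lam x * l1 x)"
      and e2: "s2 x * sig x + sig x * s2 x = - eps * (l2 x * lam x + lam x * l2 x)"
      by (rule partials_unique)+
    have ss: "sig x * s1 x = - eps * lam x * l1 x" "sig x * s2 x = - eps * lam x * l2 x"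
      using e1 e2 by algebra+
    have "sig x * (s1 x * b1 x + s2 x * b2 x) = (sig x * s1 x) * b1 x + (sig x * s2 x) * b2 x"
      by (simp add: algebra_simps)
    also have "\<dots> = - eps * lam x * (l1 x * b1 x + l2 x * b2 x)" unfolding ss by (simp add: algebra_simps)
    also have "\<dots> = 0" using lb by simp
    finally have sb: "s1 x * b1 x + s2 x * b2 x = 0" using sig_pos[OF xS] by simp
    have "v11 x + v22 x = (s1 x * b1 x + s2 x * b2 x) + sig x * (b11 x + b22 x)"
      by (simp add: v11_def v22_def algebra_simps)
    then have div: "v11 x + v22 x = 0" using sb divB by simp
    note dV1 = v1[OF xS, unfolded at_S[OF x]] and dV2 = v2[OF xS, unfolded at_S[OF x]]
    let ?v1 = "sig x * b1 x" and ?v2 = "sig x * b2 x"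
    have "(Q has_derivative (\<lambda>h. (1/2) * (((v11 x * ?v1 + ?v1 * v11 x) * h $ 1 + (v12 x * ?v1 + ?v1 * v12 x) * h $ 2)
        + ((v21 x * ?v2 + ?v2 * v21 x) * h $ 1 + (v22 x * ?v2 + ?v2 * v22 x) * h $ 2))
        - eps * (p1 * h $ 1 + p2 * h $ 2))) (at x)"
      unfolding Q_def[abs_def] by (intro has_derivative_diff has_derivative_mult_right has_derivative_add partials_mult dV1 dV2 dp)
    moreover have Q1: "?v1 * v11 x + ?v2 * v21 x - eps * p1 = om x * sig x * b2 x"
    proof -
      have "(sig x * b1 x) * (s1 x * b1 x + sig x * b11 x) + (sig x * b2 x) * (s1 x * b2 x + sig x * b21 x) - eps * p1
        = ((s1 x * b2 x + sig x * b21 x) - (s2 x * b1 x + sig x * b12 x)) * sig x * b2 x"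
      proof (rule pressure_identity[OF sig_sq[OF xS] sb lb])
        show "(lam x * b1 x) * (lam x * b11 x + l1 x * b1 x) + (lam x * b2 x) * (lam x * b12 x + l2 x * b1 x)
           - (b1 x * b11 x + b2 x * b12 x) = - p1"
          using m1 unfolding u_eq[OF xS] by (simp add: algebra_simps)
      qed
      then show ?thesis by (simp add: om_def v11_def v21_def v12_def)
    qed
    moreover have Q2: "?v1 * v12 x + ?v2 * v22 x - eps * p2 = - (om x * sig x * b1 x)"
    proof -
      have "(sig x * b2 x) * (s2 x * b2 x + sig x * b22 x) + (sig x * b1 x) * (s2 x * b1 x + sig x * b12 x) - eps * p2
        = ((s2 x * b1 x + sig x * b12 x) - (s1 x * b2 x + sig x * b21 x)) * sig x * b1 x"
      proof (rule pressure_identity[OF sig_sq[OF xS]])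
        show "s2 x * b2 x + s1 x * b1 x = 0" "l2 x * b2 x + l1 x * b1 x = 0" using sb lb by simp_all
        show "(lam x * b2 x) * (lam x * b22 x + l2 x * b2 x) + (lam x * b1 x) * (lam x * b21 x + l1 x * b2 x)
           - (b2 x * b22 x + b1 x * b21 x) = - p2"
          using m2 unfolding u_eq[OF xS] by (simp add: algebra_simps)
      qed
      then show ?thesis by (simp add: om_def v21_def v12_def v22_def algebra_simps)
    qed
    have "(\<lambda>h. (1/2) * (((v11 x * ?v1 + ?v1 * v11 x) * h $ 1 + (v12 x * ?v1 + ?v1 * v12 x) * h $ 2)
        + ((v21 x * ?v2 + ?v2 * v21 x) * h $ 1 + (v22 x * ?v2 + ?v2 * v22 x) * h $ 2))
        - eps * (p1 * h $ 1 + p2 * h $ 2)) = (\<lambda>h::real^2. (om x * sig x) * (gA x \<bullet> h))"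
    proof
      fix h :: "real^2"
      have "(1/2) * (((v11 x * ?v1 + ?v1 * v11 x) * h $ 1 + (v12 x * ?v1 + ?v1 * v12 x) * h $ 2)
        + ((v21 x * ?v2 + ?v2 * v21 x) * h $ 1 + (v22 x * ?v2 + ?v2 * v22 x) * h $ 2))
        - eps * (p1 * h $ 1 + p2 * h $ 2)
        = (?v1 * v11 x + ?v2 * v21 x - eps * p1) * h $ 1 + (?v1 * v12 x + ?v2 * v22 x - eps * p2) * h $ 2"
        by (simp add: field_simps)
      also have "\<dots> = (om x * sig x) * (gA x \<bullet> h)" unfolding Q1 Q2 gA_inner by (simp add: algebra_simps)
      finally show "(1/2) * (((v11 x * ?v1 + ?v1 * v11 x) * h $ 1 + (v12 x * ?v1 + ?v1 * v12 x) * h $ 2)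
        + ((v21 x * ?v2 + ?v2 * v21 x) * h $ 1 + (v22 x * ?v2 + ?v2 * v22 x) * h $ 2))
        - eps * (p1 * h $ 1 + p2 * h $ 2) = (om x * sig x) * (gA x \<bullet> h)" .
    qed
    ultimately show ?thesis using div sb by simp
  qed
  \<comment> \<open>The Hessian has to be symmetric on the frontier as well, so the divergence
    condition is carried there by continuity.\<close>
  have div: "v11 x + v22 x = 0" if "x \<in> S" for x
  proof (cases "x \<in> \<Omega>")
    case False
    have "x \<in> closure \<Omega>" using that by simp
    then obtain X where X: "\<And>n. X n \<in> \<Omega>" "X \<longlonglongrightarrow> x" using closure_sequential by blast
    have cont: "continuous_on S (\<lambda>x. v11 x + v22 x)"
      by (intro continuous_intros Ck_on_imp_continuous_on[OF vC(1)] Ck_on_imp_continuous_on[OF vC(4)])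
    have "\<forall>\<^sub>F n in sequentially. X n \<in> - {xs}"
      by (rule topological_tendstoD[OF X(2)]) (use that in auto)
    then have ev: "\<forall>\<^sub>F n in sequentially. X n \<in> \<Omega> - {xs}" by eventually_elim (use X in auto)
    then have "\<forall>\<^sub>F n in sequentially. X n \<in> S" by eventually_elim (rule \<Omega>S)
    then have "(\<lambda>n. v11 (X n) + v22 (X n)) \<longlonglongrightarrow> v11 x + v22 x"
      by (rule continuous_on_tendsto_compose[OF cont X(2) that])
    moreover have "\<forall>\<^sub>F n in sequentially. v11 (X n) + v22 (X n) = 0" using ev by eventually_elim (use point in blast)
    then have "(\<lambda>n. v11 (X n) + v22 (X n)) \<longlonglongrightarrow> 0" by (rule tendsto_eventually)
    ultimately show ?thesis using LIMSEQ_unique by blast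
  qed (use that point in blast)
  \<comment> \<open>The gradient of \<open>sig\<close> is orthogonal to B and hence a multiple of
    \<open>gA\<close>; \<open>ks\<close> is the coefficient, found by projecting on
    \<open>gA\<close>.\<close>
  define ks where "ks x = (s1 x * b2 x - s2 x * b1 x) / (b1 x * b1 x + b2 x * b2 x)" for x
  have gA_nz: "gA x \<noteq> 0" if "x \<in> S" for x
    using nz[OF that] by (auto simp: gA_def vec_eq_iff forall_2)
  show thesis
  proof (rule that)
    show "euler_core \<Omega> A sig om Q ks gA G K xs (sqrt (eps * (1 - l)))"
    proof
      show "(A has_derivative (\<lambda>h. gA x \<bullet> h)) (at x within closure \<Omega>)" if "x \<in> closure \<Omega>" for x
        using gradA[OF that] by (simp add: gA_inner)
      show "continuous_on S gA"
        unfolding gA_def[abs_def]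
        using Ck_on_imp_continuous_on[OF b1C] Ck_on_imp_continuous_on[OF b2C]
        by (subst continuous_on_componentwise) (simp add: Basis_real2 inner_axis continuous_on_minus)
      show "continuous_on S sig" by (rule Ck_on_imp_continuous_on[OF sigC])
      show "(sig \<longlongrightarrow> sqrt (eps * (1 - l))) (at xs)"
      proof (rule Lim_transform_eventually)
        show "((\<lambda>x. sqrt (eps * (1 - (u1 x * u1 x + u2 x * u2 x) / (b1 x * b1 x + b2 x * b2 x)))) \<longlongrightarrow>
            sqrt (eps * (1 - l))) (at xs)"
          by (intro tendsto_intros lim)
        have "\<forall>\<^sub>F x in at xs. x \<in> \<Omega>" using open_\<Omega> xs by (rule eventually_at_in_open')
        moreover have "\<forall>\<^sub>F x in at xs. x \<noteq> xs" by (simp add: eventually_at_filter)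
        ultimately show "\<forall>\<^sub>F x in at xs. sqrt (eps * (1 - (u1 x * u1 x + u2 x * u2 x) / (b1 x * b1 x + b2 x * b2 x))) = sig x"
        proof eventually_elim
          case (elim x)
          then have xS: "x \<in> S" using \<Omega>S by blast
          show ?case unfolding uu_eq[OF xS] using nz[OF xS] by (simp add: sig_def)
        qed
      qed
      show "(sig has_derivative (\<lambda>h. ks x * (gA x \<bullet> h))) (at x)" if x: "x \<in> \<Omega> - {xs}" for x
      proof (rule has_derivative_eq_rhs[OF sg(3)[OF \<Omega>S[OF x], unfolded at_S[OF x]]], rule ext)
        fix h :: "real^2"
        have n: "b1 x * b1 x + b2 x * b2 x \<noteq> 0" by (rule nz[OF \<Omega>S[OF x]])
        have sb: "s1 x * b1 x + s2 x * b2 x = 0" using point[OF x] by blast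
        have "(s1 x * b2 x - s2 x * b1 x) * b2 x = s1 x * (b1 x * b1 x + b2 x * b2 x) - b1 x * (s1 x * b1 x + s2 x * b2 x)"
          by (simp add: algebra_simps)
        then have "(s1 x * b2 x - s2 x * b1 x) * b2 x = s1 x * (b1 x * b1 x + b2 x * b2 x)" unfolding sb by simp
        then have "ks x * b2 x = s1 x * (b1 x * b1 x + b2 x * b2 x) / (b1 x * b1 x + b2 x * b2 x)" by (simp add: ks_def)
        then have k1: "ks x * b2 x = s1 x" by (simp only: nonzero_mult_div_cancel_right[OF n])
        have "(s1 x * b2 x - s2 x * b1 x) * b1 x = b2 x * (s1 x * b1 x + s2 x * b2 x) - s2 x * (b1 x * b1 x + b2 x * b2 x)"
          by (simp add: algebra_simps)
        then have "(s1 x * b2 x - s2 x * b1 x) * b1 x = - s2 x * (b1 x * b1 x + b2 x * b2 x)" unfolding sb by simp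
        then have "ks x * b1 x = - s2 x * (b1 x * b1 x + b2 x * b2 x) / (b1 x * b1 x + b2 x * b2 x)" by (simp add: ks_def)
        then have k2: "ks x * b1 x = - s2 x" by (simp only: nonzero_mult_div_cancel_right[OF n])
        have "ks x * (gA x \<bullet> h) = (ks x * b2 x) * h $ 1 - (ks x * b1 x) * h $ 2"
          by (simp add: gA_inner algebra_simps)
        then show "s1 x * h $ 1 + s2 x * h $ 2 = ks x * (gA x \<bullet> h)" unfolding k1 k2 by simp
      qed
      show "G x = sig x *\<^sub>R gA x" for x by (simp add: G_def gA_def vec_eq_iff forall_2)
      show "(G has_derivative K x) (at x within S)" if "x \<in> S" for x
        unfolding G_def[abs_def] K_def[abs_def]
        by (intro has_derivative_vector2 has_derivative_minus v1 v2 that)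
      show "K x h \<bullet> k = h \<bullet> K x k" if "x \<in> S" for x h k
      proof -
        have "v22 x = - v11 x" using div[OF that] by simp
        then show ?thesis by (simp add: K_def inner_real2 algebra_simps)
      qed
      show "om x = (\<Sum>i\<in>Basis. K x i \<bullet> i)" for x
        by (simp add: sum_Basis_real2 inner_real2 K_def om_def axis_def)
      show "Ck_on (Suc 0) S om" by (rule omC)
      show "continuous_on S Q" unfolding Q_def[abs_def]
        by (intro continuous_intros Ck_on_imp_continuous_on[OF b1C] Ck_on_imp_continuous_on[OF b2C]
            Ck_on_imp_continuous_on[OF sigC] continuous_on_subset[OF p_cont]) auto
      show "(Q has_derivative (\<lambda>h. (om x * sig x) * (gA x \<bullet> h))) (at x)" if "x \<in> \<Omega> - {xs}" for x
        using point[OF that] by blast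
      show "Q x = (norm (G x))\<^sup>2 / 2" if "x \<in> frontier \<Omega>" for x
        using p_frontier[OF that] unfolding power2_norm_eq_inner by (simp add: Q_def G_def inner_real2)
    qed (use open_\<Omega> conn bdd compl C1 xs zeroA pos_xs gA_nz sig_pos in auto)
    show "(\<psi> has_derivative (\<lambda>h. lam x * (gA x \<bullet> h))) (at x)" if x: "x \<in> \<Omega> - {xs}" for x
    proof -
      have "x \<in> closure \<Omega>" using x closure_subset by blast
      from grad\<psi>[OF this] have "(\<psi> has_derivative (\<lambda>h. u2 x * h $ 1 - u1 x * h $ 2)) (at x)"
        using at_cl[of x] x by simp
      then show ?thesis unfolding u_eq[OF \<Omega>S[OF x]] by (simp add: gA_inner algebra_simps)
    qed
  qed
qed

text \<open>The gradient of \<psi> is \<open>lam\<close> times that of \<open>A\<close>, so \<psi>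
  is constant on the levels of \<open>A\<close>, the frontier included, and inherits the symmetry of
  \<open>A\<close>.\<close>

theorem radial_symmetry:
  shows "dist x xs = dist y xs \<Longrightarrow> x \<in> \<Omega> \<longleftrightarrow> y \<in> \<Omega>"
    and "dist x xs = dist y xs \<Longrightarrow> x \<in> closure \<Omega> \<Longrightarrow> y \<in> closure \<Omega> \<Longrightarrow> A x = A y \<and> \<psi> x = \<psi> y"
proof -
  obtain sig om Q ks gA G K s0 where ec: "euler_core \<Omega> A sig om Q ks gA G K xs s0"
    and d\<psi>: "\<And>x. x \<in> \<Omega> - {xs} \<Longrightarrow> (\<psi> has_derivative (\<lambda>h. lam x * (gA x \<bullet> h))) (at x)"
    using reduction by blast
  interpret E: euler_core \<Omega> A sig om Q ks gA G K xs s0 by (rule ec)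
  show "dist x xs = dist y xs \<Longrightarrow> x \<in> \<Omega> \<longleftrightarrow> y \<in> \<Omega>" by (rule E.radial_domain)
  assume xy: "dist x xs = dist y xs" "x \<in> closure \<Omega>" "y \<in> closure \<Omega>"
  have A: "A x = A y" by (rule E.radial_A[OF xy])
  have "continuous_on (closure \<Omega>) \<psi>"
    using grad\<psi> has_derivative_continuous continuous_on_eq_continuous_within by blast
  then have "continuous_on S \<psi>" by (rule continuous_on_subset) auto
  from E.constant_on_closure_level[OF d\<psi> this xy(2,3) A] have "\<psi> x = \<psi> y" .
  with A show "A x = A y \<and> \<psi> x = \<psi> y" ..
qed

end

section \<open>From radial symmetry to the disk\<close>

text \<open>The set of distances from the centre is an interval starting at 0 by connectedness,
  bounded, and without a largest element by openness.\<close>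

lemma radial_open_set_is_ball:
  fixes \<Omega> :: "'a::euclidean_space set"
  assumes "open \<Omega>" "connected \<Omega>" "bounded \<Omega>" "c \<in> \<Omega>"
    and rad: "\<And>x y. dist x c = dist y c \<Longrightarrow> x \<in> \<Omega> \<longleftrightarrow> y \<in> \<Omega>"
  obtains R where "R > 0" "\<Omega> = ball c R"
proof -
  define D where "D = (\<lambda>x. dist x c) ` \<Omega>"
  define R where "R = Sup D"
  obtain r where r: "r > 0" "ball c r \<subseteq> \<Omega>" using assms(1,4) openE by blast
  obtain b where "\<And>x. x \<in> \<Omega> \<Longrightarrow> dist c x \<le> b" using assms(3) bounded_any_center[of \<Omega> c] by blast
  then have bdd: "bdd_above D" by (auto simp: D_def bdd_above_def dist_commute)
  have le: "dist x c \<le> R" if "x \<in> \<Omega>" for x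
    unfolding R_def by (rule cSup_upper[OF _ bdd]) (use that in \<open>simp add: D_def\<close>)
  have further: "\<exists>y\<in>\<Omega>. dist y c > dist x c" if x: "x \<in> \<Omega>" for x
  proof -
    obtain d where d: "d > 0" "ball x d \<subseteq> \<Omega>" using assms(1) x openE by blast
    obtain i :: 'a where i: "i \<in> Basis" using nonempty_Basis by blast
    \<comment> \<open>The outward direction; at the centre itself any unit vector will do.\<close>
    define v where "v = (if x = c then i else (1 / norm (x - c)) *\<^sub>R (x - c))"
    have v: "norm v = 1" using i by (simp add: v_def)
    let ?y = "x + (d/2) *\<^sub>R v"
    have "dist x ?y = d/2" using v d by (simp add: dist_norm)
    then have "?y \<in> \<Omega>" using d by (intro subsetD[OF d(2)]) simp
    moreover have "dist ?y c = dist x c + d/2"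
    proof (cases "x = c")
      case True
      then show ?thesis using v d by (simp add: dist_norm)
    next
      case False
      have "?y - c = (x - c) + (d/2) *\<^sub>R v" by simp
      also have "\<dots> = (1 + d/2 / norm (x - c)) *\<^sub>R (x - c)"
        using False by (simp add: v_def scaleR_add_left)
      finally have "?y - c = (1 + d/2 / norm (x - c)) *\<^sub>R (x - c)" .
      then have "norm (?y - c) = (1 + d/2 / norm (x - c)) * norm (x - c)" using d by simp
      then show ?thesis using False by (simp add: dist_norm algebra_simps)
    qed
    ultimately show ?thesis using d by (intro bexI[of _ ?y]) auto
  qed
  have "\<Omega> = ball c R"
  proof (intro equalityI subsetI)
    fix x assume "x \<in> \<Omega>"
    then obtain y where "y \<in> \<Omega>" "dist y c > dist x c" using further by blast
    then show "x \<in> ball c R" using le[of y] by (simp add: dist_commute)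
  next
    fix x assume "x \<in> ball c R"
    then have "dist x c < Sup D" by (simp add: R_def dist_commute)
    then obtain y where y: "y \<in> \<Omega>" "dist y c > dist x c"
      using less_cSup_iff[OF _ bdd, of "dist x c"] assms(4) by (auto simp: D_def)
    have "connected D" unfolding D_def by (intro connected_continuous_image continuous_intros assms)
    moreover have "dist c c \<in> D" "dist y c \<in> D" using y assms(4) by (auto simp: D_def simp del: dist_self)
    ultimately have "{dist c c..dist y c} \<subseteq> D" by (rule connected_contains_Icc)
    then have "dist x c \<in> D" using y by auto
    then obtain w where "w \<in> \<Omega>" "dist x c = dist w c" by (auto simp: D_def)
    then show "x \<in> \<Omega>" using rad by blast
  qed
  moreover have "R > 0"
  proof -
    obtain y where y: "y \<in> \<Omega>" "dist y c > dist c c" using further[OF assms(4)] by blast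
    then show ?thesis using le[OF y(1)] zero_le_dist[of c c] by linarith
  qed
  ultimately show thesis using that by blast
qed

section \<open>Translation of the hypotheses into components\<close>

lemma frechet_derivative_components:
  fixes w :: "real^2 \<Rightarrow> real^2"
  assumes "((\<lambda>x. w x $ 1) has_derivative (\<lambda>h. a * h $ 1 + b * h $ 2)) (at x)"
    and "((\<lambda>x. w x $ 2) has_derivative (\<lambda>h. c * h $ 1 + d * h $ 2)) (at x)"
  shows "frechet_derivative w (at x) = (\<lambda>h. vector [a * h $ 1 + b * h $ 2, c * h $ 1 + d * h $ 2])"
proof -
  have "((\<lambda>x. vector [w x $ 1, w x $ 2] :: real^2) has_derivative
      (\<lambda>h. vector [a * h $ 1 + b * h $ 2, c * h $ 1 + d * h $ 2])) (at x)"
    by (rule has_derivative_vector2[OF assms])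
  moreover have "(\<lambda>x. vector [w x $ 1, w x $ 2] :: real^2) = w"
    by (rule ext) (simp add: vec_eq_iff forall_2)
  ultimately have d: "(w has_derivative (\<lambda>h. vector [a * h $ 1 + b * h $ 2, c * h $ 1 + d * h $ 2])) (at x)" by simp
  show ?thesis by (rule frechet_derivative_at[OF d, symmetric])
qed

lemma stream_function_derivative:
  assumes "is_stream_function S f v" "x \<in> S"
  shows "(f has_derivative (\<lambda>h. v x $ 2 * h $ 1 - v x $ 1 * h $ 2)) (at x within S)"
proof -
  have d: "f differentiable (at x within S)" and v: "v x = perp (grad f (at x within S))"
    using assms by (auto simp: is_stream_function_def)
  show ?thesis
    by (rule has_derivative_eq_rhs[OF has_derivative_grad[OF d]]) (simp add: v perp_def inner_real2)
qed

theorem theorem2: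
  fixes k :: nat
    and \<Omega> :: "(real^2) set"
    and u B :: "real^2 \<Rightarrow> real^2"
    and \<psi> A p :: "real^2 \<Rightarrow> real"
    and xstar :: "real^2"
    and \<mu> :: "real \<Rightarrow> real"
    and l :: real
  assumes "k \<ge> 4"
    and "open \<Omega>" "connected \<Omega>" "\<Omega> \<noteq> {}" "bounded \<Omega>" "simply_connected \<Omega>" "C1_boundary \<Omega>"
    and "is_stream_function (closure \<Omega>) \<psi> u"
    and "is_stream_function (closure \<Omega>) A B"
    and "\<forall>x\<in>frontier \<Omega>. A x = 0"
    and "steady_free_boundary_MHD k \<Omega> u B p"
    and "xstar \<in> \<Omega>" "B xstar = 0" "\<forall>x\<in>closure \<Omega> - {xstar}. B x \<noteq> 0"
    and "\<forall>a\<in>A ` closure \<Omega> - {A xstar}. \<mu> a = travel_time \<Omega> A a"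
    and "times_differentiable_on k (A ` closure \<Omega>) \<mu>"
    and "\<forall>x\<in>closure \<Omega> - {xstar}. norm (B x) \<noteq> norm (u x)"
    and "((\<lambda>x. norm (u x) / norm (B x)) \<longlongrightarrow> l) (at xstar)" "l \<noteq> 1"
  shows "\<exists>c R. R > 0 \<and> (\<lambda>x. x - c) ` \<Omega> = ball 0 R \<and>
           measure lborel (ball (0::real^2) R) = measure lborel \<Omega> \<and>
           (\<exists>\<alpha> \<beta> :: real \<Rightarrow> real.
              \<forall>x\<in>closure \<Omega>. A x = \<alpha> (dist x c) \<and> \<psi> x = \<beta> (dist x c))"
proof -
  note \<Omega> = assms(2,3,5)
  have sub: "\<Omega> \<subseteq> closure \<Omega>" by (rule closure_subset)
  have at_cl: "at x within closure \<Omega> = at x" if "x \<in> \<Omega>" for x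
    by (rule at_within_open_subset[OF that \<Omega>(1) sub])
  note mhd = assms(11)[unfolded steady_free_boundary_MHD_def]
  have Ck2: "Ck_on (Suc (Suc 0)) (closure \<Omega>) (\<lambda>x. w x $ i)" if "Ck_on k (closure \<Omega>) w"
    for w :: "real^2 \<Rightarrow> real^2" and i
    by (rule Ck_on_bounded_linear[OF bounded_linear_vec_nth]) (rule Ck_on_le[OF that], use assms(1) in simp)
  have CB: "Ck_on (Suc (Suc 0)) (closure \<Omega>) (\<lambda>x. B x $ i)"
    and CU: "Ck_on (Suc (Suc 0)) (closure \<Omega>) (\<lambda>x. u x $ i)" for i
    using mhd by (blast intro: Ck2)+
  have partials: "\<exists>a b. ((\<lambda>x. w x $ i) has_derivative (\<lambda>h. a * h $ 1 + b * h $ 2)) (at x)"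
    if C: "Ck_on (Suc (Suc 0)) (closure \<Omega>) (\<lambda>x. w x $ i)" and x: "x \<in> \<Omega>" for w :: "real^2 \<Rightarrow> real^2" and i x
  proof -
    obtain f1 f2 where "\<And>x. x \<in> closure \<Omega> \<Longrightarrow>
        ((\<lambda>x. w x $ i) has_derivative (\<lambda>h. f1 x * h $ 1 + f2 x * h $ 2)) (at x within closure \<Omega>)"
      using Ck_on_partials[OF C] by blast
    from this[of x] show ?thesis using at_cl[OF x] x sub by auto
  qed
  \<comment> \<open>For divergence free fields, \<open>advect u B - advect B u\<close> is the
    perpendicular gradient of the cross product of u and B.\<close>
  have cross_grad: "((\<lambda>x. u x $ 1 * B x $ 2 - u x $ 2 * B x $ 1) has_derivative (\<lambda>h. 0)) (at x)"
    if x: "x \<in> \<Omega>" for x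
  proof -
    obtain b11 b12 where B1: "((\<lambda>x. B x $ 1) has_derivative (\<lambda>h. b11 * h $ 1 + b12 * h $ 2)) (at x)"
      using partials[OF CB x] by blast
    obtain b21 b22 where B2: "((\<lambda>x. B x $ 2) has_derivative (\<lambda>h. b21 * h $ 1 + b22 * h $ 2)) (at x)"
      using partials[OF CB x] by blast
    obtain u11 u12 where U1: "((\<lambda>x. u x $ 1) has_derivative (\<lambda>h. u11 * h $ 1 + u12 * h $ 2)) (at x)"
      using partials[OF CU x] by blast
    obtain u21 u22 where U2: "((\<lambda>x. u x $ 2) has_derivative (\<lambda>h. u21 * h $ 1 + u22 * h $ 2)) (at x)"
      using partials[OF CU x] by blast
    note FB = frechet_derivative_components[OF B1 B2] and FU = frechet_derivative_components[OF U1 U2]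
    have "advect u B x - advect B u x = 0" "divergence B x = 0" "divergence u x = 0" using mhd x by auto
    then have ind: "b11 * u x $ 1 + b12 * u x $ 2 = u11 * B x $ 1 + u12 * B x $ 2"
        "b21 * u x $ 1 + b22 * u x $ 2 = u21 * B x $ 1 + u22 * B x $ 2"
      and div: "b22 = - b11" "u22 = - u11"
      by (auto simp: advect_def divergence_def FB FU vec_eq_iff forall_2 UNIV_2 axis_def)
    have "((\<lambda>x. u x $ 1 * B x $ 2 - u x $ 2 * B x $ 1) has_derivative
      (\<lambda>h. ((u11 * B x $ 2 + u x $ 1 * b21) * h $ 1 + (u12 * B x $ 2 + u x $ 1 * b22) * h $ 2)
         - ((u21 * B x $ 1 + u x $ 2 * b11) * h $ 1 + (u22 * B x $ 1 + u x $ 2 * b12) * h $ 2))) (at x)"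
      by (intro has_derivative_diff partials_mult B1 B2 U1 U2)
    moreover have "u11 * B x $ 2 + u x $ 1 * b21 = u21 * B x $ 1 + u x $ 2 * b11"
      using ind(2) div by (simp add: algebra_simps)
    moreover have "u12 * B x $ 2 + u x $ 1 * b22 = u22 * B x $ 1 + u x $ 2 * b12"
      using ind(1) div by (simp add: algebra_simps)
    ultimately show ?thesis by simp
  qed
  have cross_\<Omega>: "u x $ 1 * B x $ 2 - u x $ 2 * B x $ 1 = 0" if x: "x \<in> \<Omega>" for x
  proof -
    have "u x $ 1 * B x $ 2 - u x $ 2 * B x $ 1 = u xstar $ 1 * B xstar $ 2 - u xstar $ 2 * B xstar $ 1"
      by (rule has_derivative_zero_unique_connected[OF \<Omega>(1,2) cross_grad x assms(12)])
    then show ?thesis by (simp add: assms(13))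
  qed
  have cross: "u x $ 1 * B x $ 2 = u x $ 2 * B x $ 1" if "x \<in> closure \<Omega>" for x
  proof -
    have "continuous_on (closure \<Omega>) (\<lambda>x. u x $ 1 * B x $ 2 - u x $ 2 * B x $ 1)"
      by (intro continuous_intros Ck_on_imp_continuous_on[OF CB] Ck_on_imp_continuous_on[OF CU])
    from continuous_constant_on_closure[OF this cross_\<Omega> that] show ?thesis by simp
  qed
  \<comment> \<open>Otherwise both extreme values of \<open>A\<close> over the closure would be 0,
    since an extremum inside \<Omega> occurs at \<open>xstar\<close> only; \<open>A\<close> would be
    constant and B would vanish on \<Omega>.\<close>
  have A_xstar: "A xstar \<noteq> 0"
  proof
    assume A0: "A xstar = 0"
    have dA: "(A has_derivative (\<lambda>h. B x $ 2 * h $ 1 - B x $ 1 * h $ 2)) (at x)" if "x \<in> \<Omega>" for x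
      using stream_function_derivative[OF assms(9), of x] at_cl[OF that] that sub by auto
    have crit: False if x: "x \<in> \<Omega>" "x \<noteq> xstar"
      and ext: "(\<forall>y\<in>\<Omega>. A y \<le> A x) \<or> (\<forall>y\<in>\<Omega>. A x \<le> A y)" for x
    proof -
      have "(\<lambda>h::real^2. B x $ 2 * h $ 1 - B x $ 1 * h $ 2) = (\<lambda>h. 0)"
        by (rule differential_zero_maxmin[OF x(1) \<Omega>(1) dA[OF x(1)] ext])
      from fun_cong[OF this, of "axis 1 1"] fun_cong[OF this, of "axis 2 1"]
      have "B x = 0" by (simp add: axis_def vec_eq_iff forall_2)
      then show False using assms(14) x sub by blast
    qed
    have cA: "continuous_on (closure \<Omega>) A"
      using stream_function_derivative[OF assms(9)] has_derivative_continuous continuous_on_eq_continuous_within by blast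
    have cpt: "compact (closure \<Omega>)" "closure \<Omega> \<noteq> {}" using \<Omega>(3) assms(4) by auto
    obtain M where M: "M \<in> closure \<Omega>" "\<And>y. y \<in> closure \<Omega> \<Longrightarrow> A y \<le> A M"
      using continuous_attains_sup[OF cpt cA] by blast
    obtain m where m: "m \<in> closure \<Omega>" "\<And>y. y \<in> closure \<Omega> \<Longrightarrow> A m \<le> A y"
      using continuous_attains_inf[OF cpt cA] by blast
    have fr: "x \<in> \<Omega> \<or> A x = 0" if "x \<in> closure \<Omega>" for x
      using that assms(10) \<Omega>(1) by (auto simp: frontier_def interior_open)
    have "A M = 0" using fr[OF M(1)] crit[of M] M(2) A0 sub by blast
    moreover have "A m = 0" using fr[OF m(1)] crit[of m] m(2) A0 sub by blast
    ultimately have zero: "A y = 0" if "y \<in> \<Omega>" for y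
      using M(2)[of y] m(2)[of y] that sub by force
    have "\<Omega> \<noteq> {xstar}" using \<Omega>(1) not_open_singleton by metis
    then obtain y where "y \<in> \<Omega>" "y \<noteq> xstar" using assms(12) by blast
    then show False using crit[of y] zero by simp
  qed
  \<comment> \<open>Multiplying \<open>A\<close> and B by this sign makes \<open>xstar\<close> a
    maximum; the momentum equation is quadratic in B and does not change.\<close>
  define s where "s = sgn (A xstar)"
  have s: "s * s = 1" "s \<noteq> 0" "s * A xstar > 0" using A_xstar by (auto simp: s_def sgn_if)
  have ss: "s * (s * t) = t" for t
    unfolding mult.assoc[symmetric] s(1) by simp
  have norm2: "(norm w)\<^sup>2 = w $ 1 * w $ 1 + w $ 2 * w $ 2" for w :: "real^2"
    unfolding power2_norm_eq_inner by (simp add: inner_real2)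
  have sB: "(s * B x $ 1) * (s * B x $ 1) + (s * B x $ 2) * (s * B x $ 2) = (norm (B x))\<^sup>2" for x
  proof -
    have "(s * B x $ 1) * (s * B x $ 1) + (s * B x $ 2) * (s * B x $ 2)
        = (s * s) * (B x $ 1 * B x $ 1 + B x $ 2 * B x $ 2)" by (simp add: algebra_simps)
    then show ?thesis using s(1) by (simp add: norm2)
  qed
  interpret mhd_core \<Omega> "\<lambda>x. s * A x" \<psi> "\<lambda>x. s * B x $ 1" "\<lambda>x. s * B x $ 2"
    "\<lambda>x. u x $ 1" "\<lambda>x. u x $ 2" p xstar "l\<^sup>2"
  proof
    show "connected (- \<Omega>)" by (rule connected_Compl_of_simply_connected[OF \<Omega>(1,3) assms(6)])
    show "((\<lambda>x. s * A x) has_derivative (\<lambda>h. s * B x $ 2 * h $ 1 - s * B x $ 1 * h $ 2)) (at x within closure \<Omega>)"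
      if "x \<in> closure \<Omega>" for x
      by (rule has_derivative_eq_rhs[OF has_derivative_mult_right[OF stream_function_derivative[OF assms(9) that]]])
         (simp add: algebra_simps)
    show "(\<psi> has_derivative (\<lambda>h. u x $ 2 * h $ 1 - u x $ 1 * h $ 2)) (at x within closure \<Omega>)"
      if "x \<in> closure \<Omega>" for x by (rule stream_function_derivative[OF assms(8) that])
    show "Ck_on (Suc (Suc 0)) (closure \<Omega>) (\<lambda>x. s * B x $ 1)" "Ck_on (Suc (Suc 0)) (closure \<Omega>) (\<lambda>x. s * B x $ 2)"
      by (intro Ck_on_mult Ck_on_const CB)+
    show "u x $ 1 * (s * B x $ 2) = u x $ 2 * (s * B x $ 1)" if "x \<in> closure \<Omega>" for x
      using cross[OF that] by simp
    show "s * B x $ 1 * (s * B x $ 1) + s * B x $ 2 * (s * B x $ 2) \<noteq> 0" if "x \<in> closure \<Omega> - {xstar}" for x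
      unfolding sB using assms(14) that by simp
    show "s * B x $ 1 * (s * B x $ 1) + s * B x $ 2 * (s * B x $ 2) \<noteq> u x $ 1 * u x $ 1 + u x $ 2 * u x $ 2"
      if "x \<in> closure \<Omega> - {xstar}" for x
      unfolding sB norm2[of "u x", symmetric] using assms(17) that by simp
    \<comment> \<open>Squared lengths avoid roots in the core, hence the limit
      \<open>l\<^sup>2\<close>.\<close>
    show "((\<lambda>x. (u x $ 1 * u x $ 1 + u x $ 2 * u x $ 2) /
        (s * B x $ 1 * (s * B x $ 1) + s * B x $ 2 * (s * B x $ 2))) \<longlongrightarrow> l\<^sup>2) (at xstar)"
      unfolding sB norm2[of "u _", symmetric] using tendsto_power[OF assms(18), of 2] by (simp add: power_divide)
    show "continuous_on (closure \<Omega>) p" using mhd by blast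
    show "p x = 0" if "x \<in> frontier \<Omega>" for x using mhd that by blast
  next
    fix x b11 b12 b21 b22 u11 u12 u21 u22
    assume x: "x \<in> \<Omega> - {xstar}"
      and b1: "((\<lambda>x. s * B x $ 1) has_derivative (\<lambda>h. b11 * h $ 1 + b12 * h $ 2)) (at x)"
      and b2: "((\<lambda>x. s * B x $ 2) has_derivative (\<lambda>h. b21 * h $ 1 + b22 * h $ 2)) (at x)"
      and U1: "((\<lambda>x. u x $ 1) has_derivative (\<lambda>h. u11 * h $ 1 + u12 * h $ 2)) (at x)"
      and U2: "((\<lambda>x. u x $ 2) has_derivative (\<lambda>h. u21 * h $ 1 + u22 * h $ 2)) (at x)"
    have B1: "((\<lambda>x. B x $ 1) has_derivative (\<lambda>h. (s * b11) * h $ 1 + (s * b12) * h $ 2)) (at x)"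
      using has_derivative_mult_right[OF b1, of s] by (simp add: ss distrib_left mult.assoc)
    have B2: "((\<lambda>x. B x $ 2) has_derivative (\<lambda>h. (s * b21) * h $ 1 + (s * b22) * h $ 2)) (at x)"
      using has_derivative_mult_right[OF b2, of s] by (simp add: ss distrib_left mult.assoc)
    note FB = frechet_derivative_components[OF B1 B2] and FU = frechet_derivative_components[OF U1 U2]
    have eqs: "advect u u x - advect B B x = - grad p (at x)" "divergence B x = 0" "divergence u x = 0"
      and dp: "p differentiable (at x)" using mhd x by auto
    have div: "s * b11 + s * b22 = 0" "u11 + u22 = 0"
      using eqs(2,3) by (auto simp: divergence_def FB FU UNIV_2 axis_def)
    have "s * (b11 + b22) = 0" using div(1) by (simp add: algebra_simps)
    then have "b11 + b22 = 0" using s(2) by simp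
    moreover have "(p has_derivative (\<lambda>h. grad p (at x) $ 1 * h $ 1 + grad p (at x) $ 2 * h $ 2)) (at x)"
      using has_derivative_grad[OF dp] by (simp add: inner_real2)
    moreover have "u x $ 1 * u11 + u x $ 2 * u12 - (s * B x $ 1 * b11 + s * B x $ 2 * b12) = - grad p (at x) $ 1"
      "u x $ 1 * u21 + u x $ 2 * u22 - (s * B x $ 1 * b21 + s * B x $ 2 * b22) = - grad p (at x) $ 2"
      using arg_cong[OF eqs(1), of "\<lambda>v. v $ 1"] arg_cong[OF eqs(1), of "\<lambda>v. v $ 2"]
      by (simp_all add: advect_def FB FU algebra_simps)
    ultimately show "b11 + b22 = 0 \<and> u11 + u22 = 0 \<and>
      (\<exists>p1 p2. (p has_derivative (\<lambda>h. p1 * h $ 1 + p2 * h $ 2)) (at x) \<and>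
         u x $ 1 * u11 + u x $ 2 * u12 - (s * B x $ 1 * b11 + s * B x $ 2 * b12) = - p1 \<and>
         u x $ 1 * u21 + u x $ 2 * u22 - (s * B x $ 1 * b21 + s * B x $ 2 * b22) = - p2)"
      using div(2) by blast
  qed (use assms(7,10,12) \<Omega> s(3) CU in auto)
  obtain R where R: "R > 0" "\<Omega> = ball xstar R"
    using radial_open_set_is_ball[OF \<Omega> assms(12) radial_symmetry(1)] by blast
  have level: "A x = A y \<and> \<psi> x = \<psi> y" if "dist x xstar = dist y xstar" "x \<in> closure \<Omega>" "y \<in> closure \<Omega>" for x y
    using radial_symmetry(2)[OF that] s(2) by simp
  \<comment> \<open>A representative of each circle about the centre; evaluating \<open>A\<close>
    and \<psi> there gives the radial profiles.\<close>
  define pt where "pt r = (SOME x. x \<in> closure \<Omega> \<and> dist x xstar = r)" for r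
  have pt: "pt (dist x xstar) \<in> closure \<Omega>" "dist (pt (dist x xstar)) xstar = dist x xstar" if "x \<in> closure \<Omega>" for x
    using someI[of "\<lambda>y. y \<in> closure \<Omega> \<and> dist y xstar = dist x xstar" x] that by (auto simp: pt_def)
  show ?thesis
  proof (intro exI conjI ballI)
    show "R > 0" by (rule R)
    show "(\<lambda>x. x - xstar) ` \<Omega> = ball 0 R"
    proof (intro equalityI subsetI)
      fix y :: "real^2" assume "y \<in> ball 0 R"
      then have "y + xstar \<in> \<Omega>" by (simp add: R dist_norm)
      then show "y \<in> (\<lambda>x. x - xstar) ` \<Omega>" by (intro image_eqI[of _ _ "y + xstar"]) auto
    qed (auto simp: R dist_norm norm_minus_commute)
    show "measure lborel (ball (0::real^2) R) = measure lborel \<Omega>"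
      using R by (simp add: content_ball)
    fix x assume x: "x \<in> closure \<Omega>"
    show "A x = (\<lambda>r. A (pt r)) (dist x xstar)" "\<psi> x = (\<lambda>r. \<psi> (pt r)) (dist x xstar)"
      using level[of x "pt (dist x xstar)"] pt[OF x] x by simp_all
  qed
qed

end
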